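(* Let $n\ge 1$, let $x\in|X|$ be a closed point, let $r\in\{1,\dots,n\}$, and let $[g]\in G(F)\backslash G(\mathbb{A})/K$. The $\Phi_{x,r}$-neighbors of $[g]$ are the classes $[g\xi_w]$ with $w\in \mathrm{Gr}(n-r,n)(\kappa(x))$, and the multiplicity of an edge from $[g]$ to $[g']$ equals the number of $w\in\mathrm{Gr}(n-r,n)(\kappa(x))$ such that $[g\xi_w]=[g']$. The multiplicities of the edges originating in $[g]$ sum up to $\#\mathrm{Gr}(n-r,n)(\kappa(x))$.
   Context: $X$ is a geometrically irreducible smooth projective curve over a finite field $\mathbb{F}_q$ with function field $F$; $|X|$ is its set of closed points (= places of $F$). For $x\in|X|$: $F_x$ is the completion, $\mathcal{O}_x$ its ring of integers, $\pi_x\in F$ a uniformizer, $\kappa(x)=\mathcal{O}_x/(\pi_x)$ the residue field, viewed as a subfield of $\mathcal{O}_x\cong\kappa(x)[[\pi_x]]$, and $|\cdot|_x$ the absolute value with $|\pi_x|_x=(\#\kappa(x))^{-1}$. $\mathbb{A}$ is the adele ring of $F$, $\mathcal{O}_{\mathbb{A}}=\prod_x\mathcal{O}_x$, $G=\mathrm{GL}_n$, $Z$ is the center of $G$, $K=\mathrm{GL}_n(\mathcal{O}_{\mathbb{A}})$, and the Haar measure on $G(\mathbb{A})$ is normalized by $\mathrm{vol}(K)=1$. The Hecke algebra $\mathcal{H}$ is the space of locally constant compactly supported functions $\Phi:G(\mathbb{A})\to\mathbb{C}$ with the convolution product; it acts on continuous functions $f:G(\mathbb{A})\to\mathbb{C}$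 by $\Phi(f)(g)=\int_{G(\mathbb{A})}\Phi(h)f(gh)\,dh$. An unramified Hecke operator is a bi-$K$-invariant element of $\mathcal{H}$. The space $\mathcal{A}$ of automorphic forms (with trivial central character) consists of the continuous functions $f:G(\mathbb{A})\to\mathbb{C}$ that are locally constant, $K$-finite (the right translates of $f$ by $K$ span a finite-dimensional space), left $G(F)Z(\mathbb{A})$-invariant, $\mathcal{H}$-finite (the space $\mathcal{H}.f$ is finite-dimensional) and of moderate growth, i.e. $|f(g)|\le C\|g\|^N$ for some constants $C,N$ and all $g$, where $\|g\|=\prod_x\|g_x\|_x$ and $\|g_x\|_x$ is the maximum of the absolute values $|\cdot|_x$ of the entries of $g_x$ and of $\det(g_x)^{-1}$. $\mathcal{A}^K$ is the subspace of right $K$-invariant elements of $\mathcal{A}$. For an unramified Hecke operator $\Phi$ and $[g]\in G(F)\backslash G(\mathbb{A})/K$ there is a unique set of pairwise distinct classes $[g_1],\dots,[g_s]\in G(F)\backslash G(\mathbb{A})/K$ and numbers $m_1,\dots,m_s\in\mathbb{C}^*$ such that $\Phi(f)(g)=\sum_i m_i f(g_i)$ for all $f\in\mathcal{A}^K$. The graph $\mathcal{G}_{\Phi,K}$ has vertex set $G(F)\backslash G(\mathbb{A})/K$, and the edges with origin $[g]$ are the triples $([g],[g_i],m_i)$; the $[g_i]$ are called the $\Phi$-neighbors of $[g]$ and $m_i$ is the multiplicity of the edge. $\Phi_{x,r}$ is the characteristic function of $K\,\mathrm{diag}(\pi_x I_r, I_{n-r})\,K$, where $\pi_x$ is interpreted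 as the idele with component $\pi_x$ at $x$ and $1$ at all other places; neighbors and edges are those of its graph $\mathcal{G}_{x,r}:=\mathcal{G}_{\Phi_{x,r},K}$. $\mathrm{Gr}(k,n)(\kappa(x))$ is the set of $k$-dimensional linear subspaces of $\kappa(x)^n$. The matrices $\xi_w\in G(\mathbb{A})$, $w\in\mathrm{Gr}(k,n)(\kappa(x))$, are obtained from the Schubert cell decomposition: each $w$ has a unique basis in reduced form, given by an index set $\lambda\subseteq\{1,\dots,n\}$ with $\#\lambda=k$ and vectors $v_j$ ($j\in\lambda$) with $j$-th entry $1$, and $i$-th entry $0$ for $i>j$ and for $i\in\lambda$, $i\neq j$. Then $\xi_w$ is the upper triangular matrix with diagonal entries $\epsilon_j=1$ if $j\in\lambda$ and $\epsilon_j=\pi_x$ if $j\notin\lambda$, whose $(i,j)$ entry for $i<j$ is the $i$-th entry of $v_j$ if $j\in\lambda$ and $0$ if $j\notin\lambda$. Here $\pi_x$ is the idele with component $\pi_x$ at $x$ and $1$ elsewhere, and an off-diagonal entry $b\in\kappa(x)$ is the adele with component $b$ at $x$ and $0$ elsewhere. So $w\mapsto\xi_w$ is a bijection onto the set of upper triangular matrices with diagonal entries $\epsilon_i\in\{1,\pi_x\}$, exactly $k$ of them equal to $1$, and above-diagonal entries $b_{ij}\in\kappa(x)$ with $b_{ij}=0$ if $\epsilon_j=\pi_x$ or $\epsilon_i=1$.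
   Formalization: Neighbors and multiplicities are defined by testing on all functions on G(F)\G(A)/K instead of only f in A^K, since Z(A)-invariance of A^K makes the classes [g_i] non-unique (replace g_i by z g_i); the identity for f in A^K is proved as well. *)

theory Defs
  imports "HOL-Analysis.Analysis" "HOL-Algebra.Finite_Extensions" "HOL-Algebra.Generated_Fields"
    "Jordan_Normal_Form.Determinant" "Jordan_Normal_Form.VS_Connect"
begin

text \<open>A geometrically irreducible smooth projective curve over a finite field \<open>k\<close> is given by its
  function field: a field \<open>R\<close> that is a finite extension of \<open>k(t)\<close> for some \<open>t\<close> transcendental over
  \<open>k\<close>, and in which \<open>k\<close> is algebraically closed. As \<open>k\<close> is perfect, the last condition amounts to
  geometric irreducibility. The closed points of the curve are the places of \<open>R\<close>.\<close>

definition function_field_over :: "'a ring \<Rightarrow> 'a set \<Rightarrow> bool" where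
  "function_field_over R k \<longleftrightarrow>
     finite k \<and> subfield k R \<and>
     (\<exists>t\<in>carrier R. ring.transcendental R k t \<and>
        ring.finite_dimension R (generate_field R (insert t k)) (carrier R)) \<and>
     (\<forall>z\<in>carrier R. ring.algebraic R k z \<longrightarrow> z \<in> k)"

text \<open>Normalized discrete valuations; the value at \<open>0\<close> is a dummy. A finite subfield consists of \<open>0\<close>
  and roots of unity, so these valuations are automatically trivial on the field of constants.\<close>

definition is_valuation :: "('a::field \<Rightarrow> int) \<Rightarrow> bool" where
  "is_valuation v \<longleftrightarrow> v 0 = 0 \<and>
     (\<forall>a b. a \<noteq> 0 \<longrightarrow> b \<noteq> 0 \<longrightarrow> v (a * b) = v a + v b) \<and>
     (\<forall>a b. a \<noteq> 0 \<longrightarrow> b \<noteq> 0 \<longrightarrow> a + b \<noteq> 0 \<longrightarrow> min (v a) (v b) \<le> v (a + b)) \<and>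
     (\<exists>a. a \<noteq> 0 \<and> v a = 1)"

text \<open>The facts up to \<open>function_field_ex_valuation\<close> serve to show that every function field has a
  place, so that the type of places is inhabited and the adele ring is not the zero ring.\<close>

locale sring =
  fixes S :: "'a::field set"
  assumes one [simp]: "1 \<in> S" and add [simp]: "a \<in> S \<Longrightarrow> b \<in> S \<Longrightarrow> a + b \<in> S"
    and uminus [simp]: "a \<in> S \<Longrightarrow> - a \<in> S" and mult [simp]: "a \<in> S \<Longrightarrow> b \<in> S \<Longrightarrow> a * b \<in> S"
begin

lemma zero [simp]: "0 \<in> S"
  using add[OF one uminus[OF one]] by simp

lemma diff [simp]: "a \<in> S \<Longrightarrow> b \<in> S \<Longrightarrow> a - b \<in> S"
  using add[of a "- b"] by simp

lemma sum_in [simp]: "(\<And>i. i \<in> I \<Longrightarrow> f i \<in> S) \<Longrightarrow> sum f I \<in> S"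
  by (induction I rule: infinite_finite_induct) (auto simp: zero)

lemma pow [simp]: "a \<in> S \<Longrightarrow> a ^ n \<in> S"
  by (induction n) auto

definition L :: "nat \<Rightarrow> 'a \<Rightarrow> 'a set" where
  "L n z = {poly p z | p. (\<forall>i. Polynomial.coeff p i \<in> S) \<and> (\<forall>i\<ge>n. Polynomial.coeff p i = 0)}"

lemma L_add: "a \<in> L n z \<Longrightarrow> b \<in> L n z \<Longrightarrow> a + b \<in> L n z"
  unfolding L_def
  apply clarsimp
  subgoal for p q by (rule exI[of _ "p + q"]) auto
  done

lemma L_smult: "c \<in> S \<Longrightarrow> a \<in> L n z \<Longrightarrow> c * a \<in> L n z"
  unfolding L_def
  apply clarsimp
  subgoal for p by (rule exI[of _ "Polynomial.smult c p"]) auto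
  done

lemma L_pow: "i < n \<Longrightarrow> z ^ i \<in> L n z"
  unfolding L_def by (auto intro!: exI[of _ "Polynomial.monom 1 i"] simp: poly_monom)

lemma L_zero: "0 \<in> L n z"
  unfolding L_def by (auto intro!: exI[of _ 0])

lemma L_sum: "(\<And>i. i \<in> I \<Longrightarrow> f i \<in> L n z) \<Longrightarrow> sum f I \<in> L n z"
  by (induction I rule: infinite_finite_induct) (auto simp: L_zero L_add)

lemma L_mono: "m \<le> n \<Longrightarrow> L m z \<subseteq> L n z"
  unfolding L_def by fastforce

lemma poly_upto: "(\<forall>i\<ge>Suc n. Polynomial.coeff p i = 0) \<Longrightarrow> poly p x = (\<Sum>i\<le>n. Polynomial.coeff p i * (x::'a) ^ i)"
  unfolding poly_altdef
  by (rule sum.mono_neutral_left) (auto simp: not_less_eq_eq intro!: degree_le le_degree)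

lemma L_mult:
  assumes "a \<in> L n z" "b \<in> L m z"
  shows "a * b \<in> L (n + m) z"
proof -
  obtain p q where p: "a = poly p z" "\<And>i. Polynomial.coeff p i \<in> S" "\<And>i. i \<ge> n \<Longrightarrow> Polynomial.coeff p i = 0"
    and q: "b = poly q z" "\<And>i. Polynomial.coeff q i \<in> S" "\<And>i. i \<ge> m \<Longrightarrow> Polynomial.coeff q i = 0"
    using assms unfolding L_def by blast
  have "Polynomial.coeff (p * q) i = 0" if "i \<ge> n + m" for i
    unfolding coeff_mult
  proof (rule sum.neutral, intro ballI)
    fix j assume "j \<in> {..i}"
    then have "j \<ge> n \<or> i - j \<ge> m" using that by auto
    then show "Polynomial.coeff p j * Polynomial.coeff q (i - j) = 0" using p(3) q(3) by auto
  qed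
  moreover have "Polynomial.coeff (p * q) i \<in> S" for i
    unfolding coeff_mult using p q by auto
  ultimately show ?thesis unfolding L_def using p(1) q(1) by (auto intro!: exI[of _ "p * q"])
qed

lemma L_one: "L (Suc 0) z = S"
proof -
  have "poly p z \<in> S" if "\<forall>i. Polynomial.coeff p i \<in> S" "\<forall>i\<ge>Suc 0. Polynomial.coeff p i = 0" for p
  proof -
    have "p = [:Polynomial.coeff p 0:]"
      using that(2) by (intro poly_eqI) (auto simp: coeff_pCons split: nat.splits)
    then have "poly p z = Polynomial.coeff p 0" by (metis poly_0 poly_pCons mult_zero_right add.right_neutral)
    then show ?thesis using that by simp
  qed
  moreover have "\<exists>p. s = poly p z \<and> (\<forall>i. Polynomial.coeff p i \<in> S) \<and> (\<forall>i\<ge>Suc 0. Polynomial.coeff p i = 0)" if "s \<in> S" for s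
    using that by (intro exI[of _ "[:s:]"]) (auto simp: coeff_pCons split: nat.splits)
  ultimately show ?thesis unfolding L_def by blast
qed

lemma L_Suc:
  assumes "a \<in> L (Suc n) z"
  shows "\<exists>c. (\<forall>i. c i \<in> S) \<and> a = (\<Sum>i<n. c i * z ^ i) + c n * z ^ n"
proof -
  obtain p where p: "a = poly p z" "\<forall>i. Polynomial.coeff p i \<in> S" "\<forall>i\<ge>Suc n. Polynomial.coeff p i = 0"
    using assms unfolding L_def by blast
  have "a = (\<Sum>i\<le>n. Polynomial.coeff p i * z ^ i)" using p(1) poly_upto[OF p(3)] by simp
  then have "a = (\<Sum>i<n. Polynomial.coeff p i * z ^ i) + Polynomial.coeff p n * z ^ n"
    by (simp add: lessThan_Suc_atMost[symmetric])
  then show ?thesis using p(2) by blast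
qed

text \<open>The union of the \<open>L n z\<close> is the ring \<open>S[z]\<close>.\<close>

lemma adjoin_sring: "sring (\<Union>n. L n z)"
proof
  show "1 \<in> (\<Union>n. L n z)" using L_pow[of 0 1 z] by auto
  fix a b assume "a \<in> (\<Union>n. L n z)" "b \<in> (\<Union>n. L n z)"
  then obtain n m where nm: "a \<in> L n z" "b \<in> L m z" by auto
  show "a + b \<in> (\<Union>n. L n z)"
  proof -
    have "a \<in> L (max n m) z" "b \<in> L (max n m) z"
      using nm L_mono[of n "max n m" z] L_mono[of m "max n m" z] by (simp_all add: subset_iff)
    then show ?thesis using L_add by blast
  qed
  show "a * b \<in> (\<Union>n. L n z)" by (rule UN_I[OF UNIV_I, of _ _ "n + m"]) (rule L_mult[OF nm])
  show "- a \<in> (\<Union>n. L n z)" by (rule UN_I[OF UNIV_I, of _ _ n]) (use L_smult[of "-1" a n z] nm in simp)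
qed

lemma reduce:
  assumes z: "z \<noteq> 0" and t: "t \<in> S" "t \<noteq> 0" and 1: "inverse t \<in> L (Suc n) z"
    and 2: "inverse t \<in> L (Suc m) (inverse z)" and mn: "m \<le> n" "0 < n"
  shows "inverse t \<in> L n z"
proof -
  obtain a where a: "\<forall>i. a i \<in> S" "inverse t = (\<Sum>i<n. a i * z ^ i) + a n * z ^ n"
    using L_Suc[OF 1] by blast
  obtain p where p: "inverse t = poly p (inverse z)" "\<forall>i. Polynomial.coeff p i \<in> S" "\<forall>i\<ge>Suc m. Polynomial.coeff p i = 0"
    using 2 unfolding L_def by blast
  define b where "b = Polynomial.coeff p"
  have "inverse t = (\<Sum>j\<le>m. b j * inverse z ^ j)"
    unfolding b_def p(1) by (rule poly_upto[OF p(3)])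
  also have "\<dots> = b 0 + (\<Sum>j=1..m. b j * inverse z ^ j)"
    by (simp add: atMost_atLeast0 sum.atLeast_Suc_atMost)
  finally have b1: "inverse t = b 0 + (\<Sum>j=1..m. b j * inverse z ^ j)" .
  have b2: "(1 - t * b 0) * z ^ n = t * (\<Sum>j=1..m. b j * z ^ (n - j))"
  proof -
    have "1 - t * b 0 = t * (\<Sum>j=1..m. b j * inverse z ^ j)"
      using b1 t(2) by (simp add: field_simps)
    then have "(1 - t * b 0) * z ^ n = t * (\<Sum>j=1..m. b j * (inverse z ^ j * z ^ n))"
      by (simp add: sum_distrib_right mult.assoc)
    also have "(\<Sum>j=1..m. b j * (inverse z ^ j * z ^ n)) = (\<Sum>j=1..m. b j * z ^ (n - j))"
    proof (rule sum.cong)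
      fix j assume "j \<in> {1..m}"
      then have "z ^ n = z ^ (n - j) * z ^ j" using mn by (simp flip: power_add)
      then show "b j * (inverse z ^ j * z ^ n) = b j * z ^ (n - j)"
        using z by (simp add: power_inverse)
    qed simp
    finally show ?thesis .
  qed
  have "inverse t = b 0 + (1 - t * b 0) * inverse t" using t by (simp add: field_simps)
  also have "\<dots> = b 0 + (1 - t * b 0) * (\<Sum>i<n. a i * z ^ i) + a n * ((1 - t * b 0) * z ^ n)"
    unfolding a(2) by (simp add: algebra_simps)
  also have "\<dots> = b 0 * z ^ 0 + (1 - t * b 0) * (\<Sum>i<n. a i * z ^ i)
      + a n * (t * (\<Sum>j=1..m. b j * z ^ (n - j)))"
    unfolding b2 by simp
  also have "\<dots> \<in> L n z"
    using a(1) p(2) t mn unfolding b_def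
    by (intro L_add L_smult L_sum L_pow) auto
  finally show ?thesis .
qed

end

lemma sring_chain:
  assumes "C \<noteq> {}" "\<And>S. S \<in> C \<Longrightarrow> sring S" "\<And>S T. S \<in> C \<Longrightarrow> T \<in> C \<Longrightarrow> S \<subseteq> T \<or> T \<subseteq> S"
  shows "sring (\<Union>C)"
proof
  show "1 \<in> \<Union>C" using assms(1,2) sring.one by blast
  fix a b assume "a \<in> \<Union>C" "b \<in> \<Union>C"
  then obtain T where T: "T \<in> C" "a \<in> T" "b \<in> T" using assms(3) by blast
  show "a + b \<in> \<Union>C" using T sring.add[OF assms(2)[OF T(1)]] by blast
  show "a * b \<in> \<Union>C" using T sring.mult[OF assms(2)[OF T(1)]] by blast
  show "- a \<in> \<Union>C" using T sring.uminus[OF assms(2)[OF T(1)]] by blast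
qed

lemma ex_valuation_ring:
  assumes "sring R" "t \<in> R" "t \<noteq> 0" "inverse t \<notin> R"
  obtains S where "sring S" "R \<subseteq> S" "inverse t \<notin> S" "\<And>z::'a::field. z \<in> S \<or> inverse z \<in> S"
proof -
  define A where "A = {S. sring S \<and> R \<subseteq> S \<and> inverse t \<notin> S}"
  have "\<exists>M\<in>A. \<forall>Y\<in>A. M \<subseteq> Y \<longrightarrow> Y = M"
  proof (rule subset_Zorn_nonempty)
    show "A \<noteq> {}" using assms unfolding A_def by blast
    fix C assume C: "C \<noteq> {}" "subset.chain A C"
    then have C2: "C \<subseteq> A" "\<And>S T. S \<in> C \<Longrightarrow> T \<in> C \<Longrightarrow> S \<subseteq> T \<or> T \<subseteq> S"
      by (auto simp: subset_chain_def)
    have "sring (\<Union>C)"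
      by (rule sring_chain[OF C(1)]) (use C2 in \<open>auto simp: A_def\<close>)
    then show "\<Union>C \<in> A" using C(1) C2(1) unfolding A_def by blast
  qed
  then obtain S where SA: "S \<in> A" "\<And>Y. Y \<in> A \<Longrightarrow> S \<subseteq> Y \<Longrightarrow> Y = S" by auto
  then have S: "sring S" "R \<subseteq> S" "inverse t \<notin> S" unfolding A_def by auto
  have max: "Y = S" if "sring Y" "S \<subseteq> Y" "inverse t \<notin> Y" for Y
    using SA(2)[of Y] that S(2) unfolding A_def by auto
  interpret sring S by fact
  have tS: "t \<in> S" using S assms by blast
  have ex: "\<exists>n. inverse t \<in> L (Suc n) z" if "z \<notin> S" for z
  proof -
    have "S \<subseteq> (\<Union>n. L n z)" using L_one by auto
    moreover have "z \<in> (\<Union>n. L n z)" using L_pow[of 1 2 z] by auto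
    ultimately have "inverse t \<in> (\<Union>n. L n z)"
      using max[OF adjoin_sring] that by blast
    then obtain n where "inverse t \<in> L n z" by auto
    then show ?thesis using L_mono[of n "Suc n" z] by auto
  qed
  have "z \<in> S \<or> inverse z \<in> S" for z
  proof (rule ccontr)
    assume neg: "\<not> ?thesis"
    then have z0: "z \<noteq> 0" by auto
    define n where "n = (LEAST n. inverse t \<in> L (Suc n) z)"
    define m where "m = (LEAST n. inverse t \<in> L (Suc n) (inverse z))"
    have n: "inverse t \<in> L (Suc n) z" unfolding n_def by (rule LeastI_ex) (use ex neg in auto)
    have m: "inverse t \<in> L (Suc m) (inverse z)" unfolding m_def by (rule LeastI_ex) (use ex neg in auto)
    have n0: "0 < n" using n L_one S(3) by (cases n) auto
    have m0: "0 < m" using m L_one S(3) by (cases m) auto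
    show False
    proof (cases "m \<le> n")
      case True
      then have "inverse t \<in> L n z" using reduce[OF z0 tS assms(3) n m] n0 by blast
      then show False using not_less_Least[of "n - 1" "\<lambda>n. inverse t \<in> L (Suc n) z"] n0
        unfolding n_def[symmetric] by auto
    next
      case False
      then have "inverse t \<in> L m (inverse z)"
        using reduce[of "inverse z" t m n] z0 tS assms(3) n m m0 by auto
      then show False using not_less_Least[of "m - 1" "\<lambda>n. inverse t \<in> L (Suc n) (inverse z)"] m0
        unfolding m_def[symmetric] by auto
    qed
  qed
  then show ?thesis using that S by blast
qed

locale vring = sring S for S :: "'a::field set" +
  assumes val: "z \<in> S \<or> inverse z \<in> S"
begin

definition U :: "'a set" where "U = {z. z \<noteq> 0 \<and> z \<in> S \<and> inverse z \<in> S}"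
definition P :: "'a set" where "P = {z \<in> S. z = 0 \<or> inverse z \<notin> S}"

lemma U_mult: "a \<in> U \<Longrightarrow> b \<in> U \<Longrightarrow> a * b \<in> U"
  by (auto simp: U_def)

lemma U_inv: "a \<in> U \<Longrightarrow> inverse a \<in> U"
  by (auto simp: U_def)

lemma U_one: "1 \<in> U"
  by (auto simp: U_def)

lemma U_pow: "a \<in> U \<Longrightarrow> a ^ n \<in> U"
  by (induction n) (auto simp: U_one U_mult)

lemma P_zero: "0 \<in> P"
  by (auto simp: P_def)

lemma P_mult: assumes "a \<in> S" "b \<in> P" shows "a * b \<in> P"
proof -
  have "inverse b \<in> S" if "a * b \<noteq> 0" "inverse (a * b) \<in> S"
  proof -
    have "inverse b = a * inverse (a * b)" using that by (simp add: field_simps)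
    then show ?thesis using that(2) assms(1) mult by metis
  qed
  then show ?thesis using assms by (auto simp: P_def)
qed

lemma P_add: assumes "a \<in> P" "b \<in> P" shows "a + b \<in> P"
proof -
  have main: "a + b \<in> P" if "a \<in> P" "b \<in> P" "a \<noteq> 0" "b / a \<in> S" for a b
  proof -
    have "a + b = (1 + b / a) * a" using that(3) by (simp add: field_simps)
    moreover have "(1 + b / a) * a \<in> P" using that by (intro P_mult) auto
    ultimately show ?thesis by simp
  qed
  show ?thesis
  proof (cases "a = 0 \<or> b = 0")
    case True then show ?thesis using assms by auto
  next
    case False
    then show ?thesis using val[of "b / a"] main[of a b] main[of b a] assms
      by (auto simp: add.commute)
  qed
qed

lemma P_sum: "(\<And>i. i \<in> I \<Longrightarrow> f i \<in> P) \<Longrightarrow> sum f I \<in> P"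
  by (induction I rule: infinite_finite_induct) (auto simp: P_zero P_add)

lemma P_uminus: "a \<in> P \<Longrightarrow> - a \<in> P"
  using P_mult[of "-1" a] by simp

lemma U_not_P: "u \<in> U \<Longrightarrow> u \<notin> P"
  by (auto simp: U_def P_def)

lemma S_cases: "z \<in> S \<Longrightarrow> z \<in> U \<or> z \<in> P"
  by (auto simp: U_def P_def)

lemma U_plus: assumes "u \<in> U" "p \<in> P" shows "u + p \<in> U"
proof (rule ccontr)
  assume "u + p \<notin> U"
  moreover have "u + p \<in> S" using assms by (auto simp: U_def P_def)
  ultimately have "u + p \<in> P" using S_cases by blast
  then have "u + p + - p \<in> P" using P_add P_uminus assms(2) by blast
  then show False using U_not_P[OF assms(1)] by simp
qed

lemma ex_min:
  assumes "finite I" "I \<noteq> {}" "\<And>i. i \<in> I \<Longrightarrow> f i \<noteq> (0::'a)"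
  shows "\<exists>i0\<in>I. \<forall>i\<in>I. f i / f i0 \<in> S"
  using assms
proof (induction I rule: finite_ne_induct)
  case (singleton x) then show ?case by auto
next
  case (insert x F)
  then obtain i0 where i0: "i0 \<in> F" "\<forall>i\<in>F. f i / f i0 \<in> S" by auto
  have nz: "f x \<noteq> 0" "f i0 \<noteq> 0" using insert i0 by auto
  show ?case
  proof (cases "f x / f i0 \<in> S")
    case True
    then show ?thesis using i0 by (intro bexI[of _ i0]) auto
  next
    case False
    then have "f i0 / f x \<in> S" using val[of "f x / f i0"] by auto
    then have "f i / f x \<in> S" if "i \<in> F" for i
      using i0(2) that mult[of "f i / f i0" "f i0 / f x"] nz by auto
    then show ?thesis using nz by (intro bexI[of _ x]) auto
  qed
qed

lemma ex_associate:
  assumes "finite I" "(\<Sum>i\<in>I. f i) = 0" "i1 \<in> I" "f i1 \<noteq> 0"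
  shows "\<exists>i\<in>I. \<exists>j\<in>I. i \<noteq> j \<and> f i \<noteq> 0 \<and> f j \<noteq> 0 \<and> f i / f j \<in> U"
proof -
  define J where "J = {i \<in> I. f i \<noteq> 0}"
  have J: "finite J" "J \<noteq> {}" "\<And>i. i \<in> J \<Longrightarrow> f i \<noteq> 0" using assms by (auto simp: J_def)
  have "\<exists>i0\<in>J. \<forall>i\<in>J. f i / f i0 \<in> S" by (rule ex_min) (use J in auto)
  then obtain i0 where i0: "i0 \<in> J" "\<forall>i\<in>J. f i / f i0 \<in> S" by (elim bexE) (rule that)
  have "(\<Sum>i\<in>J. f i) = (\<Sum>i\<in>I. f i)"
    by (rule sum.mono_neutral_left) (use assms(1) in \<open>auto simp: J_def\<close>)
  then have "(\<Sum>i\<in>J. f i) = 0" using assms(2) by simp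
  then have "(\<Sum>i\<in>J. f i / f i0) = 0" by (simp flip: sum_divide_distrib)
  then have e: "1 + (\<Sum>i\<in>J - {i0}. f i / f i0) = 0"
    using i0(1) J by (simp add: sum.remove[of J i0])
  show ?thesis
  proof (rule ccontr)
    assume neg: "\<not> ?thesis"
    have "f i / f i0 \<in> P" if "i \<in> J - {i0}" for i
    proof -
      have ii: "i \<in> I" "i0 \<in> I" "i \<noteq> i0" "f i \<noteq> 0" "f i0 \<noteq> 0" using that i0(1) by (auto simp: J_def)
      have "f i / f i0 \<notin> U"
      proof
        assume "f i / f i0 \<in> U"
        then have "\<exists>i\<in>I. \<exists>j\<in>I. i \<noteq> j \<and> f i \<noteq> 0 \<and> f j \<noteq> 0 \<and> f i / f j \<in> U" using ii by (intro bexI[of _ i] bexI[of _ i0] conjI)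
        then show False using neg by (rule notE[rotated])
      qed
      then show ?thesis using S_cases i0(2) that by blast
    qed
    then have "(\<Sum>i\<in>J - {i0}. f i / f i0) \<in> P" by (rule P_sum)
    then have "1 + (\<Sum>i\<in>J - {i0}. f i / f i0) \<in> U" by (rule U_plus[OF U_one])
    then show False unfolding e by (simp add: U_def)
  qed
qed

end

lemma class_ring_inv: "(h::'a::field) \<noteq> 0 \<Longrightarrow> inv\<^bsub>class_ring\<^esub> h = inverse h"
  by (simp add: class_ring_simps)

lemma class_ring_a_inv: "\<ominus>\<^bsub>class_ring\<^esub> (h::'a::field) = - h"
  by (simp add: class_ring_simps)

lemmas class_ring_ring = field.is_ring[OF class_field]

lemma poly_Poly_snoc: "poly (Poly (xs @ [a])) (x::'a::field) = poly (Poly xs) x + a * x ^ length xs"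
  by (induction xs) (auto simp: algebra_simps)

lemma class_ring_eval: "ring.eval class_ring xs (x::'a::field) = poly (Poly (rev xs)) x"
  by (induction xs) (auto simp: ring.eval.simps[OF class_ring_ring] class_ring_simps poly_Poly_snoc)

lemma subfield_class_ring:
  assumes "subfield k (class_ring :: 'a::field ring)"
  shows "0 \<in> k" "1 \<in> k" "\<And>a b. a \<in> k \<Longrightarrow> b \<in> k \<Longrightarrow> a + b \<in> k" "\<And>a b. a \<in> k \<Longrightarrow> b \<in> k \<Longrightarrow> a * b \<in> k"
    "\<And>a. a \<in> k \<Longrightarrow> - a \<in> k" "\<And>a. a \<in> k \<Longrightarrow> inverse a \<in> k"
proof -
  have sr: "subring k (class_ring :: 'a ring)" using assms by (rule subfieldE)
  show "0 \<in> k" "1 \<in> k" "\<And>a b. a \<in> k \<Longrightarrow> b \<in> k \<Longrightarrow> a + b \<in> k" "\<And>a b. a \<in> k \<Longrightarrow> b \<in> k \<Longrightarrow> a * b \<in> k"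
    using subringE(2,3,6,7)[OF sr] by auto
  show "- a \<in> k" if "a \<in> k" for a
    using subringE(5)[OF sr that] by (simp add: class_ring_a_inv)
  show "inverse a \<in> k" if "a \<in> k" for a
    using ring.subfield_m_inv(1)[OF class_ring_ring assms, of a] that
    by (cases "a = 0") (auto simp: class_ring_inv)
qed

lemma transcendental_poly:
  assumes k: "subfield k (class_ring :: 'a::field ring)" and t: "ring.transcendental class_ring k t"
    and p: "\<forall>i. Polynomial.coeff p i \<in> k" "poly p t = 0"
  shows "p = 0"
proof (rule ccontr)
  assume p0: "p \<noteq> 0"
  have "set (coeffs p) \<subseteq> k" using p(1) by (auto simp: coeffs_def)
  then have "rev (coeffs p) \<in> carrier (k [X]\<^bsub>class_ring\<^esub>)"
    using p0 by (auto simp: univ_poly_def polynomial_def hd_rev last_coeffs_eq_coeff_degree)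
  moreover have "[] \<in> carrier (k [X]\<^bsub>class_ring\<^esub>)"
    by (simp add: univ_poly_def polynomial_def)
  moreover have "ring.eval class_ring (rev (coeffs p)) t = ring.eval class_ring [] t"
    unfolding class_ring_eval using p(2) by simp
  ultimately have "rev (coeffs p) = []"
    using t unfolding ring.transcendental_def[OF class_ring_ring] inj_on_def by blast
  then show False using p0 by simp
qed

definition pevals :: "'a::field set \<Rightarrow> 'a \<Rightarrow> 'a set" where
  "pevals k t = {poly p t | p. \<forall>i. Polynomial.coeff p i \<in> k}"

lemma sring_subfield: "subfield k (class_ring :: 'a::field ring) \<Longrightarrow> sring k"
  using subfield_class_ring[of k] by unfold_locales auto

lemma pevals_sring:
  assumes k: "subfield k (class_ring :: 'a::field ring)"
  shows "sring (pevals k t)" "k \<subseteq> pevals k t" "t \<in> pevals k t"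
proof -
  interpret sring k by (rule sring_subfield[OF k])
  show "sring (pevals k t)"
  proof
    show "1 \<in> pevals k t" unfolding pevals_def
      by (auto intro!: exI[of _ 1] simp: coeff_1)
    fix a b assume "a \<in> pevals k t" "b \<in> pevals k t"
    then obtain p q where p: "a = poly p t" "\<And>i. Polynomial.coeff p i \<in> k"
      and q: "b = poly q t" "\<And>i. Polynomial.coeff q i \<in> k" unfolding pevals_def by blast
    show "a + b \<in> pevals k t" unfolding pevals_def p(1) q(1)
      by (rule CollectI, rule exI[of _ "p + q"]) (use p q in auto)
    show "- a \<in> pevals k t" unfolding pevals_def p(1)
      by (rule CollectI, rule exI[of _ "- p"]) (use p q in auto)
    show "a * b \<in> pevals k t" unfolding pevals_def p(1) q(1)
      by (rule CollectI, rule exI[of _ "p * q"]) (use p q in \<open>auto simp: coeff_mult\<close>)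
  qed
  show "k \<subseteq> pevals k t"
  proof
    fix a assume "a \<in> k"
    then show "a \<in> pevals k t" unfolding pevals_def
      by (intro CollectI exI[of _ "[:a:]"]) (auto simp: coeff_pCons split: nat.splits)
  qed
  show "t \<in> pevals k t" unfolding pevals_def
    by (intro CollectI exI[of _ "[:0, 1:]"]) (auto simp: coeff_pCons split: nat.splits)
qed

lemma generate_field_frac:
  assumes k: "subfield k (class_ring :: 'a::field ring)"
    and z: "z \<in> generate_field class_ring (insert t k)"
  shows "\<exists>a\<in>pevals k t. \<exists>b\<in>pevals k t. b \<noteq> 0 \<and> z = a / b"
  using z
proof (induction rule: generate_field.induct)
  interpret R: sring "pevals k t" by (rule pevals_sring(1)[OF k])
  have int: "\<exists>a\<in>pevals k t. \<exists>b\<in>pevals k t. b \<noteq> 0 \<and> c = a / b" if "c \<in> pevals k t" for c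
    using that by (intro bexI[of _ c] bexI[of _ 1]) auto
  {
    case one show ?case using int[OF R.one] by simp
  next
    case (incl h)
    then have "h \<in> pevals k t" using pevals_sring(2,3)[OF k, of t] by auto
    then show ?case by (rule int)
  next
    case (a_inv h)
    then obtain a b where "a \<in> pevals k t" "b \<in> pevals k t" "b \<noteq> 0" "h = a / b" by blast
    then show ?case by (intro bexI[of _ "- a"] bexI[of _ b]) (auto simp: class_ring_a_inv)
  next
    case (m_inv h)
    then obtain a b where ab: "a \<in> pevals k t" "b \<in> pevals k t" "b \<noteq> 0" "h = a / b" by blast
    then show ?case using m_inv(2) by (intro bexI[of _ b] bexI[of _ a]) (auto simp: class_ring_inv)
  next
    case (eng_add h1 h2)
    then obtain a b c d where "a \<in> pevals k t" "b \<in> pevals k t" "b \<noteq> 0" "h1 = a / b"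
      "c \<in> pevals k t" "d \<in> pevals k t" "d \<noteq> 0" "h2 = c / d" by blast
    then show ?case by (intro bexI[of _ "a * d + c * b"] bexI[of _ "b * d"]) (auto simp: add_frac_eq)
  next
    case (eng_mult h1 h2)
    then obtain a b c d where "a \<in> pevals k t" "b \<in> pevals k t" "b \<noteq> 0" "h1 = a / b"
      "c \<in> pevals k t" "d \<in> pevals k t" "d \<noteq> 0" "h2 = c / d" by blast
    then show ?case by (intro bexI[of _ "a * c"] bexI[of _ "b * d"]) auto
  }
qed

lemma combine_sum:
  "length Ks = length Us \<Longrightarrow>
    ring.combine class_ring Ks Us = (\<Sum>i<length Us. Ks ! i * (Us ! i :: 'a::field))"
proof (induction Ks Us rule: list_induct2)
  case (Cons x xs y ys)
  then show ?case by (simp add: ring.combine.simps[OF class_ring_ring] sum.lessThan_Suc_shift del: sum.lessThan_Suc)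
qed (simp add: ring.combine.simps[OF class_ring_ring])

lemma finite_dimension_relation:
  fixes K :: "'a::field set"
  assumes K: "subfield K (class_ring :: 'a ring)" and d: "ring.dimension class_ring N K UNIV"
  shows "\<exists>c. (\<forall>i\<le>N. c i \<in> K) \<and> (\<exists>i\<le>N. c i \<noteq> 0) \<and> (\<Sum>i\<le>N. c i * z ^ i) = 0"
proof -
  define Us where "Us = map (\<lambda>i. z ^ i) [0..<Suc N]"
  have dep: "ring.dependent class_ring K Us"
    using ring.independent_length_le_dimension[OF class_ring_ring K d, of Us] unfolding Us_def by auto
  obtain Ks where Ks: "length Ks = length Us" "ring.combine class_ring Ks Us = 0"
    "set Ks \<subseteq> K" "set Ks \<noteq> {0}"
    by (rule ring.dependent_imp_non_trivial_combine[OF class_ring_ring K _ dep]) (auto intro: that)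
  have len: "length Us = Suc N" by (simp add: Us_def)
  have "(\<Sum>i<Suc N. Ks ! i * z ^ i) = 0"
    using combine_sum[OF Ks(1)] Ks(2) unfolding len by (simp add: Us_def nth_append)
  then have 1: "(\<Sum>i\<le>N. Ks ! i * z ^ i) = 0" by (simp only: lessThan_Suc_atMost)
  have "\<exists>a\<in>set Ks. a \<noteq> 0" using Ks(4) Ks(1) len by (cases Ks) auto
  then have 2: "\<exists>i\<le>N. Ks ! i \<noteq> 0" using Ks(1) len by (auto simp: in_set_conv_nth less_Suc_eq_le)
  have 3: "\<forall>i\<le>N. Ks ! i \<in> K" using Ks(1,3) len by (auto simp: subset_iff less_Suc_eq_le)
  show ?thesis using 1 2 3 by blast
qed

locale vring_t = vring S for S :: "'a::field set" +
  fixes t :: 'a and k :: "'a set"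
  assumes tP: "t \<in> P" and t0: "t \<noteq> 0" and k: "subfield k (class_ring :: 'a ring)" and kS: "k \<subseteq> S"
begin

lemma tpow_U: "t ^ n \<in> U \<Longrightarrow> n = 0"
proof (rule ccontr)
  assume u: "t ^ n \<in> U" and "n \<noteq> 0"
  then have "t ^ n = t ^ (n - 1) * t" by (simp flip: power_Suc2)
  moreover have "t ^ (n - 1) * t \<in> P" using tP by (intro P_mult pow) (auto simp: P_def)
  ultimately show False using U_not_P u by auto
qed

lemma tpowi_U: assumes "t powi e \<in> U" shows "e = 0"
proof (cases "e \<ge> 0")
  case True
  then show ?thesis using tpow_U[of "nat e"] assms by (simp add: power_int_def)
next
  case False
  then show ?thesis using tpow_U[of "nat (- e)"] U_inv[OF assms] by (simp add: power_int_def power_inverse)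
qed

lemma tpowi_S: assumes "u \<in> U" shows "u * t powi e \<in> S \<longleftrightarrow> e \<ge> 0"
proof
  assume "e \<ge> 0"
  then show "u * t powi e \<in> S" using assms tP by (auto simp: power_int_def U_def P_def)
next
  assume s: "u * t powi e \<in> S"
  show "e \<ge> 0"
  proof (rule ccontr)
    assume "\<not> e \<ge> 0"
    then have e: "e < 0" by simp
    have "inverse u * (u * t powi e) \<in> S" by (rule mult[OF _ s]) (use assms in \<open>simp add: U_def\<close>)
    moreover have "inverse u * (u * t powi e) = t powi e" using assms by (simp add: U_def)
    ultimately have 1: "t powi e \<in> S" by simp
    have "inverse (t powi e) = t ^ nat (- e)" using e by (simp add: power_int_def power_inverse)
    moreover have "t ^ nat (- e) \<in> S" using tP by (auto simp: P_def)
    ultimately have "t powi e \<in> U" using 1 t0 by (simp add: U_def)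
    then show False using tpowi_U e by auto
  qed
qed

lemma k_U: "a \<in> k \<Longrightarrow> a \<noteq> 0 \<Longrightarrow> a \<in> U"
  using subfield_class_ring(6)[OF k, of a] kS by (auto simp: U_def)

lemma poly_S: "(\<And>i. Polynomial.coeff p i \<in> k) \<Longrightarrow> poly p t \<in> S"
  unfolding poly_altdef using kS tP by (intro sum_in mult pow) (auto simp: P_def)

lemma poly_assoc: "(\<And>i. Polynomial.coeff p i \<in> k) \<Longrightarrow> p \<noteq> 0 \<Longrightarrow> \<exists>u\<in>U. \<exists>n. poly p t = u * t ^ n"
proof (induction p)
  case (pCons a p)
  have ck: "Polynomial.coeff p i \<in> k" for i using pCons.prems(1)[of "Suc i"] by simp
  have ak: "a \<in> k" using pCons.prems(1)[of 0] by simp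
  show ?case
  proof (cases "a = 0")
    case True
    then have "p \<noteq> 0" using pCons.prems(2) by auto
    then obtain u n where un: "u \<in> U" "poly p t = u * t ^ n" using pCons.IH ck by blast
    have "poly (pCons a p) t = u * t ^ Suc n" using True un(2) by simp
    then show ?thesis using un(1) by blast
  next
    case False
    have "poly p t * t \<in> P" using P_mult[OF poly_S[OF ck] tP] .
    then have "a + poly p t * t \<in> U" using U_plus[OF k_U[OF ak False]] by blast
    then show ?thesis by (intro bexI[of _ "a + poly p t * t"] exI[of _ 0]) (auto simp: mult.commute)
  qed
qed simp

lemma pevals_assoc:
  assumes "z \<in> pevals k t" "z \<noteq> 0"
  shows "\<exists>u\<in>U. \<exists>n. z = u * t ^ n"
proof -
  obtain p where p: "z = poly p t" "\<And>i. Polynomial.coeff p i \<in> k"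
    using assms(1) unfolding pevals_def by blast
  have "p \<noteq> 0" using assms(2) p(1) by auto
  then show ?thesis using poly_assoc[of p] p by simp
qed

lemma K_assoc:
  assumes "z \<in> generate_field class_ring (insert t k)" "z \<noteq> 0"
  shows "\<exists>u\<in>U. \<exists>e. z = u * t powi e"
proof -
  obtain a b where ab: "a \<in> pevals k t" "b \<in> pevals k t" "b \<noteq> 0" "z = a / b"
    using generate_field_frac[OF k assms(1)] by (elim bexE conjE) (rule that)
  then have a0: "a \<noteq> 0" using assms(2) by auto
  obtain u n where un: "u \<in> U" "a = u * t ^ n"
    using pevals_assoc[OF ab(1) a0] by (elim bexE exE) (rule that)
  obtain u' n' where un': "u' \<in> U" "b = u' * t ^ n'"
    using pevals_assoc[OF ab(2,3)] by (elim bexE exE) (rule that)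
  have "z = (u * inverse u') * t powi (int n - int n')"
    unfolding ab(4) un(2) un'(2) using t0 by (simp add: power_int_diff field_simps)
  moreover have "u * inverse u' \<in> U" using U_mult[OF un(1) U_inv[OF un'(1)]] .
  ultimately show ?thesis by blast
qed

lemma pow_assoc:
  assumes N: "ring.dimension class_ring N (generate_field class_ring (insert t k)) UNIV" and z: "z \<noteq> 0"
  shows "\<exists>u\<in>U. \<exists>e. z ^ fact N = u * t powi e"
proof -
  let ?K = "generate_field (class_ring :: 'a ring) (insert t k)"
  have K: "subfield ?K (class_ring :: 'a ring)"
    by (rule field.generate_field_is_subfield[OF class_field]) auto
  from finite_dimension_relation[OF K N, of z]
  obtain c where c: "\<forall>i\<le>N. c i \<in> ?K" "\<exists>i\<le>N. c i \<noteq> 0" "(\<Sum>i\<le>N. c i * z ^ i) = 0"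
    by auto
  have "\<exists>i\<in>{..N}. \<exists>j\<in>{..N}. i \<noteq> j \<and> c i * z ^ i \<noteq> 0 \<and> c j * z ^ j \<noteq> 0 \<and> (c i * z ^ i) / (c j * z ^ j) \<in> U"
    using c(2,3) z ex_associate[of "{..N}" "\<lambda>i. c i * z ^ i"] by auto
  then obtain i j where ij: "i \<le> N" "j \<le> N" "i \<noteq> j" "c i \<noteq> 0" "c j \<noteq> 0"
    "(c i * z ^ i) / (c j * z ^ j) \<in> U" by auto
  have sym: "(c j * z ^ j) / (c i * z ^ i) \<in> U" using U_inv[OF ij(6)] by simp
  have main: "\<exists>u\<in>U. \<exists>e. z ^ fact N = u * t powi e"
    if ij: "i < j" "i \<le> N" "j \<le> N" "c i \<noteq> 0" "c j \<noteq> 0" "(c j * z ^ j) / (c i * z ^ i) \<in> U" for i j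
  proof -
    define d where "d = j - i"
    have d: "1 \<le> d" "d \<le> N" using ij by (auto simp: d_def)
    obtain u1 e1 where 1: "u1 \<in> U" "c i = u1 * t powi e1"
      using K_assoc[of "c i"] c(1) ij(2,4) by auto
    obtain u2 e2 where 2: "u2 \<in> U" "c j = u2 * t powi e2"
      using K_assoc[of "c j"] c(1) ij(3,5) by auto
    define u3 where "u3 = (c j * z ^ j) / (c i * z ^ i)"
    define u where "u = u3 * u1 * inverse u2"
    have uU: "u \<in> U" unfolding u_def u3_def
      by (rule U_mult[OF U_mult[OF ij(6) 1(1)] U_inv[OF 2(1)]])
    have u20: "u2 \<noteq> 0" "u1 \<noteq> 0" using 1 2 by (auto simp: U_def)
    have "z ^ j = z ^ i * z ^ d" unfolding d_def using ij(1) by (simp flip: power_add)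
    then have "u3 * c i = c j * z ^ d" using ij(4) z unfolding u3_def by simp
    then have "z ^ d = u3 * c i / c j" using ij(5) by (simp add: field_simps)
    also have "\<dots> = u * t powi (e1 - e2)"
      unfolding 1(2) 2(2) u_def using u20 t0 by (simp add: power_int_diff field_simps)
    finally have zd: "z ^ d = u * t powi (e1 - e2)" .
    have "d dvd fact N" using d dvd_fact by blast
    then obtain m where m: "fact N = d * m" by (elim dvdE)
    have "z ^ fact N = (z ^ d) ^ m" unfolding m by (simp add: power_mult)
    also have "\<dots> = u ^ m * t powi ((e1 - e2) * int m)"
      unfolding zd by (simp add: power_mult_distrib power_int_mult)
    finally show ?thesis using U_pow[OF uU, of m] by blast
  qed
  show ?thesis
  proof (cases "i < j")
    case True
    show ?thesis by (rule main[OF True ij(1,2,4,5) sym])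
  next
    case False
    then have "j < i" using ij(3) by simp
    then show ?thesis by (rule main[OF _ ij(2,1,5,4,6)])
  qed
qed

lemma pow_S: assumes "M > 0" "z ^ M \<in> S" shows "z \<in> S"
proof (rule ccontr)
  assume z: "z \<notin> S"
  then have iz: "inverse z \<in> S" "z \<noteq> 0" using val[of z] by auto
  have "z ^ M * inverse z ^ (M - 1) = z"
    using iz(2) assms(1) by (cases M) (auto simp: power_inverse)
  moreover have "z ^ M * inverse z ^ (M - 1) \<in> S" by (rule mult[OF assms(2) pow[OF iz(1)]])
  ultimately show False using z by simp
qed

lemma ex_valuation:
  assumes N: "ring.dimension class_ring N (generate_field class_ring (insert t k)) UNIV"
  shows "\<exists>v :: 'a \<Rightarrow> int. is_valuation v"
proof -
  define M :: nat where "M = fact N"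
  have M: "M > 0" by (simp add: M_def)
  have "\<forall>z. \<exists>e. z \<noteq> 0 \<longrightarrow> (\<exists>u\<in>U. z ^ M = u * t powi e)"
    using pow_assoc[OF N] unfolding M_def by blast
  then obtain w where w0: "\<forall>z. z \<noteq> 0 \<longrightarrow> (\<exists>u\<in>U. z ^ M = u * t powi w z)"
    by (elim exE[OF choice]) (rule that)
  then have w: "\<exists>u\<in>U. z ^ M = u * t powi w z" if "z \<noteq> 0" for z using that by simp
  have uniq: "e = e'" if "u \<in> U" "u' \<in> U" "u * t powi e = u' * t powi e'" for u u' e e'
  proof -
    have "t powi (e - e') = u' * inverse u"
      using that t0 by (simp add: power_int_diff field_simps U_def)
    then have "t powi (e - e') \<in> U" using U_mult[OF that(2) U_inv[OF that(1)]] by simp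
    then show ?thesis using tpowi_U[of "e - e'"] by simp
  qed
  have w_eq: "w z = e" if zu: "z \<noteq> 0" "u \<in> U" "z ^ M = u * t powi e" for z u e
  proof -
    obtain u' where u': "u' \<in> U" "z ^ M = u' * t powi w z" using w[OF zu(1)] by (elim bexE) (rule that)
    then show ?thesis using uniq[OF u'(1) zu(2)] zu(3) by simp
  qed
  have w_mult: "w (a * b) = w a + w b" if ab: "a \<noteq> 0" "b \<noteq> 0" for a b
  proof -
    obtain u1 where u1: "u1 \<in> U" "a ^ M = u1 * t powi w a" using w[OF ab(1)] by (elim bexE) (rule that)
    obtain u2 where u2: "u2 \<in> U" "b ^ M = u2 * t powi w b" using w[OF ab(2)] by (elim bexE) (rule that)
    show ?thesis
      by (rule w_eq[OF _ U_mult[OF u1(1) u2(1)]])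
        (use ab t0 u1(2) u2(2) in \<open>auto simp: power_mult_distrib power_int_add\<close>)
  qed
  have w_S: "z \<in> S \<longleftrightarrow> w z \<ge> 0" if z: "z \<noteq> 0" for z
  proof -
    obtain u where u: "u \<in> U" "z ^ M = u * t powi w z" using w[OF z] by (elim bexE) (rule that)
    have "z \<in> S \<longleftrightarrow> z ^ M \<in> S" using pow_S[OF M, of z] by auto
    then show ?thesis using tpowi_S[OF u(1)] u(2) by simp
  qed
  have w_inv: "w (inverse a) = - w a" if "a \<noteq> 0" for a
  proof -
    have "w 1 = 0" using w_mult[of 1 1] by simp
    then show ?thesis using w_mult[of a "inverse a"] that by simp
  qed
  have w_le: "w a \<le> w (a + b)" if ab: "a \<noteq> 0" "b \<noteq> 0" "a + b \<noteq> 0" "w a \<le> w b" for a b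
  proof -
    have "w (b / a) \<ge> 0" using w_mult[of b "inverse a"] w_inv[of a] ab by (simp add: divide_inverse)
    then have "1 + b / a \<in> S" using w_S[of "b / a"] ab by auto
    moreover have e: "1 + b / a = (a + b) * inverse a" using ab(1) by (simp add: field_simps)
    ultimately have "w ((a + b) * inverse a) \<ge> 0" using w_S[of "(a + b) * inverse a"] ab by auto
    then show ?thesis using w_mult[of "a + b" "inverse a"] w_inv[of a] ab by auto
  qed
  have w_add: "min (w a) (w b) \<le> w (a + b)" if ab: "a \<noteq> 0" "b \<noteq> 0" "a + b \<noteq> 0" for a b
    using w_le[OF ab] w_le[of b a] ab by (auto simp: add.commute min_def)
  have w_pow: "w (a powi e) = e * w a" if a: "a \<noteq> 0" for a e
  proof -
    have n: "w (a ^ n) = int n * w a" for n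
    proof (induction n)
      case 0 show ?case using w_mult[of 1 1] by simp
    next
      case (Suc n) then show ?case using w_mult[of a "a ^ n"] a by (simp add: algebra_simps)
    qed
    show ?thesis
    proof (cases "e \<ge> 0")
      case True then show ?thesis using n[of "nat e"] by (simp add: power_int_def)
    next
      case False then show ?thesis using n[of "nat (- e)"] w_inv[of "a ^ nat (- e)"] a
        by (simp add: power_int_def power_inverse)
    qed
  qed
  have wt: "w t = int M" by (rule w_eq[OF t0 U_one]) simp
  define D where "D = {n::nat. n > 0 \<and> (\<exists>a. a \<noteq> 0 \<and> w a = int n)}"
  define d where "d = (LEAST n. n \<in> D)"
  have "M \<in> D" unfolding D_def using wt M t0 by auto
  then have dD: "d \<in> D" unfolding d_def by (rule LeastI)
  then obtain a where a: "a \<noteq> 0" "w a = int d" "d > 0" unfolding D_def by auto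
  have ddvd: "int d dvd w z" if z: "z \<noteq> 0" for z
  proof (rule ccontr)
    assume nd: "\<not> int d dvd w z"
    define r where "r = w z mod int d"
    have r: "0 \<le> r" "r < int d" "r \<noteq> 0" using a(3) nd by (auto simp: r_def dvd_eq_mod_eq_0)
    have "w (z * a powi (- (w z div int d))) = w z - w z div int d * int d"
      using w_mult[of z "a powi (- (w z div int d))"] w_pow[OF a(1)] z a by simp
    also have "\<dots> = r" by (simp add: r_def minus_div_mult_eq_mod)
    finally have "nat r \<in> D" using r z a(1) unfolding D_def
      by (auto intro!: exI[of _ "z * a powi (- (w z div int d))"])
    then have "d \<le> nat r" unfolding d_def by (rule Least_le)
    then show False using r by auto
  qed
  define v where "v z = (if z = 0 then 0 else w z div int d)" for z
  have wv: "w z = int d * v z" if "z \<noteq> 0" for z using ddvd[OF that] that by (simp add: v_def)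
  have "is_valuation v" unfolding is_valuation_def
  proof (intro conjI allI impI)
    show "v 0 = 0" by (simp add: v_def)
    show "v (x * y) = v x + v y" if xy: "x \<noteq> 0" "y \<noteq> 0" for x y
    proof -
      have "int d * v (x * y) = int d * (v x + v y)"
        using w_mult[OF xy] xy wv[of x] wv[of y] wv[of "x * y"] by (simp add: distrib_left)
      then show ?thesis using a(3) by simp
    qed
    show "min (v x) (v y) \<le> v (x + y)" if xy: "x \<noteq> 0" "y \<noteq> 0" "x + y \<noteq> 0" for x y
    proof -
      have "int d * min (v x) (v y) \<le> int d * v (x + y)"
        using w_add[OF xy] wv[OF xy(1)] wv[OF xy(2)] wv[OF xy(3)] a(3) by (auto simp: min_def)
      then show ?thesis using a(3) by simp
    qed
    show "\<exists>x. x \<noteq> 0 \<and> v x = 1" using a wv[OF a(1)] by (intro exI[of _ a]) auto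
  qed
  then show ?thesis by blast
qed

end

lemma function_field_ex_valuation:
  assumes "function_field_over (class_ring :: 'a::field ring) k"
  shows "\<exists>v :: 'a \<Rightarrow> int. is_valuation v"
proof -
  have k: "subfield k (class_ring :: 'a ring)" using assms by (simp add: function_field_over_def)
  obtain t N where t: "ring.transcendental class_ring k t"
    and N: "ring.dimension class_ring N (generate_field class_ring (insert t k)) UNIV"
    using assms unfolding function_field_over_def ring.finite_dimension_def[OF class_ring_ring] by auto
  have t0: "t \<noteq> 0"
  proof
    assume "t = 0"
    moreover have "\<forall>i. Polynomial.coeff [:0, 1:] i \<in> k"
      using subfield_class_ring(1,2)[OF k] by (simp add: coeff_pCons split: nat.splits)
    ultimately show False using transcendental_poly[OF k t, of "[:0, 1:]"] by simp
  qed
  have nin: "inverse t \<notin> pevals k t"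
  proof
    assume "inverse t \<in> pevals k t"
    then obtain p where p: "inverse t = poly p t" "\<And>i. Polynomial.coeff p i \<in> k"
      unfolding pevals_def by blast
    have "poly (pCons (-1) p) t = 0" using t0 by (simp flip: p(1))
    moreover have "\<forall>i. Polynomial.coeff (pCons (-1) p) i \<in> k"
      using p(2) subfield_class_ring(2)[OF k] subfield_class_ring(5)[OF k, of 1]
      by (auto simp: coeff_pCons split: nat.splits)
    ultimately show False using transcendental_poly[OF k t] by fastforce
  qed
  obtain S where S: "sring S" "pevals k t \<subseteq> S" "inverse t \<notin> S" "\<And>z. z \<in> S \<or> inverse z \<in> S"
    by (rule ex_valuation_ring[OF pevals_sring(1,3)[OF k] t0 nin]) (rule that)
  interpret vring S by (intro vring.intro vring_axioms.intro S)
  interpret vring_t S t k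
    by (intro vring_t.intro vring_axioms vring_t_axioms.intro)
      (use S(2,3) pevals_sring(2,3)[OF k, of t] t0 k in \<open>auto simp: P_def\<close>)
  show ?thesis by (rule ex_valuation[OF N])
qed

class function_field = field +
  fixes const_field :: "'a set"
  assumes function_field:
    "function_field_over \<lparr>carrier = UNIV, mult = (*), one = 1, zero = 0, add = (+)\<rparr> const_field"

typedef (overloaded) 'a place = "{v :: 'a::function_field \<Rightarrow> int. is_valuation v}"
  morphisms val Abs_place
  using function_field_ex_valuation[OF function_field] by auto

lemma is_valuation_val: "is_valuation (val x)"
  using val[of x] by simp

text \<open>\<open>v a \<ge> M\<close> with the convention \<open>v 0 = \<infinity>\<close>.\<close>

definition val_ge :: "('a::field \<Rightarrow> int) \<Rightarrow> int \<Rightarrow> 'a \<Rightarrow> bool" where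
  "val_ge v M a \<longleftrightarrow> a = 0 \<or> M \<le> v a"

definition cauchy_seqs :: "('a::field \<Rightarrow> int) \<Rightarrow> (nat \<Rightarrow> 'a) set" where
  "cauchy_seqs v = {s. \<forall>M. \<exists>N. \<forall>i\<ge>N. \<forall>j\<ge>N. val_ge v M (s i - s j)}"

definition null_seqs :: "('a::field \<Rightarrow> int) \<Rightarrow> (nat \<Rightarrow> 'a) set" where
  "null_seqs v = {s. \<forall>M. \<exists>N. \<forall>i\<ge>N. val_ge v M (s i)}"

definition cauchy_ring :: "('a::field \<Rightarrow> int) \<Rightarrow> (nat \<Rightarrow> 'a) ring" where
  "cauchy_ring v = \<lparr>carrier = cauchy_seqs v, mult = (\<lambda>s t i. s i * t i), one = (\<lambda>i. 1),
                    zero = (\<lambda>i. 0), add = (\<lambda>s t i. s i + t i)\<rparr>"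

lemma cauchy_ring_simps:
  "carrier (cauchy_ring v) = cauchy_seqs v"
  "s \<otimes>\<^bsub>cauchy_ring v\<^esub> t = (\<lambda>i. s i * t i)"
  "s \<oplus>\<^bsub>cauchy_ring v\<^esub> t = (\<lambda>i. s i + t i)"
  "\<one>\<^bsub>cauchy_ring v\<^esub> = (\<lambda>i. 1)" "\<zero>\<^bsub>cauchy_ring v\<^esub> = (\<lambda>i. 0)"
  by (simp_all add: cauchy_ring_def)

text \<open>Elements of the completion are classes of Cauchy sequences modulo null sequences.\<close>

definition completion_ring :: "('a::field \<Rightarrow> int) \<Rightarrow> (nat \<Rightarrow> 'a) set ring" where
  "completion_ring v = cauchy_ring v Quot null_seqs v"

definition to_completion :: "('a::field \<Rightarrow> int) \<Rightarrow> 'a \<Rightarrow> (nat \<Rightarrow> 'a) set" where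
  "to_completion v a = null_seqs v +>\<^bsub>cauchy_ring v\<^esub> (\<lambda>i. a)"

text \<open>The power \<open>(\<pi>^M)\<close> of the maximal ideal \<open>(\<pi>)\<close> of the ring of integers of the completion, as the
  closure of \<open>{a. v a \<ge> M}\<close>. For \<open>M = 0\<close> this is the ring of integers itself.\<close>

definition ideal_power :: "('a::field \<Rightarrow> int) \<Rightarrow> int \<Rightarrow> (nat \<Rightarrow> 'a) set set" where
  "ideal_power v M = {\<alpha> \<in> carrier (completion_ring v). \<exists>s\<in>\<alpha>. \<forall>i. val_ge v M (s i)}"

context
  fixes v :: "'a::field \<Rightarrow> int"
  assumes v: "is_valuation v"
begin

lemma val_mult: "a \<noteq> 0 \<Longrightarrow> b \<noteq> 0 \<Longrightarrow> v (a * b) = v a + v b"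
  using v by (simp add: is_valuation_def)

lemma val_one: "v 1 = 0"
  using val_mult[of 1 1] by simp

lemma val_uminus: "v (- a) = v a"
proof (cases "a = 0")
  case False
  have "v (-1) = 0" using val_mult[of "-1" "-1"] val_one by simp
  then show ?thesis using val_mult[of "-1" a] False by simp
qed simp

lemma val_ge_add: "val_ge v M a \<Longrightarrow> val_ge v M b \<Longrightarrow> val_ge v M (a + b)"
proof -
  assume a: "val_ge v M a" "val_ge v M b"
  have "min (v a) (v b) \<le> v (a + b)" if "a \<noteq> 0" "b \<noteq> 0" "a + b \<noteq> 0"
    using v that by (simp add: is_valuation_def)
  then show ?thesis using a
    by (cases "a = 0"; cases "b = 0"; cases "a + b = 0") (auto simp: val_ge_def min_def split: if_splits)
qed

lemma val_ge_uminus: "val_ge v M (- a) = val_ge v M a"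
  by (simp add: val_ge_def val_uminus)

lemma val_ge_mult: "val_ge v M a \<Longrightarrow> val_ge v N b \<Longrightarrow> val_ge v (M + N) (a * b)"
  by (cases "a = 0"; cases "b = 0") (auto simp: val_ge_def val_mult)

lemma val_ge_mono: "val_ge v M a \<Longrightarrow> N \<le> M \<Longrightarrow> val_ge v N a"
  by (auto simp: val_ge_def)

lemma val_ge_zero: "val_ge v M 0"
  by (simp add: val_ge_def)

lemma val_ge_one: "val_ge v 0 1"
  by (simp add: val_ge_def val_one)

lemma cauchy_add: "s \<in> cauchy_seqs v \<Longrightarrow> t \<in> cauchy_seqs v \<Longrightarrow> (\<lambda>i. s i + t i) \<in> cauchy_seqs v"
proof -
  assume st: "s \<in> cauchy_seqs v" "t \<in> cauchy_seqs v"
  have "\<exists>N. \<forall>i\<ge>N. \<forall>j\<ge>N. val_ge v M (s i + t i - (s j + t j))" for M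
  proof -
    obtain N where N: "\<forall>i\<ge>N. \<forall>j\<ge>N. val_ge v M (s i - s j)" using st(1) unfolding cauchy_seqs_def by blast
    obtain N' where N': "\<forall>i\<ge>N'. \<forall>j\<ge>N'. val_ge v M (t i - t j)" using st(2) unfolding cauchy_seqs_def by blast
    show ?thesis
    proof (intro exI[of _ "max N N'"] allI impI)
      fix i j assume "max N N' \<le> i" "max N N' \<le> j"
      then have "val_ge v M ((s i - s j) + (t i - t j))" using N N' by (intro val_ge_add) auto
      then show "val_ge v M (s i + t i - (s j + t j))" by (simp add: algebra_simps)
    qed
  qed
  then show ?thesis by (simp add: cauchy_seqs_def)
qed

lemma cauchy_uminus: "s \<in> cauchy_seqs v \<Longrightarrow> (\<lambda>i. - s i) \<in> cauchy_seqs v"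
proof -
  have "val_ge v M (- s i - - s j) = val_ge v M (s i - s j)" for M i j
    using val_ge_uminus[of M "s i - s j"] by simp
  then show "(\<lambda>i. - s i) \<in> cauchy_seqs v" if "s \<in> cauchy_seqs v"
    using that unfolding cauchy_seqs_def mem_Collect_eq by presburger
qed

lemma cauchy_const: "(\<lambda>i. a) \<in> cauchy_seqs v"
  by (simp add: cauchy_seqs_def val_ge_zero)

lemma cauchy_bounded: assumes s: "s \<in> cauchy_seqs v" shows "\<exists>B. \<forall>i. val_ge v B (s i)"
proof -
  obtain N where N: "\<forall>i\<ge>N. \<forall>j\<ge>N. val_ge v 0 (s i - s j)" using s unfolding cauchy_seqs_def by blast
  define B where "B = Min (insert 0 ((\<lambda>i. v (s i)) ` {..N}))"
  have B: "B \<le> 0" "\<And>i. i \<le> N \<Longrightarrow> B \<le> v (s i)"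
    unfolding B_def by (auto intro!: Min_le simp del: Min_insert)
  have "val_ge v B (s i)" for i
  proof (cases "i \<le> N")
    case True then show ?thesis using B by (simp add: val_ge_def)
  next
    case False
    then have "val_ge v 0 (s i - s N)" using N by simp
    then have "val_ge v B (s i - s N)" using val_ge_mono B(1) by blast
    moreover have "val_ge v B (s N)" using B(2)[of N] by (simp add: val_ge_def)
    ultimately have "val_ge v B (s i - s N + s N)" by (rule val_ge_add)
    then show ?thesis by simp
  qed
  then show ?thesis by blast
qed

lemma cauchy_mult: "s \<in> cauchy_seqs v \<Longrightarrow> t \<in> cauchy_seqs v \<Longrightarrow> (\<lambda>i. s i * t i) \<in> cauchy_seqs v"
proof -
  assume st: "s \<in> cauchy_seqs v" "t \<in> cauchy_seqs v"
  obtain B where B: "\<forall>i. val_ge v B (s i)" using cauchy_bounded[OF st(1)] by blast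
  obtain C where C: "\<forall>i. val_ge v C (t i)" using cauchy_bounded[OF st(2)] by blast
  have "\<exists>N. \<forall>i\<ge>N. \<forall>j\<ge>N. val_ge v M (s i * t i - s j * t j)" for M
  proof -
    obtain N where N: "\<forall>i\<ge>N. \<forall>j\<ge>N. val_ge v (M - C) (s i - s j)" using st(1) unfolding cauchy_seqs_def by blast
    obtain N' where N': "\<forall>i\<ge>N'. \<forall>j\<ge>N'. val_ge v (M - B) (t i - t j)" using st(2) unfolding cauchy_seqs_def by blast
    show ?thesis
    proof (intro exI[of _ "max N N'"] allI impI)
      fix i j assume ij: "max N N' \<le> i" "max N N' \<le> j"
      have "val_ge v (B + (M - B)) (s i * (t i - t j))" using B N' ij by (intro val_ge_mult) auto
      moreover have "val_ge v ((M - C) + C) ((s i - s j) * t j)" using C N ij by (intro val_ge_mult) auto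
      ultimately have "val_ge v M (s i * (t i - t j) + (s i - s j) * t j)" by (intro val_ge_add) auto
      then show "val_ge v M (s i * t i - s j * t j)" by (simp add: algebra_simps)
    qed
  qed
  then show ?thesis by (simp add: cauchy_seqs_def)
qed

lemma cauchy_ring_cring: "cring (cauchy_ring v)"
proof (rule cringI)
  show "abelian_group (cauchy_ring v)"
  proof (rule abelian_groupI)
    fix s assume "s \<in> carrier (cauchy_ring v)"
    then show "\<exists>t\<in>carrier (cauchy_ring v). t \<oplus>\<^bsub>cauchy_ring v\<^esub> s = \<zero>\<^bsub>cauchy_ring v\<^esub>"
      by (intro bexI[of _ "\<lambda>i. - s i"]) (auto simp: cauchy_ring_simps cauchy_uminus)
  qed (auto simp: cauchy_ring_simps cauchy_add cauchy_const algebra_simps)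
  show "Group.comm_monoid (cauchy_ring v)"
    by (rule comm_monoidI) (auto simp: cauchy_ring_simps cauchy_mult cauchy_const algebra_simps)
qed (auto simp: cauchy_ring_simps algebra_simps)

lemma null_subset: "null_seqs v \<subseteq> cauchy_seqs v"
proof
  fix s assume s: "s \<in> null_seqs v"
  have "\<exists>N. \<forall>i\<ge>N. \<forall>j\<ge>N. val_ge v M (s i - s j)" for M
  proof -
    obtain N where N: "\<forall>i\<ge>N. val_ge v M (s i)" using s unfolding null_seqs_def by blast
    have "val_ge v M (s i - s j)" if "i \<ge> N" "j \<ge> N" for i j
      using val_ge_add[of M "s i" "- s j"] N that by (simp add: val_ge_uminus)
    then show ?thesis by blast
  qed
  then show "s \<in> cauchy_seqs v" by (simp add: cauchy_seqs_def)
qed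

lemma null_add: "s \<in> null_seqs v \<Longrightarrow> t \<in> null_seqs v \<Longrightarrow> (\<lambda>i. s i + t i) \<in> null_seqs v"
proof -
  assume st: "s \<in> null_seqs v" "t \<in> null_seqs v"
  have "\<exists>N. \<forall>i\<ge>N. val_ge v M (s i + t i)" for M
  proof -
    obtain N where N: "\<forall>i\<ge>N. val_ge v M (s i)" using st(1) unfolding null_seqs_def by blast
    obtain N' where N': "\<forall>i\<ge>N'. val_ge v M (t i)" using st(2) unfolding null_seqs_def by blast
    have "val_ge v M (s i + t i)" if "i \<ge> max N N'" for i
      using N N' that by (intro val_ge_add) auto
    then show ?thesis by blast
  qed
  then show ?thesis by (simp add: null_seqs_def)
qed

lemma null_mult: "s \<in> cauchy_seqs v \<Longrightarrow> t \<in> null_seqs v \<Longrightarrow> (\<lambda>i. s i * t i) \<in> null_seqs v"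
proof -
  assume st: "s \<in> cauchy_seqs v" "t \<in> null_seqs v"
  obtain B where B: "\<forall>i. val_ge v B (s i)" using cauchy_bounded[OF st(1)] by blast
  have "\<exists>N. \<forall>i\<ge>N. val_ge v M (s i * t i)" for M
  proof -
    obtain N where N: "\<forall>i\<ge>N. val_ge v (M - B) (t i)" using st(2) unfolding null_seqs_def by blast
    have "val_ge v (B + (M - B)) (s i * t i)" if "i \<ge> N" for i
      using B N that by (intro val_ge_mult) auto
    then show ?thesis by auto
  qed
  then show ?thesis by (simp add: null_seqs_def)
qed

lemma cauchy_ring_a_inv: "s \<in> cauchy_seqs v \<Longrightarrow> \<ominus>\<^bsub>cauchy_ring v\<^esub> s = (\<lambda>i. - s i)"
  by (rule abelian_group.minus_equality[OF ring.is_abelian_group[OF cring.axioms(1)[OF cauchy_ring_cring]]])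
    (auto simp: cauchy_ring_simps cauchy_uminus)

lemma null_ideal: "ideal (null_seqs v) (cauchy_ring v)"
proof (rule idealI)
  show R: "ring (cauchy_ring v)" using cauchy_ring_cring by (rule cring.axioms)
  show "subgroup (null_seqs v) (add_monoid (cauchy_ring v))"
  proof (rule group.subgroupI)
    show "group (add_monoid (cauchy_ring v))"
      using abelian_group.a_group[OF ring.is_abelian_group[OF R]] .
    show "null_seqs v \<subseteq> carrier (add_monoid (cauchy_ring v))"
      using null_subset by (simp add: cauchy_ring_simps)
    show "null_seqs v \<noteq> {}" by (auto simp: null_seqs_def val_ge_zero intro!: exI[of _ "\<lambda>i. 0"])
    fix s t assume s: "s \<in> null_seqs v" and t: "t \<in> null_seqs v"
    have "inv\<^bsub>add_monoid (cauchy_ring v)\<^esub> s = (\<lambda>i. - s i)"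
      using s null_subset by (subst a_inv_def[symmetric]) (auto intro: cauchy_ring_a_inv)
    then show "inv\<^bsub>add_monoid (cauchy_ring v)\<^esub> s \<in> null_seqs v"
      using s by (simp add: null_seqs_def val_ge_uminus)
    show "s \<otimes>\<^bsub>add_monoid (cauchy_ring v)\<^esub> t \<in> null_seqs v"
      using null_add[OF s t] by (simp add: cauchy_ring_simps)
  qed
  show "s \<otimes>\<^bsub>cauchy_ring v\<^esub> t \<in> null_seqs v" if "t \<in> null_seqs v" "s \<in> carrier (cauchy_ring v)" for s t
    using null_mult[of s t] that by (simp add: cauchy_ring_simps)
  show "t \<otimes>\<^bsub>cauchy_ring v\<^esub> s \<in> null_seqs v" if "t \<in> null_seqs v" "s \<in> carrier (cauchy_ring v)" for s t
    using null_mult[of s t] that by (simp add: cauchy_ring_simps mult.commute)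
qed

lemma completion_cring: "cring (completion_ring v)"
  unfolding completion_ring_def by (rule ideal.quotient_is_cring[OF null_ideal cauchy_ring_cring])

lemma completion_hom:
  "ring_hom_ring (cauchy_ring v) (completion_ring v) ((+>\<^bsub>cauchy_ring v\<^esub>) (null_seqs v))"
  unfolding completion_ring_def by (rule ideal.rcos_ring_hom_ring[OF null_ideal])

lemmas completion_ring_hom = ring_hom_ring.homh[OF completion_hom]

lemma completion_mem_coset:
  assumes "\<alpha> \<in> carrier (completion_ring v)" "s \<in> \<alpha>"
  shows "s \<in> cauchy_seqs v" "\<alpha> = null_seqs v +>\<^bsub>cauchy_ring v\<^esub> s"
proof -
  interpret ideal "null_seqs v" "cauchy_ring v" by (rule null_ideal)
  obtain t where t: "t \<in> carrier (cauchy_ring v)" "\<alpha> = null_seqs v +>\<^bsub>cauchy_ring v\<^esub> t"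
    using assms(1) unfolding completion_ring_def FactRing_def A_RCOSETS_def' by auto
  then show "s \<in> cauchy_seqs v"
    using assms(2) a_elemrcos_carrier[OF t(1)] by (simp add: cauchy_ring_simps)
  show "\<alpha> = null_seqs v +>\<^bsub>cauchy_ring v\<^esub> s"
    using a_repr_independence[OF _ t(1) a_subgroup, of s] assms(2) t(2) by simp
qed

lemma coset_self: "s \<in> cauchy_seqs v \<Longrightarrow> s \<in> null_seqs v +>\<^bsub>cauchy_ring v\<^esub> s"
proof -
  assume s: "s \<in> cauchy_seqs v"
  interpret ideal "null_seqs v" "cauchy_ring v" by (rule null_ideal)
  show ?thesis using a_rcos_self[of s] s by (simp add: cauchy_ring_simps)
qed

lemma ideal_power_iff:
  "\<alpha> \<in> ideal_power v M \<longleftrightarrow>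
    (\<exists>s\<in>cauchy_seqs v. (\<forall>i. val_ge v M (s i)) \<and> \<alpha> = null_seqs v +>\<^bsub>cauchy_ring v\<^esub> s)"
proof
  assume "\<alpha> \<in> ideal_power v M"
  then show "\<exists>s\<in>cauchy_seqs v. (\<forall>i. val_ge v M (s i)) \<and> \<alpha> = null_seqs v +>\<^bsub>cauchy_ring v\<^esub> s"
    unfolding ideal_power_def using completion_mem_coset by blast
next
  assume "\<exists>s\<in>cauchy_seqs v. (\<forall>i. val_ge v M (s i)) \<and> \<alpha> = null_seqs v +>\<^bsub>cauchy_ring v\<^esub> s"
  then obtain s where s: "s \<in> cauchy_seqs v" "\<forall>i. val_ge v M (s i)" "\<alpha> = null_seqs v +>\<^bsub>cauchy_ring v\<^esub> s"
    by blast
  have "\<alpha> \<in> carrier (completion_ring v)"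
    unfolding s(3) using ring_hom_memE(1)[OF ring_hom_ring.homh[OF completion_hom]] s(1)
    by (simp add: cauchy_ring_simps)
  then show "\<alpha> \<in> ideal_power v M"
    unfolding ideal_power_def using s coset_self by blast
qed

lemma ideal_power_zero: "\<zero>\<^bsub>completion_ring v\<^esub> \<in> ideal_power v M"
proof -
  have "\<zero>\<^bsub>completion_ring v\<^esub> = null_seqs v +>\<^bsub>cauchy_ring v\<^esub> (\<lambda>i. 0)"
    using ring_hom_zero[OF completion_ring_hom] cring.axioms(1)[OF completion_cring]
      cring.axioms(1)[OF cauchy_ring_cring] by (simp add: cauchy_ring_simps)
  then show ?thesis unfolding ideal_power_iff
    by (intro bexI[of _ "\<lambda>i. 0"]) (auto simp: cauchy_const val_ge_zero)
qed

lemma ideal_power_one: "\<one>\<^bsub>completion_ring v\<^esub> \<in> ideal_power v 0"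
proof -
  have "\<one>\<^bsub>completion_ring v\<^esub> = null_seqs v +>\<^bsub>cauchy_ring v\<^esub> (\<lambda>i. 1)"
    using ring_hom_one[OF completion_ring_hom] by (simp add: cauchy_ring_simps)
  then show ?thesis unfolding ideal_power_iff
    by (intro bexI[of _ "\<lambda>i. 1"]) (auto simp: cauchy_const val_ge_one)
qed

lemma ideal_power_add:
  assumes "\<alpha> \<in> ideal_power v M" "\<beta> \<in> ideal_power v M"
  shows "\<alpha> \<oplus>\<^bsub>completion_ring v\<^esub> \<beta> \<in> ideal_power v M"
proof -
  obtain s t where s: "s \<in> cauchy_seqs v" "\<forall>i. val_ge v M (s i)" "\<alpha> = null_seqs v +>\<^bsub>cauchy_ring v\<^esub> s"
    and t: "t \<in> cauchy_seqs v" "\<forall>i. val_ge v M (t i)" "\<beta> = null_seqs v +>\<^bsub>cauchy_ring v\<^esub> t"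
    using assms unfolding ideal_power_iff by blast
  have "\<alpha> \<oplus>\<^bsub>completion_ring v\<^esub> \<beta> = null_seqs v +>\<^bsub>cauchy_ring v\<^esub> (\<lambda>i. s i + t i)"
    unfolding s(3) t(3) using ring_hom_add[OF completion_ring_hom, of s t] s(1) t(1)
    by (simp add: cauchy_ring_simps)
  then show ?thesis unfolding ideal_power_iff
    by (intro bexI[of _ "\<lambda>i. s i + t i"] conjI allI) (use s t in \<open>auto simp: val_ge_add cauchy_add\<close>)
qed

lemma ideal_power_mult:
  assumes "\<alpha> \<in> ideal_power v M" "\<beta> \<in> ideal_power v N"
  shows "\<alpha> \<otimes>\<^bsub>completion_ring v\<^esub> \<beta> \<in> ideal_power v (M + N)"
proof -
  obtain s t where s: "s \<in> cauchy_seqs v" "\<forall>i. val_ge v M (s i)" "\<alpha> = null_seqs v +>\<^bsub>cauchy_ring v\<^esub> s"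
    and t: "t \<in> cauchy_seqs v" "\<forall>i. val_ge v N (t i)" "\<beta> = null_seqs v +>\<^bsub>cauchy_ring v\<^esub> t"
    using assms unfolding ideal_power_iff by blast
  have "\<alpha> \<otimes>\<^bsub>completion_ring v\<^esub> \<beta> = null_seqs v +>\<^bsub>cauchy_ring v\<^esub> (\<lambda>i. s i * t i)"
    unfolding s(3) t(3) using ring_hom_mult[OF completion_ring_hom, of s t] s(1) t(1)
    by (simp add: cauchy_ring_simps)
  then show ?thesis unfolding ideal_power_iff
    by (intro bexI[of _ "\<lambda>i. s i * t i"] conjI allI) (use s t in \<open>auto simp: val_ge_mult cauchy_mult\<close>)
qed

lemma ideal_power_a_inv:
  assumes "\<alpha> \<in> ideal_power v M"
  shows "\<ominus>\<^bsub>completion_ring v\<^esub> \<alpha> \<in> ideal_power v M"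
proof -
  obtain s where s: "s \<in> cauchy_seqs v" "\<forall>i. val_ge v M (s i)" "\<alpha> = null_seqs v +>\<^bsub>cauchy_ring v\<^esub> s"
    using assms unfolding ideal_power_iff by blast
  interpret h: ring_hom_ring "cauchy_ring v" "completion_ring v" "(+>\<^bsub>cauchy_ring v\<^esub>) (null_seqs v)"
    by (rule completion_hom)
  have "\<ominus>\<^bsub>completion_ring v\<^esub> \<alpha> = null_seqs v +>\<^bsub>cauchy_ring v\<^esub> (\<lambda>i. - s i)"
    unfolding s(3) using h.hom_a_inv[of s] s(1) cauchy_ring_a_inv[OF s(1)]
    by (simp add: cauchy_ring_simps)
  then show ?thesis unfolding ideal_power_iff
    by (intro bexI[of _ "\<lambda>i. - s i"] conjI allI) (use s in \<open>auto simp: val_ge_uminus cauchy_uminus\<close>)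
qed

lemma ideal_power_antimono: "N \<le> M \<Longrightarrow> ideal_power v M \<subseteq> ideal_power v N"
  unfolding ideal_power_def using val_ge_mono by blast

lemma completion_zero_neq_one: "\<zero>\<^bsub>completion_ring v\<^esub> \<noteq> \<one>\<^bsub>completion_ring v\<^esub>"
proof
  assume e: "\<zero>\<^bsub>completion_ring v\<^esub> = \<one>\<^bsub>completion_ring v\<^esub>"
  have "\<one>\<^bsub>completion_ring v\<^esub> = null_seqs v +>\<^bsub>cauchy_ring v\<^esub> (\<lambda>i. 1)"
    using ring_hom_one[OF completion_ring_hom] by (simp add: cauchy_ring_simps)
  then have "(\<lambda>i. 1) \<in> \<one>\<^bsub>completion_ring v\<^esub>" using coset_self[OF cauchy_const] by simp
  then have "(\<lambda>i. 1) \<in> null_seqs v" unfolding e[symmetric] by (simp add: completion_ring_def FactRing_def)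
  then obtain N where "\<forall>i\<ge>N. val_ge v 1 ((\<lambda>i. 1) (i::nat))" unfolding null_seqs_def by blast
  then show False using val_one by (auto simp: val_ge_def)
qed

end

lemma completion_val_cring: "cring (completion_ring (val x))"
  by (rule completion_cring[OF is_valuation_val])

text \<open>The restricted product of the completions with respect to their rings of integers.\<close>

typedef (overloaded) 'a adele =
  "{a :: 'a::function_field place \<Rightarrow> (nat \<Rightarrow> 'a) set.
     (\<forall>x. a x \<in> carrier (completion_ring (val x))) \<and> finite {x. a x \<notin> ideal_power (val x) 0}}"
  morphisms local_component Abs_adele
proof -
  have "\<zero>\<^bsub>completion_ring (val x)\<^esub> \<in> carrier (completion_ring (val x))" for x :: "'a place"
    using cring.cring_simprules(2)[OF completion_val_cring] .
  then show ?thesis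
    by (intro exI[of _ "\<lambda>x. \<zero>\<^bsub>completion_ring (val x)\<^esub>"]) (auto simp: ideal_power_zero[OF is_valuation_val])
qed

setup_lifting type_definition_adele

instantiation adele :: (function_field) comm_ring_1
begin

lift_definition zero_adele :: "'a adele" is "\<lambda>x. \<zero>\<^bsub>completion_ring (val x)\<^esub>"
  by (auto simp: ideal_power_zero[OF is_valuation_val] cring.cring_simprules(2)[OF completion_val_cring])

lift_definition one_adele :: "'a adele" is "\<lambda>x. \<one>\<^bsub>completion_ring (val x)\<^esub>"
  by (auto simp: ideal_power_one[OF is_valuation_val] cring.cring_simprules(6)[OF completion_val_cring])

lift_definition plus_adele :: "'a adele \<Rightarrow> 'a adele \<Rightarrow> 'a adele"
  is "\<lambda>a b x. a x \<oplus>\<^bsub>completion_ring (val x)\<^esub> b x"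
proof (intro conjI allI)
  fix a b :: "'a place \<Rightarrow> (nat \<Rightarrow> 'a) set"
  assume a: "(\<forall>x. a x \<in> carrier (completion_ring (val x))) \<and> finite {x. a x \<notin> ideal_power (val x) 0}"
    and b: "(\<forall>x. b x \<in> carrier (completion_ring (val x))) \<and> finite {x. b x \<notin> ideal_power (val x) 0}"
  show "a x \<oplus>\<^bsub>completion_ring (val x)\<^esub> b x \<in> carrier (completion_ring (val x))" for x
    using a b cring.cring_simprules(1)[OF completion_val_cring] by blast
  show "finite {x. a x \<oplus>\<^bsub>completion_ring (val x)\<^esub> b x \<notin> ideal_power (val x) 0}"
    by (rule finite_subset[of _ "{x. a x \<notin> ideal_power (val x) 0} \<union> {x. b x \<notin> ideal_power (val x) 0}"])
      (use a b ideal_power_add[OF is_valuation_val] in auto)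
qed

lift_definition times_adele :: "'a adele \<Rightarrow> 'a adele \<Rightarrow> 'a adele"
  is "\<lambda>a b x. a x \<otimes>\<^bsub>completion_ring (val x)\<^esub> b x"
proof (intro conjI allI)
  fix a b :: "'a place \<Rightarrow> (nat \<Rightarrow> 'a) set"
  assume a: "(\<forall>x. a x \<in> carrier (completion_ring (val x))) \<and> finite {x. a x \<notin> ideal_power (val x) 0}"
    and b: "(\<forall>x. b x \<in> carrier (completion_ring (val x))) \<and> finite {x. b x \<notin> ideal_power (val x) 0}"
  show "a x \<otimes>\<^bsub>completion_ring (val x)\<^esub> b x \<in> carrier (completion_ring (val x))" for x
    using a b cring.cring_simprules(5)[OF completion_val_cring] by blast
  show "finite {x. a x \<otimes>\<^bsub>completion_ring (val x)\<^esub> b x \<notin> ideal_power (val x) 0}"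
    by (rule finite_subset[of _ "{x. a x \<notin> ideal_power (val x) 0} \<union> {x. b x \<notin> ideal_power (val x) 0}"])
      (use a b ideal_power_mult[OF is_valuation_val, of _ _ 0 _ 0] in auto)
qed

lift_definition uminus_adele :: "'a adele \<Rightarrow> 'a adele" is "\<lambda>a x. \<ominus>\<^bsub>completion_ring (val x)\<^esub> a x"
proof (intro conjI allI)
  fix a :: "'a place \<Rightarrow> (nat \<Rightarrow> 'a) set"
  assume a: "(\<forall>x. a x \<in> carrier (completion_ring (val x))) \<and> finite {x. a x \<notin> ideal_power (val x) 0}"
  show "\<ominus>\<^bsub>completion_ring (val x)\<^esub> a x \<in> carrier (completion_ring (val x))" for x
    using a cring.cring_simprules(3)[OF completion_val_cring] by blast
  show "finite {x. \<ominus>\<^bsub>completion_ring (val x)\<^esub> a x \<notin> ideal_power (val x) 0}"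
    by (rule finite_subset[of _ "{x. a x \<notin> ideal_power (val x) 0}"])
      (use a ideal_power_a_inv[OF is_valuation_val] in auto)
qed

definition minus_adele :: "'a adele \<Rightarrow> 'a adele \<Rightarrow> 'a adele" where
  "minus_adele a b = a + - b"

instance
proof
  fix a b c :: "'a adele"
  note R = cring.cring_simprules[OF completion_val_cring]
  show "a + b + c = a + (b + c)" by transfer (simp add: R(7))
  show "a + b = b + a" by transfer (simp add: R(10))
  show "0 + a = a" by transfer (simp add: R(8))
  show "- a + a = 0" by transfer (simp add: R(9))
  show "a - b = a + - b" by (simp add: minus_adele_def)
  show "a * b * c = a * (b * c)" by transfer (simp add: R(11))
  show "a * b = b * a" by transfer (simp add: R(14))
  show "1 * a = a" by transfer (simp add: R(12))
  show "(a + b) * c = a * c + b * c" by transfer (simp add: R(13))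
  show "(0::'a adele) \<noteq> 1"
    by transfer (metis completion_zero_neq_one[OF is_valuation_val])
qed

end

text \<open>The restricted product topology: the sets \<open>\<Prod>\<^sub>x (\<pi>\<^sub>x)^e(x)\<close>, with \<open>e(x) = 0\<close> for almost all \<open>x\<close>,
  form a basis of neighbourhoods of \<open>0\<close>.\<close>

instantiation adele :: (function_field) topological_space
begin

definition open_adele :: "'a adele set \<Rightarrow> bool" where
  "open_adele A \<longleftrightarrow> (\<forall>a\<in>A. \<exists>e :: 'a place \<Rightarrow> nat. finite {x. e x \<noteq> 0} \<and>
     {b. \<forall>x. local_component (b - a) x \<in> ideal_power (val x) (int (e x))} \<subseteq> A)"

instance
proof
  show "open (UNIV :: 'a adele set)"
    unfolding open_adele_def by (auto intro!: exI[of _ "\<lambda>x. 0"])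
next
  fix A B :: "'a adele set" assume A: "open A" and B: "open B"
  show "open (A \<inter> B)" unfolding open_adele_def
  proof
    fix a assume a: "a \<in> A \<inter> B"
    obtain e where e: "finite {x. e x \<noteq> 0}"
      "{b. \<forall>x. local_component (b - a) x \<in> ideal_power (val x) (int (e x))} \<subseteq> A"
      using A a unfolding open_adele_def by blast
    obtain f where f: "finite {x. f x \<noteq> 0}"
      "{b. \<forall>x. local_component (b - a) x \<in> ideal_power (val x) (int (f x))} \<subseteq> B"
      using B a unfolding open_adele_def by blast
    have m: "ideal_power (val x) (int (max (e x) (f x))) \<subseteq> ideal_power (val x) (int (e x)) \<inter> ideal_power (val x) (int (f x))" for x
      by (intro Int_greatest ideal_power_antimono[OF is_valuation_val]) auto
    have "finite {x. max (e x) (f x) \<noteq> 0}"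
      by (rule finite_subset[OF _ finite_UnI[OF e(1) f(1)]]) (auto simp: max_def)
    moreover have "{b. \<forall>x. local_component (b - a) x \<in> ideal_power (val x) (int (max (e x) (f x)))} \<subseteq> A \<inter> B"
      using m e(2) f(2) by blast
    ultimately show "\<exists>e. finite {x. e x \<noteq> 0} \<and>
        {b. \<forall>x. local_component (b - a) x \<in> ideal_power (val x) (int (e x))} \<subseteq> A \<inter> B"
      by (intro exI[of _ "\<lambda>x. max (e x) (f x)"] conjI)
  qed
next
  fix \<A> :: "'a adele set set" assume a: "\<forall>A\<in>\<A>. open A"
  show "open (\<Union>\<A>)" unfolding open_adele_def
  proof
    fix a assume "a \<in> \<Union>\<A>"
    then obtain A where "A \<in> \<A>" "a \<in> A" by blast
    then obtain e where "finite {x. e x \<noteq> 0}"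
      "{b. \<forall>x. local_component (b - a) x \<in> ideal_power (val x) (int (e x))} \<subseteq> A"
      using a unfolding open_adele_def by blast
    then show "\<exists>e. finite {x. e x \<noteq> 0} \<and>
        {b. \<forall>x. local_component (b - a) x \<in> ideal_power (val x) (int (e x))} \<subseteq> \<Union>\<A>"
      using \<open>A \<in> \<A>\<close> by blast
  qed
qed

end

definition integer_ring :: "('a::field \<Rightarrow> int) \<Rightarrow> (nat \<Rightarrow> 'a) set ring" where
  "integer_ring v = (completion_ring v)\<lparr>carrier := ideal_power v 0\<rparr>"

definition residue_field :: "('a::field \<Rightarrow> int) \<Rightarrow> (nat \<Rightarrow> 'a) set set ring" where
  "residue_field v = integer_ring v Quot ideal_power v 1"

text \<open>The residue field viewed as a subfield of the ring of integers of the completion: the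
  subfield that reduction maps bijectively onto the residue field. It is unique because the residue
  field is finite, with \<open>q\<close> elements say, and all elements of such a subfield are roots of
  \<open>T^q - T\<close>.\<close>

definition coefficient_field :: "('a::field \<Rightarrow> int) \<Rightarrow> (nat \<Rightarrow> 'a) set ring" where
  "coefficient_field v = (completion_ring v)\<lparr>carrier :=
     (THE L. subfield L (completion_ring v) \<and> L \<subseteq> ideal_power v 0 \<and>
        bij_betw (\<lambda>\<alpha>. ideal_power v 1 +>\<^bsub>integer_ring v\<^esub> \<alpha>) L (carrier (residue_field v)))\<rparr>"

definition val_abs :: "('a::field \<Rightarrow> int) \<Rightarrow> 'a \<Rightarrow> real" where
  "val_abs v a = (if a = 0 then 0 else real (card (carrier (residue_field v))) powi (- v a))"

text \<open>The continuous extension of the absolute value to the completion.\<close>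

definition completion_abs :: "('a::field \<Rightarrow> int) \<Rightarrow> (nat \<Rightarrow> 'a) set \<Rightarrow> real" where
  "completion_abs v \<alpha> = (THE l. \<forall>s\<in>\<alpha>. (\<lambda>i. val_abs v (s i)) \<longlonglongrightarrow> l)"

definition integral_adeles :: "'a::function_field adele set" where
  "integral_adeles = {a. \<forall>x. local_component a x \<in> ideal_power (val x) 0}"

definition adele_at :: "'a::function_field place \<Rightarrow> (nat \<Rightarrow> 'a) set \<Rightarrow> 'a adele" where
  "adele_at x \<alpha> = Abs_adele (\<lambda>y. if y = x then \<alpha> else \<zero>\<^bsub>completion_ring (val y)\<^esub>)"

definition idele_at :: "'a::function_field place \<Rightarrow> (nat \<Rightarrow> 'a) set \<Rightarrow> 'a adele" where
  "idele_at x \<alpha> = Abs_adele (\<lambda>y. if y = x then \<alpha> else \<one>\<^bsub>completion_ring (val y)\<^esub>)"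

definition GL :: "nat \<Rightarrow> 'r::comm_ring_1 mat set" where
  "GL n = Units (ring_mat TYPE('r) n ())"

definition GL_inv :: "nat \<Rightarrow> 'r::comm_ring_1 mat \<Rightarrow> 'r mat" where
  "GL_inv n g = inv\<^bsub>ring_mat TYPE('r) n ()\<^esub> g"

text \<open>The image of \<open>GL\<^sub>n(F)\<close> under the diagonal embedding of \<open>F\<close> into the adele ring.\<close>

definition GL_F :: "nat \<Rightarrow> 'a::function_field adele mat set" where
  "GL_F n = {g \<in> GL n. \<exists>\<gamma>\<in>GL n. \<forall>i<n. \<forall>j<n. \<forall>x.
     local_component (g $$ (i, j)) x = to_completion (val x) (\<gamma> $$ (i, j))}"

definition GL_O :: "nat \<Rightarrow> 'a::function_field adele mat set" where
  "GL_O n = {g \<in> GL n. \<forall>i<n. \<forall>j<n.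
     g $$ (i, j) \<in> integral_adeles \<and> GL_inv n g $$ (i, j) \<in> integral_adeles}"

definition center_A :: "nat \<Rightarrow> 'a::function_field adele mat set" where
  "center_A n = {u \<cdot>\<^sub>m 1\<^sub>m n | u. u dvd 1}"

text \<open>The coarsest topology for which the entries of \<open>g\<close> and of the inverse of \<open>g\<close> are continuous
  functions of \<open>g\<close>.\<close>

definition GL_topology :: "nat \<Rightarrow> 'a::function_field adele mat topology" where
  "GL_topology n = topology_generated_by
     ({{g \<in> GL n. g $$ (i, j) \<in> U} | i j U. i < n \<and> j < n \<and> open U} \<union>
      {{g \<in> GL n. GL_inv n g $$ (i, j) \<in> U} | i j U. i < n \<and> j < n \<and> open U})"

text \<open>\<open>GL\<^sub>n\<close> of the adeles is second countable and locally compact, so that a left invariant Borel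
  measure that is finite on compact sets is automatically regular.\<close>

definition is_haar_measure :: "nat \<Rightarrow> 'a::function_field adele mat measure \<Rightarrow> bool" where
  "is_haar_measure n \<mu> \<longleftrightarrow>
     space \<mu> = GL n \<and> sets \<mu> = sigma_sets (GL n) {U. openin (GL_topology n) U} \<and>
     (\<forall>g\<in>GL n. \<forall>A\<in>sets \<mu>. emeasure \<mu> ((*) g ` A) = emeasure \<mu> A) \<and>
     (\<forall>C. compactin (GL_topology n) C \<longrightarrow> emeasure \<mu> C < \<infinity>) \<and>
     emeasure \<mu> (GL_O n) = 1"

text \<open>Functions on \<open>GL\<^sub>n\<close> of the adeles are functions on the type of all matrices; all conditions
  below only concern their values on \<^const>\<open>GL\<close>.\<close>

definition locally_constant :: "nat \<Rightarrow> ('a::function_field adele mat \<Rightarrow> complex) \<Rightarrow> bool" where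
  "locally_constant n f \<longleftrightarrow>
     (\<forall>g\<in>GL n. \<exists>U. openin (GL_topology n) U \<and> g \<in> U \<and> (\<forall>h\<in>U. f h = f g))"

definition hecke_algebra :: "nat \<Rightarrow> ('a::function_field adele mat \<Rightarrow> complex) set" where
  "hecke_algebra n = {\<Phi>. locally_constant n \<Phi> \<and>
     (\<exists>C. compactin (GL_topology n) C \<and> (\<forall>g\<in>GL n - C. \<Phi> g = 0))}"

definition hecke_act :: "'a::function_field adele mat measure \<Rightarrow> ('a adele mat \<Rightarrow> complex) \<Rightarrow>
    ('a adele mat \<Rightarrow> complex) \<Rightarrow> 'a adele mat \<Rightarrow> complex" where
  "hecke_act \<mu> \<Phi> f g = integral\<^sup>L \<mu> (\<lambda>h. \<Phi> h * f (g * h))"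

text \<open>The restrictions to \<open>A\<close> of the functions in \<open>S\<close> span a finite-dimensional space.\<close>

definition finite_dim_on :: "'b set \<Rightarrow> ('b \<Rightarrow> complex) set \<Rightarrow> bool" where
  "finite_dim_on A S \<longleftrightarrow> (\<exists>B. finite B \<and> (\<forall>f\<in>S. \<exists>c. \<forall>g\<in>A. f g = (\<Sum>b\<in>B. c b * b g)))"

definition local_norm :: "nat \<Rightarrow> 'a::function_field adele mat \<Rightarrow> 'a place \<Rightarrow> real" where
  "local_norm n g x = Max (insert
     (completion_abs (val x) (inv\<^bsub>completion_ring (val x)\<^esub> (local_component (det g) x)))
     {completion_abs (val x) (local_component (g $$ (i, j)) x) | i j. i < n \<and> j < n})"

text \<open>Almost all local factors are equal to \<open>1\<close>.\<close>

definition adelic_norm :: "nat \<Rightarrow> 'a::function_field adele mat \<Rightarrow> real" where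
  "adelic_norm n g = (\<Prod>x\<in>{x. local_norm n g x \<noteq> 1}. local_norm n g x)"

definition automorphic_forms ::
  "'a::function_field adele mat measure \<Rightarrow> nat \<Rightarrow> ('a adele mat \<Rightarrow> complex) set" where
  "automorphic_forms \<mu> n = {f.
     continuous_map (GL_topology n) euclidean f \<and>
     locally_constant n f \<and>
     finite_dim_on (GL n) {\<lambda>g. f (g * k) | k. k \<in> GL_O n} \<and>
     (\<forall>\<gamma>\<in>GL_F n. \<forall>z\<in>center_A n. \<forall>g\<in>GL n. f (\<gamma> * z * g) = f g) \<and>
     finite_dim_on (GL n) {hecke_act \<mu> \<Phi> f | \<Phi>. \<Phi> \<in> hecke_algebra n} \<and>
     (\<exists>C::real. \<exists>N::nat. \<forall>g\<in>GL n. cmod (f g) \<le> C * adelic_norm n g ^ N)}"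

definition unramified_automorphic_forms ::
  "'a::function_field adele mat measure \<Rightarrow> nat \<Rightarrow> ('a adele mat \<Rightarrow> complex) set" where
  "unramified_automorphic_forms \<mu> n =
     {f \<in> automorphic_forms \<mu> n. \<forall>g\<in>GL n. \<forall>k\<in>GL_O n. f (g * k) = f g}"

definition double_coset :: "nat \<Rightarrow> 'a::function_field adele mat \<Rightarrow> 'a adele mat set" where
  "double_coset n g = {\<gamma> * g * k | \<gamma> k. \<gamma> \<in> GL_F n \<and> k \<in> GL_O n}"

definition vertices :: "nat \<Rightarrow> 'a::function_field adele mat set set" where
  "vertices n = double_coset n ` GL n"

definition double_coset_functions :: "nat \<Rightarrow> ('a::function_field adele mat \<Rightarrow> complex) set" where
  "double_coset_functions n =
     {f. \<forall>\<gamma>\<in>GL_F n. \<forall>g\<in>GL n. \<forall>k\<in>GL_O n. f (\<gamma> * g * k) = f g}"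

text \<open>\<open>represents_hecke \<mu> n V \<Phi> c m\<close>: the classes \<open>c\<^sub>i\<close> with \<open>m c\<^sub>i \<noteq> 0\<close> and the numbers
  \<open>m\<^sub>i = m c\<^sub>i\<close> satisfy \<open>\<Phi>(f)(g) = \<Sum>\<^sub>i m\<^sub>i f(g\<^sub>i)\<close> for all \<open>f \<in> V\<close>, where \<open>c = [g]\<close> and \<open>c\<^sub>i = [g\<^sub>i]\<close>.\<close>

definition represents_hecke :: "'a::function_field adele mat measure \<Rightarrow> nat \<Rightarrow>
    ('a adele mat \<Rightarrow> complex) set \<Rightarrow> ('a adele mat \<Rightarrow> complex) \<Rightarrow>
    'a adele mat set \<Rightarrow> ('a adele mat set \<Rightarrow> complex) \<Rightarrow> bool" where
  "represents_hecke \<mu> n V \<Phi> c m \<longleftrightarrow>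
     finite {c'. m c' \<noteq> 0} \<and> {c'. m c' \<noteq> 0} \<subseteq> vertices n \<and>
     (\<forall>f\<in>V. \<forall>g\<in>c. hecke_act \<mu> \<Phi> f g = (\<Sum>c' | m c' \<noteq> 0. m c' * f (SOME h. h \<in> c')))"

text \<open>All functions on the set of double cosets are used as test functions. Unramified automorphic
  forms alone do not determine the classes and numbers: they are invariant under the center of
  \<open>GL\<^sub>n\<close> of the adeles, whereas for an idele \<open>z\<close> of nonzero degree the double cosets of \<open>g\<close> and
  \<open>z g\<close> are different (for \<open>n = 1\<close> unramified automorphic forms are even constant, but there are
  infinitely many double cosets).\<close>

definition hecke_multiplicity :: "'a::function_field adele mat measure \<Rightarrow> nat \<Rightarrow>
    ('a adele mat \<Rightarrow> complex) \<Rightarrow> 'a adele mat set \<Rightarrow> 'a adele mat set \<Rightarrow> complex" where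
  "hecke_multiplicity \<mu> n \<Phi> c = (THE m. represents_hecke \<mu> n (double_coset_functions n) \<Phi> c m)"

definition hecke_edges :: "'a::function_field adele mat measure \<Rightarrow> nat \<Rightarrow>
    ('a adele mat \<Rightarrow> complex) \<Rightarrow> ('a adele mat set \<times> 'a adele mat set \<times> complex) set" where
  "hecke_edges \<mu> n \<Phi> = {(c, c', m). c \<in> vertices n \<and> m = hecke_multiplicity \<mu> n \<Phi> c c' \<and> m \<noteq> 0}"

definition hecke_neighbors :: "'a::function_field adele mat measure \<Rightarrow> nat \<Rightarrow>
    ('a adele mat \<Rightarrow> complex) \<Rightarrow> 'a adele mat set \<Rightarrow> 'a adele mat set set" where
  "hecke_neighbors \<mu> n \<Phi> c = {c'. \<exists>m. (c, c', m) \<in> hecke_edges \<mu> n \<Phi>}"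

definition Phi :: "nat \<Rightarrow> 'a::function_field place \<Rightarrow> 'a \<Rightarrow> nat \<Rightarrow> 'a adele mat \<Rightarrow> complex" where
  "Phi n x \<pi> r =
     (let D = mat n n (\<lambda>(i, j). if i \<noteq> j then 0
                                else if i < r then idele_at x (to_completion (val x) \<pi>) else 1)
      in indicator {k1 * D * k2 | k1 k2. k1 \<in> GL_O n \<and> k2 \<in> GL_O n})"

text \<open>Coordinates are numbered \<open>0, \<dots>, n - 1\<close>, as for the matrices.\<close>

definition Gr :: "nat \<Rightarrow> nat \<Rightarrow> ('k, 'm) ring_scheme \<Rightarrow> (nat \<Rightarrow> 'k) set set" where
  "Gr k n \<kappa> = {w. VectorSpace.subspace \<kappa> w (ring.func_space \<kappa> {..<n}) \<and>
     vectorspace.dim \<kappa> ((ring.func_space \<kappa> {..<n})\<lparr>carrier := w\<rparr>) = k}"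

definition is_reduced_basis :: "nat \<Rightarrow> ('k, 'm) ring_scheme \<Rightarrow> (nat \<Rightarrow> 'k) set \<Rightarrow>
    nat set \<Rightarrow> (nat \<Rightarrow> nat \<Rightarrow> 'k) \<Rightarrow> bool" where
  "is_reduced_basis n \<kappa> w \<Lambda> b \<longleftrightarrow>
     \<Lambda> \<subseteq> {..<n} \<and> b \<in> extensional \<Lambda> \<and>
     vectorspace.basis \<kappa> ((ring.func_space \<kappa> {..<n})\<lparr>carrier := w\<rparr>) (b ` \<Lambda>) \<and>
     (\<forall>j\<in>\<Lambda>. b j j = \<one>\<^bsub>\<kappa>\<^esub> \<and> (\<forall>i<n. (j < i \<or> i \<in> \<Lambda> \<and> i \<noteq> j) \<longrightarrow> b j i = \<zero>\<^bsub>\<kappa>\<^esub>))"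

definition xi :: "nat \<Rightarrow> 'a::function_field place \<Rightarrow> 'a \<Rightarrow> (nat \<Rightarrow> (nat \<Rightarrow> 'a) set) set \<Rightarrow> 'a adele mat" where
  "xi n x \<pi> w =
     (let (\<Lambda>, b) = (THE (\<Lambda>, b). is_reduced_basis n (coefficient_field (val x)) w \<Lambda> b)
      in mat n n (\<lambda>(i, j).
           if i = j then (if j \<in> \<Lambda> then 1 else idele_at x (to_completion (val x) \<pi>))
           else if i < j \<and> j \<in> \<Lambda> then adele_at x (b j i) else 0))"

end

theory Submission
  imports Defs
begin

text \<open>The coset \<open>h K\<close> of \<open>h = k\<^sub>1 diag(\<pi>\<^sub>x I\<^sub>r, I\<^sub>n\<^sub>-\<^sub>r) k\<^sub>2\<close> is determined by the lattice that \<open>h\<close> generates, which lies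
  between the standard lattice and its multiple by \<open>\<pi>\<^sub>x\<close>, hence by its reduction modulo \<open>\<pi>\<^sub>x\<close>, a subspace of
  \<open>\<kappa>(x)\<^sup>n\<close>; comparing determinants shows that its dimension is \<open>n - r\<close>. The columns of \<open>\<xi>\<^sub>w\<close> are the reduced
  basis of \<open>w\<close> and multiples of \<open>\<pi>\<^sub>x\<close> of standard basis vectors, so \<open>\<xi>\<^sub>w\<close> generates the lattice with reduction
  \<open>w\<close>. Thus the double coset of the Hecke operator is the disjoint union of the \<open>\<xi>\<^sub>w K\<close>, each of volume \<open>1\<close>, and
  the Hecke operator sends \<open>f\<close> to \<open>g \<mapsto> \<Sum>\<^sub>w f(g \<xi>\<^sub>w)\<close>.

  That the coefficient field exists, and that there are finitely many \<open>w\<close>, rests on the finiteness of the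
  residue field of a place; the coefficient field consists of the limits of \<open>a\<close>, \<open>a\<^sup>Q\<close>, \<open>a\<^sup>Q\<^sup>Q\<close>, \<open>\<dots>\<close> for a power \<open>Q\<close> of
  the characteristic that acts trivially on the residue field.\<close>

section \<open>Finiteness of the residue field of a place\<close>

text \<open>The lattices are modules over the whole ring of integral adeles, not over the local ring
  at x: the uniformizer idele is 1 at all other places, so only reduction at x matters, and local
  and adelic cosets never have to be compared. The price is a ring with zero divisors and no
  valuation. The locale \<open>residue_data\<close> isolates what replaces it: a reduction
  \<open>\<rho>\<close>, a section \<open>\<sigma>\<close>, and division by \<open>\<pi>\<close> of
  integral elements that reduce to 0. Equality of two lattices becomes a pair of integral
  factorizations, each matrix being the other one times an integral matrix. A place is given merely
  as a discrete valuation of F, so finiteness of its residue field has to be extracted from the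
  presentation of F as a finite extension of k(t). Afterwards the residue field is controlled by
  Frobenius powers of representatives, without computing its order. In positive characteristic these
  powers are additive, which is why the Teichmueller representatives form a field. The Haar measure
  enters through left invariance and the volume of K. Uniqueness of the multiplicities comes from
  testing on indicator functions of double cosets.\<close>

abbreviation poly_over :: "'a::zero set \<Rightarrow> 'a poly \<Rightarrow> bool" where
  "poly_over k p \<equiv> \<forall>i. Polynomial.coeff p i \<in> k"

text \<open>Polynomials have coefficients in the whole field, so the induction repeats Euclidean
  division in order to see that quotient and remainder stay over \<open>k\<close>.\<close>

lemma poly_division_subfield:
  fixes p f :: "'a::field poly"
  assumes k: "subfield k (class_ring :: 'a ring)" and f: "\<And>i. Polynomial.coeff f i \<in> k" "f \<noteq> 0"
    and p: "\<And>i. Polynomial.coeff p i \<in> k"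
  shows "\<exists>q r. poly_over k q \<and> poly_over k r \<and>
    p = f * q + r \<and> (r = 0 \<or> Polynomial.degree r < Polynomial.degree f)"
  using p
proof (induction "Polynomial.degree p" arbitrary: p rule: less_induct)
  case less
  note k' = subfield_class_ring[OF k]
  interpret sring k by (rule sring_subfield[OF k])
  show ?case
  proof (cases "p = 0 \<or> Polynomial.degree p < Polynomial.degree f")
    case True
    then show ?thesis using less.prems by (intro exI[of _ 0] exI[of _ p]) auto
  next
    case False
    define m where "m = Polynomial.monom (Polynomial.lead_coeff p / Polynomial.lead_coeff f) (Polynomial.degree p - Polynomial.degree f)"
    define p' where "p' = p - f * m"
    have lk: "Polynomial.lead_coeff p / Polynomial.lead_coeff f \<in> k"
      unfolding divide_inverse by (intro mult less.prems k'(6) f)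
    have m: "Polynomial.coeff m i \<in> k" for i using lk by (auto simp: m_def)
    have p': "Polynomial.coeff p' i \<in> k" for i
      unfolding p'_def coeff_diff coeff_mult by (intro diff sum_in mult f m less.prems)
    have lcf: "Polynomial.lead_coeff p / Polynomial.lead_coeff f \<noteq> 0" using False f(2) by auto
    have dm: "Polynomial.degree (f * m) = Polynomial.degree p"
      using lcf f(2) False by (simp add: m_def degree_mult_eq degree_monom_eq)
    have "Polynomial.coeff (f * m) (Polynomial.degree p) = Polynomial.lead_coeff f * Polynomial.lead_coeff m"
      using lead_coeff_mult[of f m] dm by simp
    also have "\<dots> = Polynomial.lead_coeff p" using lcf f(2) by (simp add: m_def degree_monom_eq)
    finally have "Polynomial.coeff p' (Polynomial.degree p) = 0" by (simp add: p'_def)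
    moreover have "Polynomial.degree p' \<le> Polynomial.degree p" unfolding p'_def by (rule degree_diff_le) (auto simp: dm)
    ultimately have "p' = 0 \<or> Polynomial.degree p' < Polynomial.degree p"
      by (metis le_neq_implies_less leading_coeff_0_iff)
    then obtain q r where qr: "poly_over k q" "poly_over k r"
      "p' = f * q + r" "r = 0 \<or> Polynomial.degree r < Polynomial.degree f"
    proof
      assume "p' = 0" then show ?thesis by (intro that[of 0 0]) auto
    next
      assume "Polynomial.degree p' < Polynomial.degree p" then show ?thesis using less.hyps[of p'] p' that by blast
    qed
    have "p = f * (q + m) + r" using qr(3) by (simp add: p'_def algebra_simps)
    then show ?thesis using qr(1,2,4) m by (intro exI[of _ "q + m"] exI[of _ r]) auto
  qed
qed

lemma finite_polys_bounded:
  fixes A :: "'a::zero set"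
  assumes "finite A"
  shows "finite {p. poly_over A p \<and> (p = 0 \<or> Polynomial.degree p < d)}"
proof (rule finite_subset)
  show "finite (Poly ` {xs. set xs \<subseteq> A \<and> length xs \<le> d})"
    by (intro finite_imageI finite_lists_length_le assms)
  show "{p. poly_over A p \<and> (p = 0 \<or> Polynomial.degree p < d)} \<subseteq> Poly ` {xs. set xs \<subseteq> A \<and> length xs \<le> d}"
  proof
    fix p assume "p \<in> {p. poly_over A p \<and> (p = 0 \<or> Polynomial.degree p < d)}"
    then have p: "poly_over A p" "p = 0 \<or> Polynomial.degree p < d" by auto
    have "set (coeffs p) \<subseteq> A" using p(1) by (auto simp: coeffs_def)
    moreover have "length (coeffs p) \<le> d" using p(2) by (cases "p = 0") (auto simp: length_coeffs_degree)
    ultimately show "p \<in> Poly ` {xs. set xs \<subseteq> A \<and> length xs \<le> d}"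
      by (intro image_eqI[of _ _ "coeffs p"]) auto
  qed
qed

section \<open>Roots of polynomials modulo the maximal ideal of a valuation ring\<close>

context vring
begin

lemma P_prime: assumes "a \<in> S" "b \<in> S" "a * b \<in> P" shows "a \<in> P \<or> b \<in> P"
  using S_cases[OF assms(1)] S_cases[OF assms(2)] U_mult[of a b] U_not_P[of "a * b"] assms(3) by blast

lemma P_diff: "a \<in> P \<Longrightarrow> b \<in> P \<Longrightarrow> a - b \<in> P"
  using P_add[of a "- b"] P_uminus by simp

lemma P_S: "a \<in> P \<Longrightarrow> a \<in> S"
  by (simp add: P_def)

lemma poly_closed: "(\<And>i. Polynomial.coeff p i \<in> S) \<Longrightarrow> a \<in> S \<Longrightarrow> poly p a \<in> S"
  unfolding poly_altdef by (intro sum_in mult pow)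

text \<open>A nonzero polynomial over the field \<open>S\<close>/\<open>P\<close> has finitely many
  roots, phrased without the quotient. Splitting off a root \<open>a0\<close> by synthetic division
  leaves a quotient that is still nonzero modulo \<open>P\<close>: otherwise all coefficients of
  \<open>p\<close> would lie in \<open>P\<close>. Since \<open>P\<close> is prime, any further root
  is congruent to \<open>a0\<close> or is a root of the quotient.\<close>

lemma finite_roots:
  assumes "\<And>i. Polynomial.coeff p i \<in> S" "Polynomial.coeff p j \<notin> P"
  shows "\<exists>T. finite T \<and> (\<forall>a\<in>S. poly p a \<in> P \<longrightarrow> (\<exists>b\<in>T. a - b \<in> P))"
  using assms
proof (induction "Polynomial.degree p" arbitrary: p j)
  case 0
  then obtain c where "p = [:c:]" by (metis degree_eq_zeroE)
  moreover have "c \<notin> P" using 0(3) \<open>p = [:c:]\<close> P_zero by (cases j) auto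
  ultimately have "\<forall>a\<in>S. poly p a \<notin> P" by simp
  then show ?case by (intro exI[of _ "{}"]) auto
next
  case (Suc n)
  show ?case
  proof (cases "\<exists>a0\<in>S. poly p a0 \<in> P")
    case False then show ?thesis by (intro exI[of _ "{}"]) auto
  next
    case True
    then obtain a0 where a0: "a0 \<in> S" "poly p a0 \<in> P" by blast
    define s where "s = synthetic_div p a0"
    have ps: "p + Polynomial.smult a0 s = pCons (poly p a0) s"
      unfolding s_def by (rule synthetic_div_correct)
    have ci: "Polynomial.coeff p i = Polynomial.coeff (pCons (poly p a0) s) i - a0 * Polynomial.coeff s i" for i
      using arg_cong[OF ps, of "\<lambda>q. Polynomial.coeff q i"] by (simp add: eq_diff_eq)
    \<comment> \<open>Each coefficient of the quotient is determined by the next higher one, so the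
      induction descends from beyond the degree, where the coefficients are 0.\<close>
    have sS: "Polynomial.coeff s i \<in> S" for i
    proof (induction "Suc (Polynomial.degree s) - i" arbitrary: i)
      case 0
      then show ?case by (simp add: coeff_eq_0)
    next
      case (Suc m)
      have "Polynomial.coeff s i = Polynomial.coeff p (Suc i) + a0 * Polynomial.coeff s (Suc i)"
        using ci[of "Suc i"] by simp
      moreover have "Polynomial.coeff s (Suc i) \<in> S" by (rule Suc(1)) (use Suc(2) in simp)
      ultimately show ?case using Suc.prems a0(1) assms(1) \<open>\<And>i. Polynomial.coeff p i \<in> S\<close> by auto
    qed
    have "\<exists>j'. Polynomial.coeff s j' \<notin> P"
    proof (rule ccontr)
      assume "\<not> ?thesis"
      then have sP: "Polynomial.coeff s i \<in> P" for i by blast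
      have "Polynomial.coeff (pCons (poly p a0) s) j \<in> P" using sP a0(2) by (cases j) auto
      then have "Polynomial.coeff p j \<in> P" unfolding ci by (intro P_diff P_mult a0(1) sP)
      then show False using Suc.prems(2) by simp
    qed
    then obtain j' where j': "Polynomial.coeff s j' \<notin> P" by blast
    have "n = Polynomial.degree s" unfolding s_def degree_synthetic_div using Suc(2) by simp
    then obtain T where T: "finite T" "\<forall>a\<in>S. poly s a \<in> P \<longrightarrow> (\<exists>b\<in>T. a - b \<in> P)"
      using Suc(1)[of s j'] sS j' by blast
    have "\<exists>b\<in>insert a0 T. a - b \<in> P" if a: "a \<in> S" "poly p a \<in> P" for a
    proof -
      have "poly p a = poly p a0 + (a - a0) * poly s a"
        using arg_cong[OF ps, of "\<lambda>q. poly q a"] by (simp add: algebra_simps)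
      then have "(a - a0) * poly s a \<in> P" using P_diff[OF a(2) a0(2)] by simp
      then show ?thesis using P_prime[of "a - a0" "poly s a"] a a0 T(2) poly_closed[OF sS a(1)] by auto
    qed
    then show ?thesis using T(1) by (intro exI[of _ "insert a0 T"]) auto
  qed
qed

end

lemma common_denominator:
  assumes k: "subfield k (class_ring :: 'a::field ring)"
    and c: "\<And>i. i \<le> (N::nat) \<Longrightarrow> c i \<in> generate_field class_ring (insert t k)"
  shows "\<exists>d. d \<noteq> 0 \<and> d \<in> pevals k t \<and> (\<forall>i\<le>N. d * c i \<in> pevals k t)"
  using c
proof (induction N)
  case 0
  obtain a b where "a \<in> pevals k t" "b \<in> pevals k t" "b \<noteq> 0" "c 0 = a / b"
    using generate_field_frac[OF k 0[of 0, simplified]] by (elim bexE conjE) auto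
  then show ?case by (intro exI[of _ b]) auto
next
  case (Suc N)
  interpret R: sring "pevals k t" by (rule pevals_sring(1)[OF k])
  obtain d where d: "d \<noteq> 0" "d \<in> pevals k t" "\<forall>i\<le>N. d * c i \<in> pevals k t"
    using Suc by auto
  obtain a b where ab: "a \<in> pevals k t" "b \<in> pevals k t" "b \<noteq> 0" "c (Suc N) = a / b"
    using generate_field_frac[OF k Suc.prems[of "Suc N", simplified]] by (elim bexE conjE) auto
  have "b * d * c i \<in> pevals k t" if "i \<le> N" for i
    using R.mult[OF ab(2) d(3)[rule_format, OF that]] by (simp add: mult.assoc)
  moreover have "b * d * c (Suc N) \<in> pevals k t" using ab d by simp
  ultimately show ?case using d ab by (intro exI[of _ "b * d"]) (auto simp: le_Suc_eq)
qed

text \<open>In contrast to \<open>vring_t\<close>, the place is arbitrary, so \<open>t\<close> may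
  be a unit of \<open>S\<close>. A nonzero element of \<open>P\<close> that is a polynomial in
  \<open>t\<close> therefore has to be found first.\<close>

locale vring_generator = vring S for S :: "'a::field set" +
  fixes t :: 'a and k :: "'a set" and N :: nat
  assumes tS: "t \<in> S" and k: "subfield k (class_ring :: 'a ring)" and kS: "k \<subseteq> S" and fin_k: "finite k"
    and transc: "\<And>p. (\<And>i. Polynomial.coeff p i \<in> k) \<Longrightarrow> poly p t = 0 \<Longrightarrow> p = 0"
    and N: "ring.dimension class_ring N (generate_field class_ring (insert t k)) UNIV"
    and nontriv: "\<exists>z\<in>P. z \<noteq> 0"
begin

lemma pevals_S: assumes "z \<in> pevals k t" shows "z \<in> S"
proof -
  obtain p where "z = poly p t" "\<And>i. Polynomial.coeff p i \<in> k"
    using assms unfolding pevals_def by blast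
  then show ?thesis using poly_closed[of p t] kS tS by blast
qed

text \<open>The N + 1 powers of \<open>z\<close> up to exponent \<open>N\<close> are dependent over
  k(t), which has codegree \<open>N\<close>; a common denominator turns the coefficients into
  polynomials in \<open>t\<close>.\<close>

lemma polynomial_relation:
  "\<exists>C. (\<forall>i j. Polynomial.coeff (C i) j \<in> k) \<and> (\<exists>i\<le>N. C i \<noteq> 0) \<and> (\<Sum>i\<le>N. poly (C i) t * z ^ i) = 0"
proof -
  let ?K = "generate_field (class_ring :: 'a ring) (insert t k)"
  have K: "subfield ?K (class_ring :: 'a ring)"
    by (rule field.generate_field_is_subfield[OF class_field]) auto
  obtain c where c: "\<forall>i\<le>N. c i \<in> ?K" "\<exists>i\<le>N. c i \<noteq> 0" "(\<Sum>i\<le>N. c i * z ^ i) = 0"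
    using finite_dimension_relation[OF K N, of z] by auto
  obtain d where d: "d \<noteq> 0" "\<forall>i\<le>N. d * c i \<in> pevals k t"
    using common_denominator[OF k, of N c t] c(1) by auto
  have "\<forall>i. \<exists>p. (\<forall>j. Polynomial.coeff p j \<in> k) \<and> (i \<le> N \<longrightarrow> d * c i = poly p t)"
  proof
    fix i
    show "\<exists>p. (\<forall>j. Polynomial.coeff p j \<in> k) \<and> (i \<le> N \<longrightarrow> d * c i = poly p t)"
    proof (cases "i \<le> N")
      case True then show ?thesis using d(2) unfolding pevals_def by blast
    next
      case False then show ?thesis using subfield_class_ring(1)[OF k] by (intro exI[of _ 0]) auto
    qed
  qed
  then obtain C where C: "\<And>i j. Polynomial.coeff (C i) j \<in> k" "\<And>i. i \<le> N \<Longrightarrow> d * c i = poly (C i) t"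
    by metis
  have "(\<Sum>i\<le>N. poly (C i) t * z ^ i) = (\<Sum>i\<le>N. d * (c i * z ^ i))"
    by (rule sum.cong) (auto simp: C(2)[symmetric])
  also have "\<dots> = 0" using c(3) by (simp flip: sum_distrib_left)
  finally have "(\<Sum>i\<le>N. poly (C i) t * z ^ i) = 0" .
  moreover have "\<exists>i\<le>N. C i \<noteq> 0" using c(2) C(2) d(1) by (metis mult_eq_0_iff poly_0)
  ultimately show ?thesis using C(1) by (intro exI[of _ C]) auto
qed

text \<open>Otherwise all values at \<open>t\<close> of nonzero polynomials over \<open>k\<close>
  are units. A polynomial relation for a nonzero \<open>z\<close> in \<open>P\<close> has two terms
  whose quotient is a unit, and since their coefficients are units, a positive power of
  \<open>z\<close> would be a unit as well.\<close>

lemma ex_poly_in_P: "\<exists>f. poly_over k f \<and> f \<noteq> 0 \<and> poly f t \<in> P"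
proof (rule ccontr)
  assume "\<not> ?thesis"
  then have nP: "poly f t \<notin> P" if "\<And>i. Polynomial.coeff f i \<in> k" "f \<noteq> 0" for f using that by blast
  obtain z where z: "z \<in> P" "z \<noteq> 0" using nontriv by blast
  obtain C where C: "\<And>i j. Polynomial.coeff (C i) j \<in> k" "\<exists>i\<le>N. C i \<noteq> 0"
    "(\<Sum>i\<le>N. poly (C i) t * z ^ i) = 0" using polynomial_relation[of z] by blast
  have CU: "poly (C i) t \<in> U" if "C i \<noteq> 0" for i
    using S_cases[OF poly_closed[of "C i" t]] C(1) kS tS nP[OF C(1) that] by blast
  obtain i1 where "i1 \<le> N" "C i1 \<noteq> 0" using C(2) by blast
  then have "\<exists>i\<in>{..N}. \<exists>j\<in>{..N}. i \<noteq> j \<and> poly (C i) t * z ^ i \<noteq> 0 \<and> poly (C j) t * z ^ j \<noteq> 0 \<and>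
      (poly (C i) t * z ^ i) / (poly (C j) t * z ^ j) \<in> U"
    using z(2) transc[OF C(1)] C(3) ex_associate[of "{..N}" "\<lambda>i. poly (C i) t * z ^ i" i1] by auto
  then obtain i j where ij: "i \<noteq> j" "poly (C i) t \<noteq> 0" "poly (C j) t \<noteq> 0"
    "(poly (C i) t * z ^ i) / (poly (C j) t * z ^ j) \<in> U" by auto
  have main: False if ij: "i < j" "poly (C i) t \<noteq> 0" "poly (C j) t \<noteq> 0"
    "(poly (C j) t * z ^ j) / (poly (C i) t * z ^ i) \<in> U" for i j
  proof -
    have U2: "poly (C i) t \<in> U" "poly (C j) t \<in> U" using CU ij by (metis poly_0)+
    have zj: "z ^ j = z ^ i * (z * z ^ (j - i - 1))"
      using ij(1) by (simp flip: power_add power_Suc add: Suc_diff_Suc)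
    have e: "z * z ^ (j - i - 1) = ((poly (C j) t * z ^ j) / (poly (C i) t * z ^ i)) * (poly (C i) t * inverse (poly (C j) t))"
      using ij(2,3) z(2) unfolding zj by (simp add: field_simps)
    have "z * z ^ (j - i - 1) \<in> U" unfolding e by (intro U_mult ij(4) U2(1) U_inv U2(2))
    moreover have "z * z ^ (j - i - 1) \<in> P"
      using P_mult[OF pow[OF P_S[OF z(1)]] z(1)] by (simp add: mult.commute)
    ultimately show False using U_not_P by blast
  qed
  show False
  proof (cases "i < j")
    case True
    then show False using main[OF True ij(2,3)] U_inv[OF ij(4)] by simp
  next
    case False
    then show False using main[of j i] ij by simp
  qed
qed

text \<open>The residue class of \<open>a\<close> is a root of a nonzero polynomial of degree at most \<open>N\<close> with
  coefficients among the finitely many values at \<open>t\<close> of remainders modulo \<open>f\<close>: divide the coefficients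
  of a polynomial relation for \<open>a\<close> of minimal total degree by \<open>f\<close>.\<close>

theorem finite_residues: "\<exists>T. finite T \<and> (\<forall>a\<in>S. \<exists>b\<in>T. a - b \<in> P)"
proof -
  define Q where "Q f \<longleftrightarrow> poly_over k f \<and> f \<noteq> 0 \<and> poly f t \<in> P" for f
  obtain f where f: "Q f" "\<And>g. Q g \<Longrightarrow> Polynomial.degree f \<le> Polynomial.degree g"
    using ex_has_least_nat[of Q _ Polynomial.degree] ex_poly_in_P unfolding Q_def by blast
  then have fk: "\<And>i. Polynomial.coeff f i \<in> k" "f \<noteq> 0" "poly f t \<in> P" by (auto simp: Q_def)
  have f0: "poly f t \<noteq> 0" using transc[OF fk(1)] fk(2) by blast
  have kP: "a \<notin> P" if "a \<in> k" "a \<noteq> 0" for a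
    using that subfield_class_ring(6)[OF k, of a] kS by (auto simp: P_def)
  \<comment> \<open>Nonzero constants are units of \<open>S\<close>. Positive degree makes division
    by \<open>f\<close> strictly lower the total degree of a relation below.\<close>
  have degf: "Polynomial.degree f > 0"
  proof (rule ccontr)
    assume "\<not> Polynomial.degree f > 0"
    then obtain c where "f = [:c:]" by (metis degree_eq_zeroE gr0I)
    then show False using fk kP[of c] fk(1)[of 0] by auto
  qed
  define D where "D = {r. poly_over k r \<and> (r = 0 \<or> Polynomial.degree r < Polynomial.degree f)}"
  have finD: "finite D" unfolding D_def by (rule finite_polys_bounded[OF fin_k])
  define E where "E = insert 0 ((\<lambda>r. poly r t) ` D)"
  have finE: "finite E" using finD by (simp add: E_def)
  have ES: "e \<in> S" if "e \<in> E" for e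
    using that pevals_S by (auto simp: E_def D_def pevals_def)
  define \<R> where "\<R> = {R. poly_over E R \<and> (R = 0 \<or> Polynomial.degree R < Suc N)}"
  have "finite \<R>" unfolding \<R>_def by (rule finite_polys_bounded[OF finE])
  have "\<forall>R\<in>{R\<in>\<R>. \<exists>j. Polynomial.coeff R j \<notin> P}. \<exists>T. finite T \<and> (\<forall>a\<in>S. poly R a \<in> P \<longrightarrow> (\<exists>b\<in>T. a - b \<in> P))"
    using finite_roots ES unfolding \<R>_def by blast
  then obtain T where T: "\<And>R. R \<in> \<R> \<Longrightarrow> \<exists>j. Polynomial.coeff R j \<notin> P \<Longrightarrow> finite (T R)"
    "\<And>R a. R \<in> \<R> \<Longrightarrow> \<exists>j. Polynomial.coeff R j \<notin> P \<Longrightarrow> a \<in> S \<Longrightarrow> poly R a \<in> P \<Longrightarrow> \<exists>b\<in>T R. a - b \<in> P"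
    unfolding mem_Collect_eq Ball_def by metis
  have "\<exists>R\<in>\<R>. (\<exists>j. Polynomial.coeff R j \<notin> P) \<and> poly R a \<in> P" if a: "a \<in> S" for a
  proof -
    define V where "V C \<longleftrightarrow> (\<forall>i j. Polynomial.coeff (C i) j \<in> k) \<and> (\<exists>i\<le>N. C i \<noteq> 0) \<and>
      (\<Sum>i\<le>N. poly (C i) t * a ^ i) = 0" for C
    obtain C where C: "V C" "\<And>C'. V C' \<Longrightarrow> (\<Sum>i\<le>N. Polynomial.degree (C i)) \<le> (\<Sum>i\<le>N. Polynomial.degree (C' i))"
      using ex_has_least_nat[of V _ "\<lambda>C. \<Sum>i\<le>N. Polynomial.degree (C i)"] polynomial_relation[of a]
      unfolding V_def by blast
    then have Ck: "\<And>i j. Polynomial.coeff (C i) j \<in> k" by (auto simp: V_def)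
    have "\<forall>i. \<exists>q r. (\<forall>j. Polynomial.coeff q j \<in> k) \<and> r \<in> D \<and> C i = f * q + r"
      using poly_division_subfield[OF k fk(1,2) Ck] unfolding D_def by blast
    then obtain q r where qr: "\<And>i j. Polynomial.coeff (q i) j \<in> k" "\<And>i. r i \<in> D" "\<And>i. C i = f * q i + r i"
      by metis
    \<comment> \<open>If all remainders vanished, the nonzero factor \<open>poly f t\<close> could
      be cancelled from the relation, and the quotients would form a relation of smaller total
      degree.\<close>
    have r0: "\<exists>i\<le>N. r i \<noteq> 0"
    proof (rule ccontr)
      assume "\<not> ?thesis"
      then have Cq: "C i = f * q i" if "i \<le> N" for i using qr(3) that by simp
      have "poly f t * (\<Sum>i\<le>N. poly (q i) t * a ^ i) = (\<Sum>i\<le>N. poly (C i) t * a ^ i)"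
        unfolding sum_distrib_left by (rule sum.cong) (auto simp: Cq mult.assoc)
      also have "\<dots> = 0" using C(1) by (simp add: V_def)
      finally have "(\<Sum>i\<le>N. poly (q i) t * a ^ i) = 0" using f0 by simp
      then have "V q" using C(1) qr(1) Cq by (auto simp: V_def)
      moreover have "(\<Sum>i\<le>N. Polynomial.degree (q i)) < (\<Sum>i\<le>N. Polynomial.degree (C i))"
      proof (rule sum_strict_mono_ex1)
        have dC: "Polynomial.degree (C i) = Polynomial.degree f + Polynomial.degree (q i)" if "i \<le> N" "C i \<noteq> 0" for i
          using that Cq[OF that(1)] by (simp add: degree_mult_eq)
        show "\<forall>i\<in>{..N}. Polynomial.degree (q i) \<le> Polynomial.degree (C i)"
        proof
          fix i assume "i \<in> {..N}"
          then show "Polynomial.degree (q i) \<le> Polynomial.degree (C i)" using dC[of i] Cq[of i] fk(2) by (cases "C i = 0") auto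
        qed
        obtain i where "i \<le> N" "C i \<noteq> 0" using C(1) by (auto simp: V_def)
        then show "\<exists>i\<in>{..N}. Polynomial.degree (q i) < Polynomial.degree (C i)" using dC[of i] degf by (intro bexI[of _ i]) auto
      qed auto
      ultimately show False using C(2)[of q] by simp
    qed
    define R where "R = (\<Sum>i\<le>N. Polynomial.monom (poly (r i) t) i)"
    have cR: "Polynomial.coeff R i = (if i \<le> N then poly (r i) t else 0)" for i
      by (simp add: R_def coeff_sum)
    have "R \<in> \<R>"
    proof -
      have "Polynomial.coeff R i \<in> E" for i using qr(2) by (simp add: cR E_def)
      moreover have "Polynomial.degree R < Suc N" by (rule le_imp_less_Suc, rule degree_le) (simp add: cR)
      ultimately show ?thesis by (simp add: \<R>_def)
    qed
    moreover have "\<exists>j. Polynomial.coeff R j \<notin> P"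
    proof -
      obtain i where i: "i \<le> N" "r i \<noteq> 0" using r0 by blast
      \<comment> \<open>A nonzero remainder has smaller degree than \<open>f\<close>, and
        \<open>f\<close> was chosen of least degree among the nonzero polynomials with value in
        \<open>P\<close>.\<close>
      have "poly (r i) t \<notin> P"
      proof
        assume "poly (r i) t \<in> P"
        then have "Q (r i)" using i(2) qr(2)[of i] by (auto simp: Q_def D_def)
        then show False using f(2)[of "r i"] qr(2)[of i] i(2) by (auto simp: D_def)
      qed
      then show ?thesis using i(1) by (intro exI[of _ i]) (simp add: cR)
    qed
    moreover have "poly R a \<in> P"
    proof -
      have "poly R a = (\<Sum>i\<le>N. poly (r i) t * a ^ i)" by (simp add: R_def poly_sum poly_monom)
      also have "\<dots> = (\<Sum>i\<le>N. poly (C i) t * a ^ i - poly f t * (poly (q i) t * a ^ i))"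
        by (rule sum.cong) (auto simp: qr(3) algebra_simps)
      also have "\<dots> = - (\<Sum>i\<le>N. (poly (q i) t * a ^ i)) * poly f t"
        using C(1) by (simp add: V_def sum_subtractf mult.commute flip: sum_distrib_left)
      also have "\<dots> \<in> P"
        by (intro P_mult uminus sum_in mult pow a fk(3)) (rule pevals_S, use qr(1) in \<open>auto simp: pevals_def\<close>)
      finally show ?thesis .
    qed
    ultimately show ?thesis by blast
  qed
  then have "\<forall>a\<in>S. \<exists>b\<in>\<Union>(T ` {R\<in>\<R>. \<exists>j. Polynomial.coeff R j \<notin> P}). a - b \<in> P"
    using T(2) by (metis (mono_tags, lifting) UN_I mem_Collect_eq)
  moreover have "finite (\<Union>(T ` {R\<in>\<R>. \<exists>j. Polynomial.coeff R j \<notin> P}))"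
    using \<open>finite \<R>\<close> T(1) by auto
  ultimately show ?thesis by blast
qed

end

section \<open>From valuation rings to the places of a function field\<close>

lemma vring_valuation:
  assumes v: "is_valuation v"
  shows "vring {a. val_ge v 0 a}" and "vring.P {a. val_ge v 0 a} = {a. val_ge v 1 a}"
proof -
  have s: "sring {a. val_ge v 0 a}"
    using val_ge_one[OF v] val_ge_add[OF v, of 0] val_ge_uminus[OF v] val_ge_mult[OF v, of 0 _ 0]
    by unfold_locales auto
  have inv: "v (inverse z) = - v z" if "z \<noteq> 0" for z
    using val_mult[OF v, of z "inverse z"] val_one[OF v] that by simp
  show V: "vring {a. val_ge v 0 a}"
    by (intro vring.intro s vring_axioms.intro) (auto simp: val_ge_def inv)
  show "vring.P {a. val_ge v 0 a} = {a. val_ge v 1 a}"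
    unfolding vring.P_def[OF V] by (auto simp: val_ge_def inv)
qed

text \<open>The powers of a nonzero element of a finite field repeat, which forces its valuation to
  be 0.\<close>

lemma valuation_finite_subfield:
  fixes v :: "'a::field \<Rightarrow> int"
  assumes v: "is_valuation v" and k: "subfield k (class_ring :: 'a ring)" "finite k" and a: "a \<in> k"
  shows "val_ge v 0 a"
proof (cases "a = 0")
  case False
  interpret K: sring k by (rule sring_subfield[OF k(1)])
  have "\<not> inj (\<lambda>n. a ^ n)"
  proof
    assume i: "inj (\<lambda>n. a ^ n)"
    have "range (\<lambda>n. a ^ n) \<subseteq> k" using a by auto
    then show False using i k(2) finite_imageD finite_subset by blast
  qed
  then obtain m n where mn: "m < n" "a ^ m = a ^ n"
    by (metis injI linorder_neqE_nat)
  have pow: "v (a ^ n) = int n * v a" for n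
    by (induction n) (use False in \<open>auto simp: val_mult[OF v] val_one[OF v] algebra_simps\<close>)
  have "int m * v a = int n * v a" using pow mn(2) by metis
  then have "v a = 0" using mn(1) by simp
  then show ?thesis by (simp add: val_ge_def)
qed (simp add: val_ge_def)

lemma function_field_finite_residues:
  assumes ff: "function_field_over (class_ring :: 'a::field ring) k" and v: "is_valuation v"
  shows "\<exists>T. finite T \<and> (\<forall>a::'a. val_ge v 0 a \<longrightarrow> (\<exists>b\<in>T. val_ge v 1 (a - b)))"
proof -
  have k: "subfield k (class_ring :: 'a ring)" "finite k" using ff by (simp_all add: function_field_over_def)
  obtain t N where t: "ring.transcendental class_ring k t"
    and N: "ring.dimension class_ring N (generate_field class_ring (insert t k)) UNIV"
    using ff unfolding function_field_over_def ring.finite_dimension_def[OF class_ring_ring] by auto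
  interpret vring "{a. val_ge v 0 a}" by (rule vring_valuation(1)[OF v])
  note P = vring_valuation(2)[OF v]
  have kS: "k \<subseteq> {a. val_ge v 0 a}" using valuation_finite_subfield[OF v k] by blast
  obtain z where z: "z \<noteq> 0" "v z = 1" using v unfolding is_valuation_def by blast
  have nontriv: "\<exists>z\<in>P. z \<noteq> 0" using z unfolding P by (intro bexI[of _ z]) (auto simp: val_ge_def)
  have main: ?thesis if "vring_generator {a. val_ge v 0 a} t' k N" for t'
    using vring_generator.finite_residues[OF that] unfolding P by auto
  have tr: "p = 0" if "\<And>i. Polynomial.coeff p i \<in> k" "poly p t = 0" for p
    using transcendental_poly[OF k(1) t] that by blast
  show ?thesis
  proof (cases "t \<in> {a. val_ge v 0 a}")
    case True
    then show ?thesis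
      by (intro main[of t] vring_generator.intro vring_generator_axioms.intro vring_axioms k kS N nontriv)
        (auto intro: tr)
  next
    case False
    \<comment> \<open>At a pole of \<open>t\<close> the element \<open>inverse t\<close> takes over:
      it is integral, it generates the same field over \<open>k\<close>, and it is transcendental
      because reversing the coefficients turns a relation for it into one for
      \<open>t\<close>.\<close>
    then have it: "inverse t \<in> {a. val_ge v 0 a}" using val[of t] by blast
    have t0: "t \<noteq> 0" using False by (auto simp: val_ge_def)
    have field_mono: "generate_field class_ring (insert a k) \<subseteq> generate_field class_ring (insert (inverse a) k)" for a :: 'a
    proof (rule field.generate_field_min_subfield1[OF class_field])
      have K: "subfield (generate_field class_ring (insert (inverse a) k)) (class_ring :: 'a ring)"
        by (rule field.generate_field_is_subfield[OF class_field]) auto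
      then show "subfield (generate_field class_ring (insert (inverse a) k)) (class_ring :: 'a ring)" .
      have "insert (inverse a) k \<subseteq> generate_field class_ring (insert (inverse a) k)"
        by (auto intro: generate_field.incl)
      then show "insert a k \<subseteq> generate_field class_ring (insert (inverse a) k)"
        using subfield_class_ring(6)[OF K, of "inverse a"] by auto
    qed simp
    have gen: "generate_field class_ring (insert t k) = generate_field class_ring (insert (inverse t) k)"
      using field_mono[of "inverse t"] unfolding inverse_inverse_eq by (intro subset_antisym field_mono)
    have "p = 0" if p: "\<And>i. Polynomial.coeff p i \<in> k" "poly p (inverse t) = 0" for p
    proof -
      have "poly (reflect_poly p) t = t ^ Polynomial.degree p * poly p (inverse t)"
        by (rule poly_reflect_poly_nz) (rule t0)
      moreover have "Polynomial.coeff (reflect_poly p) i \<in> k" for i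
        using p(1) subfield_class_ring(1)[OF k(1)] by (simp add: coeff_reflect_poly)
      ultimately have "reflect_poly p = 0" using p(2) tr[of "reflect_poly p"] by simp
      then show ?thesis using coeff_0_reflect_poly_0_iff[of p] by simp
    qed
    moreover note N[unfolded gen]
    ultimately show ?thesis
      by (intro main[of "inverse t"] vring_generator.intro vring_generator_axioms.intro vring_axioms k kS nontriv it) blast+
  qed
qed

section \<open>Frobenius modulo the maximal ideal\<close>

lemma function_field_prime_CHAR:
  assumes "function_field_over (class_ring :: 'a::field ring) k"
  shows "Factorial_Ring.prime CHAR('a)"
proof -
  have k: "subfield k (class_ring :: 'a ring)" "finite k" using assms by (simp_all add: function_field_over_def)
  interpret K: sring k by (rule sring_subfield[OF k(1)])
  have "of_nat n \<in> k" for n by (induction n) auto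
  then have "range (of_nat :: nat \<Rightarrow> 'a) \<subseteq> k" by auto
  then have "\<not> inj (of_nat :: nat \<Rightarrow> 'a)"
    using k(2) finite_imageD finite_subset by blast
  then obtain m n where mn: "m < n" "of_nat m = (of_nat n :: 'a)"
    by (metis injI linorder_neqE_nat)
  then have "of_nat (n - m) = (0 :: 'a)" by (simp add: of_nat_diff)
  then have "CHAR('a) > 0" using mn(1) by (auto simp: CHAR_pos_iff intro!: exI[of _ "n - m"])
  then show ?thesis by (rule prime_CHAR_semidom)
qed

text \<open>\<open>T\<close> has to meet every residue class; its members may be non-integral or
  congruent to each other. Finiteness of the residue field enters through \<open>T\<close>.\<close>

locale residue_valuation =
  fixes v :: "'a::field \<Rightarrow> int" and T :: "'a set"
  assumes v: "is_valuation v" and CHAR: "Factorial_Ring.prime CHAR('a)" and finT: "finite T"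
    and T: "\<And>a. val_ge v 0 a \<Longrightarrow> \<exists>b\<in>T. val_ge v 1 (a - b)"
begin

abbreviation integral :: "'a \<Rightarrow> bool" where "integral \<equiv> val_ge v 0"
abbreviation cong_m :: "'a \<Rightarrow> 'a \<Rightarrow> bool" (infix "\<doteq>" 50) where "a \<doteq> b \<equiv> val_ge v 1 (a - b)"

lemma cong_sym: "a \<doteq> b \<Longrightarrow> b \<doteq> a"
  using val_ge_uminus[OF v, of 1 "a - b"] by simp

lemma cong_trans: "a \<doteq> b \<Longrightarrow> b \<doteq> c \<Longrightarrow> a \<doteq> c"
  using val_ge_add[OF v, of 1 "a - b" "b - c"] by simp

lemma val_ge_diff: "val_ge v M a \<Longrightarrow> val_ge v M b \<Longrightarrow> val_ge v M (a - b)"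
  using val_ge_add[OF v, of M a "- b"] val_ge_uminus[OF v] by simp

lemma val_ge_power: "val_ge v M a \<Longrightarrow> val_ge v (int n * M) (a ^ n)"
proof (induction n)
  case (Suc n)
  then show ?case using val_ge_mult[OF v, of M a "int n * M" "a ^ n"] by (simp add: algebra_simps)
qed (simp add: val_ge_one[OF v])

lemma integral_power: "integral a \<Longrightarrow> integral (a ^ n)"
  using val_ge_power[of 0 a n] by simp

lemma power_m: assumes "val_ge v 1 (a ^ n)" shows "val_ge v 1 a"
proof (cases "a = 0")
  case False
  have pow: "v (a ^ n) = int n * v a" for n
    by (induction n) (use False in \<open>auto simp: val_mult[OF v] val_one[OF v] algebra_simps\<close>)
  have "1 \<le> int n * v a" using assms False pow[of n] by (simp add: val_ge_def)
  then have "0 < int n * v a" by simp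
  then have "0 < v a" by (simp add: zero_less_mult_iff)
  then show ?thesis by (simp add: val_ge_def)
qed (simp add: val_ge_def)

lemma frobenius_diff: "(a - b :: 'a) ^ (CHAR('a) ^ n) = a ^ (CHAR('a) ^ n) - b ^ (CHAR('a) ^ n)"
  using freshmans_dream'[OF CHAR refl, of "a - b" b n] by (simp add: eq_diff_eq)

lemma cong_frobenius: assumes "a \<doteq> b" shows "a ^ (CHAR('a) ^ n) \<doteq> b ^ (CHAR('a) ^ n)"
proof -
  have "val_ge v (int (CHAR('a) ^ n) * 1) ((a - b) ^ (CHAR('a) ^ n))"
    by (rule val_ge_power[OF assms])
  moreover have "CHAR('a) ^ n \<ge> 1" using prime_gt_0_nat[OF CHAR] by (simp add: Suc_le_eq)
  ultimately show ?thesis unfolding frobenius_diff by (elim val_ge_mono[OF v]) linarith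
qed

text \<open>By pigeonhole on \<open>T\<close>, two iterated Frobenius powers of \<open>a\<close> are
  congruent, with exponents \<open>i\<close> < \<open>j\<close>. Additivity of Frobenius exhibits
  their difference as the p^\<open>i\<close>-th power of the difference for the exponents
  \<open>j - i\<close> and 0, and the maximal ideal is radical.\<close>

lemma ex_frobenius_period: assumes a: "integral a" shows "\<exists>d>0. a ^ (CHAR('a) ^ d) \<doteq> a"
proof -
  have "\<forall>i. \<exists>b\<in>T. a ^ (CHAR('a) ^ i) \<doteq> b" using T integral_power[OF a] by blast
  then obtain b where b: "\<And>i. b i \<in> T" "\<And>i. a ^ (CHAR('a) ^ i) \<doteq> b i" by metis
  have "\<not> inj b" using b(1) finT finite_imageD finite_subset by (metis image_subsetI infinite_UNIV_nat)
  then obtain i j where ij: "i < j" "b i = b j" by (metis injI linorder_neqE_nat)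
  then have "a ^ (CHAR('a) ^ j) \<doteq> a ^ (CHAR('a) ^ i)"
    using b(2)[of i] b(2)[of j] cong_trans cong_sym by metis
  moreover have "a ^ (CHAR('a) ^ j) = (a ^ (CHAR('a) ^ (j - i))) ^ (CHAR('a) ^ i)"
    using ij(1) by (simp flip: power_mult power_add)
  ultimately have "val_ge v 1 ((a ^ (CHAR('a) ^ (j - i)) - a) ^ (CHAR('a) ^ i))"
    by (simp add: frobenius_diff)
  then have "a ^ (CHAR('a) ^ (j - i)) \<doteq> a" by (rule power_m)
  then show ?thesis using ij(1) by (intro exI[of _ "j - i"]) auto
qed

lemma frobenius_period_multiple:
  assumes "a ^ (CHAR('a) ^ d) \<doteq> a" shows "a ^ (CHAR('a) ^ (d * m)) \<doteq> a"
proof (induction m)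
  case (Suc m)
  have "a ^ (CHAR('a) ^ (d * Suc m)) = (a ^ (CHAR('a) ^ (d * m))) ^ (CHAR('a) ^ d)"
    by (simp add: mult.commute flip: power_mult power_add)
  then show ?case using cong_trans[OF cong_frobenius[OF Suc, of d] assms] by simp
qed (simp add: val_ge_zero[OF v])

text \<open>Congruent elements share their periods because Frobenius respects congruence, so the
  product of the periods of the finitely many integral representatives serves for all integral
  elements.\<close>

lemma ex_common_period: "\<exists>e>0. \<forall>a. integral a \<longrightarrow> a ^ (CHAR('a) ^ e) \<doteq> a"
proof -
  define d where "d a = (SOME d. d > 0 \<and> a ^ (CHAR('a) ^ d) \<doteq> a)" for a
  have d: "d a > 0 \<and> a ^ (CHAR('a) ^ d a) \<doteq> a" if "integral a" for a
    unfolding d_def by (rule someI_ex) (use ex_frobenius_period[OF that] in auto)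
  define T' where "T' = {b\<in>T. integral b}"
  have fT': "finite T'" using finT by (simp add: T'_def)
  define e where "e = (\<Prod>b\<in>T'. d b)"
  have "a ^ (CHAR('a) ^ e) \<doteq> a" if a: "integral a" for a
  proof -
    obtain b where b: "b \<in> T" "a \<doteq> b" using T[OF a] by blast
    have ib: "integral b" using val_ge_diff[OF a val_ge_mono[OF v b(2), of 0]] by simp
    then have "b \<in> T'" using b(1) by (simp add: T'_def)
    then have "d b dvd e" unfolding e_def using fT' by (rule dvd_prodI[rotated])
    then obtain m where m: "e = d b * m" by (elim dvdE)
    have "b ^ (CHAR('a) ^ e) \<doteq> b" unfolding m by (rule frobenius_period_multiple) (use d ib in auto)
    then show ?thesis using cong_frobenius[OF b(2), of e] b(2) cong_trans cong_sym by metis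
  qed
  moreover have "e > 0" unfolding e_def by (rule prod_pos) (use d in \<open>auto simp: T'_def\<close>)
  ultimately show ?thesis by blast
qed

text \<open>The Q of the overview. It is a power of the order of the residue field but need not
  equal that order. The positive exponent makes it at least 2, so that raising to this power
  increases positive valuations.\<close>

definition frob :: nat where
  "frob = CHAR('a) ^ (SOME e. e > 0 \<and> (\<forall>a. integral a \<longrightarrow> a ^ (CHAR('a) ^ e) \<doteq> a))"

lemma frob: "frob \<ge> 2" "integral a \<Longrightarrow> a ^ frob \<doteq> a" "(a - b) ^ frob = a ^ frob - (b::'a) ^ frob"
  "(a + b) ^ frob = a ^ frob + (b::'a) ^ frob"
proof -
  define e where "e = (SOME e. e > 0 \<and> (\<forall>a. integral a \<longrightarrow> a ^ (CHAR('a) ^ e) \<doteq> a))"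
  have e: "e > 0 \<and> (\<forall>a. integral a \<longrightarrow> a ^ (CHAR('a) ^ e) \<doteq> a)"
    unfolding e_def by (rule someI_ex) (use ex_common_period in auto)
  have f: "frob = CHAR('a) ^ e" by (simp add: frob_def e_def)
  have "CHAR('a) ^ 1 \<le> frob" unfolding f
    by (rule power_increasing) (use e CHAR prime_gt_0_nat in \<open>auto simp: Suc_le_eq\<close>)
  then show "frob \<ge> 2" using prime_ge_2_nat[OF CHAR] by simp
  show "a ^ frob \<doteq> a" if "integral a" using e that by (simp add: f)
  show "(a - b) ^ frob = a ^ frob - b ^ frob" unfolding f by (rule frobenius_diff)
  show "(a + b) ^ frob = a ^ frob + b ^ frob" unfolding f by (rule freshmans_dream'[OF CHAR refl])
qed

lemma frob_pow:
  "(a - b) ^ (frob ^ i) = a ^ (frob ^ i) - (b::'a) ^ (frob ^ i)"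
  "(a + b) ^ (frob ^ i) = a ^ (frob ^ i) + (b::'a) ^ (frob ^ i)"
  by (induction i) (simp_all add: frob power_mult mult.commute[of frob])

lemma frob_pow_ge: "i \<le> frob ^ i" "1 \<le> frob ^ i"
proof -
  have "i < 2 ^ i" by simp
  also have "\<dots> \<le> frob ^ i" by (rule power_mono) (use frob(1) in auto)
  finally show "i \<le> frob ^ i" by simp
  show "1 \<le> frob ^ i" using frob(1) by (simp add: Suc_le_eq)
qed

lemma val_ge_frob_pow: assumes "val_ge v 1 a" shows "val_ge v (int i) (a ^ (frob ^ i))"
proof -
  have "int i \<le> int (frob ^ i) * 1" using frob_pow_ge(1)[of i] by linarith
  then show ?thesis by (rule val_ge_mono[OF v val_ge_power[OF assms]])
qed

lemma cong_frob_pow: assumes "integral a" shows "a ^ (frob ^ i) \<doteq> a"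
proof (induction i)
  case (Suc i)
  have "a ^ (frob ^ Suc i) = (a ^ (frob ^ i)) ^ frob" by (simp add: mult.commute flip: power_mult)
  then show ?case using cong_trans[OF frob(2)[OF integral_power[OF assms]] Suc] by simp
qed (simp add: val_ge_zero[OF v])

text \<open>The Cauchy sequence of iterated Frobenius powers converges to the Teichmueller representative.\<close>

abbreviation teich_seq :: "'a \<Rightarrow> nat \<Rightarrow> 'a" where "teich_seq a \<equiv> \<lambda>i. a ^ (frob ^ i)"

text \<open>Frobenius is additive, so consecutive terms differ by an iterated Frobenius power of
  \<open>a ^ frob - a\<close>, which has positive valuation. The crude bound that
  \<open>frob ^ j\<close> is at least \<open>j\<close> is enough.\<close>

lemma teich_seq_diff:
  assumes a: "integral a" and ij: "i \<le> j" shows "val_ge v (int i) (teich_seq a j - teich_seq a i)"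
  using ij
proof (induction j rule: dec_induct)
  case base show ?case by (simp add: val_ge_def)
next
  case (step j)
  have "teich_seq a (Suc j) - teich_seq a j = (a ^ frob - a) ^ (frob ^ j)"
    by (simp add: frob_pow flip: power_mult)
  then have "val_ge v (int j) (teich_seq a (Suc j) - teich_seq a j)"
    using val_ge_frob_pow[OF frob(2)[OF a], of j] by simp
  then have "val_ge v (int i) (teich_seq a (Suc j) - teich_seq a j)"
    using val_ge_mono[OF v] step(1) by simp
  then show ?case using val_ge_add[OF v _ step(3)] by fastforce
qed

lemma teich_seq_cauchy: assumes a: "integral a" shows "teich_seq a \<in> cauchy_seqs v"
  unfolding cauchy_seqs_def
proof (intro CollectI allI exI impI)
  fix M :: int and i j assume ij: "nat M \<le> i" "nat M \<le> j"
  have "val_ge v (int (nat M)) ((teich_seq a i - teich_seq a (nat M)) - (teich_seq a j - teich_seq a (nat M)))"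
    by (intro val_ge_diff teich_seq_diff a ij)
  then have "val_ge v (int (nat M)) (teich_seq a i - teich_seq a j)" unfolding diff_diff_eq2 by simp
  then show "val_ge v M (teich_seq a i - teich_seq a j)" by (rule val_ge_mono[OF v]) simp
qed

end

section \<open>Completions as classes of Cauchy sequences\<close>

definition seq_class :: "('a::field \<Rightarrow> int) \<Rightarrow> (nat \<Rightarrow> 'a) \<Rightarrow> (nat \<Rightarrow> 'a) set" where
  "seq_class v s = null_seqs v +>\<^bsub>cauchy_ring v\<^esub> s"

context
  fixes v :: "'a::field \<Rightarrow> int"
  assumes v: "is_valuation v"
begin

private abbreviation \<C> where "\<C> \<equiv> completion_ring v"

lemma seq_class_closed: "s \<in> cauchy_seqs v \<Longrightarrow> seq_class v s \<in> carrier \<C>"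
  using ring_hom_memE(1)[OF completion_ring_hom[OF v]] by (simp add: seq_class_def cauchy_ring_simps)

lemma seq_class_ops:
  assumes "s \<in> cauchy_seqs v" "t \<in> cauchy_seqs v"
  shows "seq_class v s \<oplus>\<^bsub>\<C>\<^esub> seq_class v t = seq_class v (\<lambda>i. s i + t i)"
    "seq_class v s \<otimes>\<^bsub>\<C>\<^esub> seq_class v t = seq_class v (\<lambda>i. s i * t i)"
  using ring_hom_add[OF completion_ring_hom[OF v], of s t] ring_hom_mult[OF completion_ring_hom[OF v], of s t] assms
  by (simp_all add: seq_class_def cauchy_ring_simps)

lemma seq_class_one: "\<one>\<^bsub>\<C>\<^esub> = seq_class v (\<lambda>i. 1)"
  using ring_hom_one[OF completion_ring_hom[OF v]] by (simp add: seq_class_def cauchy_ring_simps)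

lemma seq_class_zero: "\<zero>\<^bsub>\<C>\<^esub> = seq_class v (\<lambda>i. 0)"
  using ring_hom_zero[OF completion_ring_hom[OF v]] cring.axioms(1)[OF completion_cring[OF v]]
    cring.axioms(1)[OF cauchy_ring_cring[OF v]] by (simp add: seq_class_def cauchy_ring_simps)

lemma seq_class_uminus:
  assumes "s \<in> cauchy_seqs v"
  shows "\<ominus>\<^bsub>\<C>\<^esub> seq_class v s = seq_class v (\<lambda>i. - s i)"
proof -
  interpret h: ring_hom_ring "cauchy_ring v" \<C> "(+>\<^bsub>cauchy_ring v\<^esub>) (null_seqs v)"
    by (rule completion_hom[OF v])
  show ?thesis using h.hom_a_inv[of s] assms cauchy_ring_a_inv[OF v assms]
    by (simp add: seq_class_def cauchy_ring_simps)
qed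

lemma cauchy_diff: "s \<in> cauchy_seqs v \<Longrightarrow> t \<in> cauchy_seqs v \<Longrightarrow> (\<lambda>i. s i - t i) \<in> cauchy_seqs v"
  using cauchy_add[OF v, of s "\<lambda>i. - t i"] cauchy_uminus[OF v, of t] by simp

lemma seq_class_diff:
  assumes "s \<in> cauchy_seqs v" "t \<in> cauchy_seqs v"
  shows "seq_class v s \<ominus>\<^bsub>\<C>\<^esub> seq_class v t = seq_class v (\<lambda>i. s i - t i)"
  using seq_class_ops(1)[OF assms(1) cauchy_uminus[OF v assms(2)]] seq_class_uminus[OF assms(2)]
  by (simp add: a_minus_def)

lemma seq_class_eq_iff:
  assumes "s \<in> cauchy_seqs v" "t \<in> cauchy_seqs v"
  shows "seq_class v s = seq_class v t \<longleftrightarrow> (\<lambda>i. s i - t i) \<in> null_seqs v"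
proof -
  interpret R: ring "cauchy_ring v" by (rule cring.axioms(1)[OF cauchy_ring_cring[OF v]])
  have "s \<ominus>\<^bsub>cauchy_ring v\<^esub> t = (\<lambda>i. s i - t i)"
    using cauchy_ring_a_inv[OF v assms(2)] by (simp add: a_minus_def cauchy_ring_simps)
  then show ?thesis using R.quotient_eq_iff_same_a_r_cos[OF null_ideal[OF v], of s t] assms
    by (simp add: seq_class_def cauchy_ring_simps)
qed

text \<open>\<open>ideal_power\<close> asks for one representative that is bounded at every index;
  here any representative may be tested on its tail. A null sequence changes the tail by arbitrarily
  small terms, and an initial segment can be overwritten by 0, which satisfies every bound.\<close>

lemma seq_class_ideal_power_iff:
  assumes s: "s \<in> cauchy_seqs v"
  shows "seq_class v s \<in> ideal_power v M \<longleftrightarrow> (\<exists>N. \<forall>i\<ge>N. val_ge v M (s i))"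
proof
  assume "seq_class v s \<in> ideal_power v M"
  then obtain t where t: "t \<in> cauchy_seqs v" "\<forall>i. val_ge v M (t i)" "seq_class v s = seq_class v t"
    unfolding ideal_power_iff[OF v] seq_class_def by blast
  then have "(\<lambda>i. s i - t i) \<in> null_seqs v" using seq_class_eq_iff[OF s] by blast
  then obtain N where N: "\<forall>i\<ge>N. val_ge v M (s i - t i)" unfolding null_seqs_def by blast
  then have "val_ge v M (s i)" if "i \<ge> N" for i
    using val_ge_add[OF v, of M "s i - t i" "t i"] t(2) that by auto
  then show "\<exists>N. \<forall>i\<ge>N. val_ge v M (s i)" by blast
next
  assume "\<exists>N. \<forall>i\<ge>N. val_ge v M (s i)"
  then obtain N where N: "\<forall>i\<ge>N. val_ge v M (s i)" by blast
  define t where "t i = (if i < N then 0 else s i)" for i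
  have "\<forall>M'. \<exists>N'. \<forall>i\<ge>N'. val_ge v M' (s i - t i)"
    by (intro allI exI[of _ N]) (auto simp: t_def val_ge_zero[OF v])
  then have st: "(\<lambda>i. s i - t i) \<in> null_seqs v" by (simp add: null_seqs_def)
  then have "(\<lambda>i. s i - t i) \<in> cauchy_seqs v" using null_subset[OF v] by blast
  then have t: "t \<in> cauchy_seqs v" using cauchy_diff[OF s, of "\<lambda>i. s i - t i"] by simp
  have "seq_class v s = seq_class v t" using seq_class_eq_iff[OF s t] st by simp
  moreover have "\<forall>i. val_ge v M (t i)" using N by (auto simp: t_def val_ge_zero[OF v])
  ultimately show "seq_class v s \<in> ideal_power v M"
    unfolding ideal_power_iff[OF v] using t by (auto simp: seq_class_def)
qed

lemma ideal_power_cases: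
  assumes "\<alpha> \<in> ideal_power v M"
  obtains s where "s \<in> cauchy_seqs v" "\<And>i. val_ge v M (s i)" "\<alpha> = seq_class v s"
  using assms unfolding ideal_power_iff[OF v] seq_class_def by blast

lemma ideal_power_carrier: "\<alpha> \<in> ideal_power v M \<Longrightarrow> \<alpha> \<in> carrier \<C>"
  by (simp add: ideal_power_def)

lemma to_completion_seq_class: "to_completion v a = seq_class v (\<lambda>i. a)"
  by (simp add: to_completion_def seq_class_def)

lemma ideal_power_minus:
  "\<alpha> \<in> ideal_power v M \<Longrightarrow> \<beta> \<in> ideal_power v M \<Longrightarrow> \<alpha> \<ominus>\<^bsub>\<C>\<^esub> \<beta> \<in> ideal_power v M"
  unfolding a_minus_def by (intro ideal_power_add ideal_power_a_inv v)

lemma integer_ring_cring: "cring (integer_ring v)"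
proof -
  interpret C: cring \<C> by (rule completion_cring[OF v])
  have sr: "subring (ideal_power v 0) \<C>"
  proof (rule C.subringI)
    show "h1 \<otimes>\<^bsub>\<C>\<^esub> h2 \<in> ideal_power v 0" if "h1 \<in> ideal_power v 0" "h2 \<in> ideal_power v 0" for h1 h2
      using ideal_power_mult[OF v that] by simp
  qed (auto intro: ideal_power_carrier ideal_power_one[OF v] ideal_power_a_inv[OF v] ideal_power_add[OF v])
  show "cring (integer_ring v)" unfolding integer_ring_def
    by (rule C.subcring_iff[THEN iffD1, rotated, OF C.subcringI'[OF sr]]) (auto intro: ideal_power_carrier)
qed

lemma integer_ring_simps:
  "carrier (integer_ring v) = ideal_power v 0"
  "\<alpha> \<otimes>\<^bsub>integer_ring v\<^esub> \<beta> = \<alpha> \<otimes>\<^bsub>\<C>\<^esub> \<beta>"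
  "\<alpha> \<oplus>\<^bsub>integer_ring v\<^esub> \<beta> = \<alpha> \<oplus>\<^bsub>\<C>\<^esub> \<beta>"
  "\<one>\<^bsub>integer_ring v\<^esub> = \<one>\<^bsub>\<C>\<^esub>" "\<zero>\<^bsub>integer_ring v\<^esub> = \<zero>\<^bsub>\<C>\<^esub>"
  by (simp_all add: integer_ring_def)

lemma integer_ring_uminus:
  assumes "\<alpha> \<in> ideal_power v 0" shows "\<ominus>\<^bsub>integer_ring v\<^esub> \<alpha> = \<ominus>\<^bsub>\<C>\<^esub> \<alpha>"
proof -
  interpret C: cring \<C> by (rule completion_cring[OF v])
  interpret I: cring "integer_ring v" by (rule integer_ring_cring)
  show ?thesis
    by (rule I.minus_equality)
      (use assms in \<open>auto simp: integer_ring_simps C.l_neg ideal_power_carrier intro: ideal_power_a_inv[OF v]\<close>)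
qed

lemma maximal_ideal: "ideal (ideal_power v 1) (integer_ring v)"
proof (rule idealI)
  interpret C: cring \<C> by (rule completion_cring[OF v])
  interpret I: cring "integer_ring v" by (rule integer_ring_cring)
  show "ring (integer_ring v)" by (rule I.ring_axioms)
  have sub: "ideal_power v 1 \<subseteq> ideal_power v 0" by (rule ideal_power_antimono[OF v]) simp
  show "subgroup (ideal_power v 1) (add_monoid (integer_ring v))"
  proof (rule group.subgroupI[OF I.a_group])
    show "ideal_power v 1 \<subseteq> carrier (add_monoid (integer_ring v))" using sub by (simp add: integer_ring_simps)
    show "ideal_power v 1 \<noteq> {}" using ideal_power_zero[OF v, of 1] by auto
    fix a b assume a: "a \<in> ideal_power v 1" and b: "b \<in> ideal_power v 1"
    have "inv\<^bsub>add_monoid (integer_ring v)\<^esub> a = \<ominus>\<^bsub>\<C>\<^esub> a"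
      using integer_ring_uminus[of a] a sub by (auto simp: a_inv_def)
    then show "inv\<^bsub>add_monoid (integer_ring v)\<^esub> a \<in> ideal_power v 1" using ideal_power_a_inv[OF v a] by simp
    show "a \<otimes>\<^bsub>add_monoid (integer_ring v)\<^esub> b \<in> ideal_power v 1"
      using ideal_power_add[OF v a b] by (simp add: integer_ring_simps)
  qed
  fix a b assume a: "a \<in> ideal_power v 1" and b: "b \<in> carrier (integer_ring v)"
  show "b \<otimes>\<^bsub>integer_ring v\<^esub> a \<in> ideal_power v 1"
    using ideal_power_mult[OF v, of b 0 a 1] a b by (simp add: integer_ring_simps)
  show "a \<otimes>\<^bsub>integer_ring v\<^esub> b \<in> ideal_power v 1"
    using ideal_power_mult[OF v, of a 1 b 0] a b by (simp add: integer_ring_simps)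
qed

lemma residue_class_eq_iff:
  assumes "\<alpha> \<in> ideal_power v 0" "\<beta> \<in> ideal_power v 0"
  shows "ideal_power v 1 +>\<^bsub>integer_ring v\<^esub> \<alpha> = ideal_power v 1 +>\<^bsub>integer_ring v\<^esub> \<beta> \<longleftrightarrow>
    \<alpha> \<ominus>\<^bsub>\<C>\<^esub> \<beta> \<in> ideal_power v 1"
proof -
  interpret I: cring "integer_ring v" by (rule integer_ring_cring)
  show ?thesis
    using I.quotient_eq_iff_same_a_r_cos[OF maximal_ideal, of \<alpha> \<beta>] assms
    by (simp add: integer_ring_simps a_minus_def integer_ring_uminus)
qed

lemma residue_field_carrier:
  "carrier (residue_field v) = (\<lambda>\<alpha>. ideal_power v 1 +>\<^bsub>integer_ring v\<^esub> \<alpha>) ` ideal_power v 0"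
  by (auto simp: residue_field_def FactRing_def A_RCOSETS_def' integer_ring_simps)

text \<open>Division by the uniformizer; this becomes the assumption \<open>\<rho>_kernel\<close> of
  \<open>residue_data\<close>.\<close>

lemma ideal_power_uniformizer:
  assumes "v \<pi> = 1" "\<alpha> \<in> ideal_power v 1"
  shows "\<alpha> \<otimes>\<^bsub>\<C>\<^esub> to_completion v (inverse \<pi>) \<in> ideal_power v 0"
proof -
  have nz: "\<pi> \<noteq> 0" using assms(1) v by (auto simp: is_valuation_def)
  have "v (inverse \<pi>) = - 1" using val_mult[OF v, of \<pi> "inverse \<pi>"] val_one[OF v] nz assms(1) by simp
  then have "to_completion v (inverse \<pi>) \<in> ideal_power v (- 1)"
    unfolding to_completion_seq_class by (subst seq_class_ideal_power_iff) (auto simp: val_ge_def cauchy_const[OF v])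
  from ideal_power_mult[OF v assms(2) this] show ?thesis by simp
qed

end

section \<open>The coefficient field of a completion\<close>

context residue_valuation
begin

abbreviation \<C> where "\<C> \<equiv> completion_ring v"

abbreviation residue_class where
  "residue_class \<equiv> \<lambda>\<alpha>. ideal_power v 1 +>\<^bsub>integer_ring v\<^esub> \<alpha>"

sublocale C: cring \<C>
  by (rule completion_cring[OF v])

text \<open>The Teichmueller representative of the residue class of \<open>a\<close>. It is additive
  as well as multiplicative, because every term of the sequence is a Frobenius power.\<close>

definition teich :: "'a \<Rightarrow> (nat \<Rightarrow> 'a) set" where
  "teich a = seq_class v (teich_seq a)"

lemma integral_ops: "integral a \<Longrightarrow> integral b \<Longrightarrow> integral (a + b)" "integral a \<Longrightarrow> integral (- a)"
  "integral a \<Longrightarrow> integral b \<Longrightarrow> integral (a * b)" "integral 0" "integral 1"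
  using val_ge_add[OF v] val_ge_uminus[OF v] val_ge_mult[OF v, of 0 a 0 b] val_ge_zero[OF v] val_ge_one[OF v] by auto

lemma teich_closed: "integral a \<Longrightarrow> teich a \<in> carrier \<C>"
  unfolding teich_def by (intro seq_class_closed v teich_seq_cauchy)

lemma teich_integral: "integral a \<Longrightarrow> teich a \<in> ideal_power v 0"
  unfolding teich_def using seq_class_ideal_power_iff[OF v teich_seq_cauchy, of a 0] integral_power by blast

lemma teich_add: "integral a \<Longrightarrow> integral b \<Longrightarrow> teich a \<oplus>\<^bsub>\<C>\<^esub> teich b = teich (a + b)"
  unfolding teich_def by (simp add: seq_class_ops[OF v] teich_seq_cauchy frob_pow)

lemma teich_mult: "integral a \<Longrightarrow> integral b \<Longrightarrow> teich a \<otimes>\<^bsub>\<C>\<^esub> teich b = teich (a * b)"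
  unfolding teich_def by (simp add: seq_class_ops[OF v] teich_seq_cauchy power_mult_distrib)

lemma teich_one: "teich 1 = \<one>\<^bsub>\<C>\<^esub>"
  unfolding teich_def by (simp add: seq_class_one[OF v])

lemma teich_zero: "teich 0 = \<zero>\<^bsub>\<C>\<^esub>"
proof -
  have "(0::'a) ^ (frob ^ i) = 0" for i using frob(1) by (intro zero_power) simp
  then show ?thesis unfolding teich_def seq_class_zero[OF v] by presburger
qed

lemma teich_uminus: assumes "integral a" shows "\<ominus>\<^bsub>\<C>\<^esub> teich a = teich (- a)"
  by (rule C.minus_equality)
    (use assms in \<open>auto simp: teich_add integral_ops teich_zero teich_closed\<close>)

lemma teich_diff: "integral a \<Longrightarrow> integral b \<Longrightarrow> teich a \<ominus>\<^bsub>\<C>\<^esub> teich b = teich (a - b)"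
  by (simp add: a_minus_def teich_uminus teich_add integral_ops)

lemma teich_ideal_power_one_iff:
  assumes a: "integral a" shows "teich a \<in> ideal_power v 1 \<longleftrightarrow> val_ge v 1 a"
proof
  assume "teich a \<in> ideal_power v 1"
  then obtain N where "\<forall>i\<ge>N. val_ge v 1 (a ^ (frob ^ i))"
    unfolding teich_def using seq_class_ideal_power_iff[OF v teich_seq_cauchy[OF a]] by blast
  then show "val_ge v 1 a" using power_m by blast
next
  assume "val_ge v 1 a"
  then have "\<forall>i\<ge>1. val_ge v 1 (a ^ (frob ^ i))"
    using val_ge_frob_pow val_ge_mono[OF v] by (metis of_nat_1 of_nat_le_iff)
  then show "teich a \<in> ideal_power v 1"
    unfolding teich_def using seq_class_ideal_power_iff[OF v teich_seq_cauchy[OF a]] by blast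
qed

text \<open>On the maximal ideal the iterated powers tend to 0. Together with additivity this makes
  \<open>teich\<close> an injective map on residue classes.\<close>

lemma teich_eq_zero_iff:
  assumes a: "integral a" shows "teich a = \<zero>\<^bsub>\<C>\<^esub> \<longleftrightarrow> val_ge v 1 a"
proof
  assume "teich a = \<zero>\<^bsub>\<C>\<^esub>"
  then show "val_ge v 1 a" using teich_ideal_power_one_iff[OF a] ideal_power_zero[OF v, of 1] by simp
next
  assume a1: "val_ge v 1 a"
  have "\<exists>N. \<forall>i\<ge>N. val_ge v M (a ^ (frob ^ i))" for M
  proof (intro exI[of _ "nat M"] allI impI)
    fix i assume "nat M \<le> i"
    then show "val_ge v M (a ^ (frob ^ i))" by (intro val_ge_mono[OF v val_ge_frob_pow[OF a1, of i]]) simp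
  qed
  then have "teich_seq a \<in> null_seqs v" by (simp add: null_seqs_def)
  then have "seq_class v (teich_seq a) = seq_class v (\<lambda>i. 0)"
    by (subst seq_class_eq_iff[OF v teich_seq_cauchy[OF a] cauchy_const[OF v]]) simp
  then show "teich a = \<zero>\<^bsub>\<C>\<^esub>" by (simp add: teich_def seq_class_zero[OF v])
qed

lemma teich_eq_iff:
  assumes "integral a" "integral b" shows "teich a = teich b \<longleftrightarrow> a \<doteq> b"
proof -
  have "teich a = teich b \<longleftrightarrow> teich a \<ominus>\<^bsub>\<C>\<^esub> teich b = \<zero>\<^bsub>\<C>\<^esub>"
    using assms by (simp add: teich_closed)
  then show ?thesis using assms by (simp add: teich_diff teich_eq_zero_iff val_ge_diff)
qed

text \<open>A Cauchy sequence is eventually constant modulo the maximal ideal, so the representative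
  of one late term is congruent to the limit.\<close>

lemma ex_teich_cong:
  assumes "\<alpha> \<in> ideal_power v 0"
  shows "\<exists>a. integral a \<and> \<alpha> \<ominus>\<^bsub>\<C>\<^esub> teich a \<in> ideal_power v 1"
proof -
  obtain s where s: "s \<in> cauchy_seqs v" "\<And>i. integral (s i)" "\<alpha> = seq_class v s"
    using ideal_power_cases[OF v assms] by blast
  obtain N where N: "\<forall>i\<ge>N. \<forall>j\<ge>N. val_ge v 1 (s i - s j)" using s(1) unfolding cauchy_seqs_def by blast
  have "val_ge v 1 (s i - teich_seq (s N) i)" if "i \<ge> N" for i
    using cong_trans[of "s i" "s N"] N that cong_sym[OF cong_frob_pow[OF s(2)[of N]]] by blast
  then have "seq_class v (\<lambda>i. s i - teich_seq (s N) i) \<in> ideal_power v 1"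
    by (subst seq_class_ideal_power_iff[OF v cauchy_diff[OF v s(1) teich_seq_cauchy[OF s(2)]]]) blast
  then show ?thesis
    using s by (intro exI[of _ "s N"]) (simp add: teich_def seq_class_diff[OF v s(1) teich_seq_cauchy])
qed

text \<open>The uniqueness half of Hensel's lemma for T^Q - T, applied term by term. If
  \<open>d i\<close> has valuation at least m > 0, then \<open>d i ^ frob\<close> has valuation at
  least m + 1, and so has \<open>d i\<close> itself as long as \<open>d i ^ frob - d i\<close> is
  that small. Iteration reaches any prescribed bound \<open>M\<close>.\<close>

lemma null_if_frobenius_fixed:
  assumes d: "\<And>i. i \<ge> N \<Longrightarrow> val_ge v 1 (d i)" and f: "(\<lambda>i. d i ^ frob - d i) \<in> null_seqs v"
  shows "d \<in> null_seqs v"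
  unfolding null_seqs_def
proof (intro CollectI allI)
  fix M :: int
  obtain N' where N': "\<forall>i\<ge>N'. val_ge v M (d i ^ frob - d i)" using f unfolding null_seqs_def by blast
  have "val_ge v M (d i)" if i: "i \<ge> max N N'" for i
  proof -
    \<comment> \<open>The maximum with 1 starts the induction at valuation 1: from valuation 0 the
      Frobenius power would gain nothing.\<close>
    have "int m \<le> M \<longrightarrow> val_ge v (max 1 (int m)) (d i)" for m
    proof (induction m)
      case 0 show ?case using d[of i] i by simp
    next
      case (Suc m)
      show ?case
      proof
        assume m: "int (Suc m) \<le> M"
        then have IH: "val_ge v (max 1 (int m)) (d i)" using Suc by simp
        have "2 * max 1 (int m) \<le> int frob * max 1 (int m)" using frob(1) by (intro mult_right_mono) auto
        then have "max 1 (int (Suc m)) \<le> int frob * max 1 (int m)" by linarith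
        then have 1: "val_ge v (max 1 (int (Suc m))) (d i ^ frob)"
          by (rule val_ge_mono[OF v val_ge_power[OF IH]])
        have "val_ge v M (d i ^ frob - d i)" using N' i by simp
        then have "val_ge v (max 1 (int (Suc m))) (d i ^ frob - d i)"
          by (rule val_ge_mono[OF v]) (use m in simp)
        from val_ge_diff[OF 1 this] show "val_ge v (max 1 (int (Suc m))) (d i)" by simp
      qed
    qed
    from this[of "nat M"] show ?thesis
    proof (cases "M \<ge> 0")
      case True
      then show ?thesis using \<open>int (nat M) \<le> M \<longrightarrow> _\<close> val_ge_mono[OF v, of "max 1 (int (nat M))" "d i" M] by auto
    next
      case False
      then show ?thesis using val_ge_mono[OF v, of 1 "d i" M] d[of i] i by simp
    qed
  qed
  then show "\<exists>N. \<forall>i\<ge>N. val_ge v M (d i)" by blast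
qed

lemma seq_class_power:
  assumes "s \<in> cauchy_seqs v"
  shows "seq_class v s [^]\<^bsub>\<C>\<^esub> (n::nat) = seq_class v (\<lambda>i. s i ^ n)" "(\<lambda>i. s i ^ n) \<in> cauchy_seqs v"
proof (induction n)
  case 0
  show "seq_class v s [^]\<^bsub>\<C>\<^esub> (0::nat) = seq_class v (\<lambda>i. s i ^ 0)" by (simp add: seq_class_one[OF v])
  show "(\<lambda>i. s i ^ 0) \<in> cauchy_seqs v" by (simp add: cauchy_const[OF v])
next
  case (Suc n)
  show "(\<lambda>i. s i ^ Suc n) \<in> cauchy_seqs v" using cauchy_mult[OF v assms Suc(2)] by simp
  show "seq_class v s [^]\<^bsub>\<C>\<^esub> Suc n = seq_class v (\<lambda>i. s i ^ Suc n)"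
    using Suc(1) seq_class_ops(2)[OF v Suc(2) assms] by (simp add: mult.commute)
qed

definition teich_field :: "(nat \<Rightarrow> 'a) set set" where
  "teich_field = teich ` {a. integral a}"

lemma teich_field_subfield: "subfield teich_field \<C>"
proof (rule C.subfieldI)
  have "subring teich_field \<C>"
  proof (rule C.subringI)
    show "teich_field \<subseteq> carrier \<C>" by (auto simp: teich_field_def teich_closed)
    show "\<one>\<^bsub>\<C>\<^esub> \<in> teich_field" unfolding teich_field_def teich_one[symmetric] by (auto simp: integral_ops)
  qed (auto simp: teich_field_def teich_uminus teich_mult teich_add integral_ops)
  then show "subcring teich_field \<C>" by (rule C.subcringI')
  show "Units (\<C>\<lparr>carrier := teich_field\<rparr>) = teich_field - {\<zero>\<^bsub>\<C>\<^esub>}"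
  proof (intro equalityI subsetI)
    fix \<alpha> assume "\<alpha> \<in> Units (\<C>\<lparr>carrier := teich_field\<rparr>)"
    then obtain \<beta> where "\<alpha> \<in> teich_field" "\<beta> \<in> teich_field" "\<alpha> \<otimes>\<^bsub>\<C>\<^esub> \<beta> = \<one>\<^bsub>\<C>\<^esub>"
      by (auto simp: Units_def)
    then show "\<alpha> \<in> teich_field - {\<zero>\<^bsub>\<C>\<^esub>}"
      using completion_zero_neq_one[OF v] by (auto simp: teich_field_def teich_closed)
  next
    fix \<alpha> assume "\<alpha> \<in> teich_field - {\<zero>\<^bsub>\<C>\<^esub>}"
    then obtain a where a: "integral a" "\<alpha> = teich a" "\<not> val_ge v 1 a"
      using teich_eq_zero_iff by (auto simp: teich_field_def)
    \<comment> \<open>Outside the maximal ideal an integral element has valuation exactly 0, so its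
      inverse is integral too and has a Teichmueller representative.\<close>
    have a0: "a \<noteq> 0" "v a = 0" using a by (auto simp: val_ge_def)
    then have "v (inverse a) = 0" using val_mult[OF v, of a "inverse a"] val_one[OF v] by simp
    then have ia: "integral (inverse a)" by (simp add: val_ge_def)
    have "teich a \<otimes>\<^bsub>\<C>\<^esub> teich (inverse a) = \<one>\<^bsub>\<C>\<^esub>" "teich (inverse a) \<otimes>\<^bsub>\<C>\<^esub> teich a = \<one>\<^bsub>\<C>\<^esub>"
      using a ia a0 by (simp_all add: teich_mult teich_one)
    then show "\<alpha> \<in> Units (\<C>\<lparr>carrier := teich_field\<rparr>)"
      using a ia by (auto simp: Units_def teich_field_def)
  qed
qed

text \<open>The predicate under the definite description in
  \<open>coefficient_field\<close>.\<close>

definition is_coefficient_set :: "(nat \<Rightarrow> 'a) set set \<Rightarrow> bool" where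
  "is_coefficient_set L \<longleftrightarrow> subfield L \<C> \<and> L \<subseteq> ideal_power v 0 \<and>
     bij_betw residue_class L (carrier (residue_field v))"

lemma is_coefficient_set_teich_field: "is_coefficient_set teich_field"
  unfolding is_coefficient_set_def
proof (intro conjI teich_field_subfield)
  show s: "teich_field \<subseteq> ideal_power v 0" by (auto simp: teich_field_def teich_integral)
  show "bij_betw residue_class teich_field (carrier (residue_field v))"
    unfolding bij_betw_def residue_field_carrier[OF v]
  proof
    show "inj_on residue_class teich_field"
      unfolding teich_field_def inj_on_def
      by (simp add: residue_class_eq_iff[OF v] teich_integral teich_diff
          teich_ideal_power_one_iff teich_eq_iff val_ge_diff)
    have "\<exists>\<beta>\<in>teich_field. residue_class \<alpha> = residue_class \<beta>"
      if "\<alpha> \<in> ideal_power v 0" for \<alpha>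
      using ex_teich_cong[OF that] that by (auto simp: teich_field_def residue_class_eq_iff[OF v] teich_integral)
    then show "residue_class ` teich_field =
        residue_class ` ideal_power v 0"
      using s by (intro equalityI image_mono image_subsetI) (auto simp only: image_iff)
  qed
qed

text \<open>For \<open>\<alpha>\<close> in \<open>L\<close> the power with exponent
  \<open>frob\<close> lies in \<open>L\<close> and is congruent to \<open>\<alpha>\<close>, so it
  equals \<open>\<alpha>\<close> by injectivity of reduction on \<open>L\<close>. The Teichmueller
  representative congruent to \<open>\<alpha>\<close> is fixed by this power as well, and
  \<open>null_if_frobenius_fixed\<close> makes the two equal. Conversely, \<open>L\<close> meets
  every residue class, and \<open>teich_field\<close> has only one element in each.\<close>

lemma coefficient_set_unique:
  assumes L: "is_coefficient_set L" shows "L = teich_field"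
proof -
  have sf: "subfield L \<C>" and Li: "L \<subseteq> ideal_power v 0"
    and bij: "bij_betw residue_class L (carrier (residue_field v))"
    using L by (auto simp: is_coefficient_set_def)
  have sr: "subring L \<C>" using sf by (rule subfieldE)
  have sub: "L \<subseteq> teich_field"
  proof
    fix \<alpha> assume \<alpha>: "\<alpha> \<in> L"
    then obtain s where s: "s \<in> cauchy_seqs v" "\<And>i. integral (s i)" "\<alpha> = seq_class v s"
      using ideal_power_cases[OF v] Li by blast
    have pL: "\<alpha> [^]\<^bsub>\<C>\<^esub> (n::nat) \<in> L" for n
      by (induction n) (auto simp: subringE(3)[OF sr] intro: subringE(6)[OF sr] \<alpha>)
    have "\<alpha> [^]\<^bsub>\<C>\<^esub> frob \<ominus>\<^bsub>\<C>\<^esub> \<alpha> = seq_class v (\<lambda>i. s i ^ frob - s i)"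
      using s seq_class_power[OF s(1), of frob] by (simp add: seq_class_diff[OF v])
    also have "\<dots> \<in> ideal_power v 1"
      using frob(2)[OF s(2)]
      by (subst seq_class_ideal_power_iff[OF v cauchy_diff[OF v seq_class_power(2)[OF s(1)] s(1)]]) blast
    finally have "\<alpha> [^]\<^bsub>\<C>\<^esub> frob \<ominus>\<^bsub>\<C>\<^esub> \<alpha> \<in> ideal_power v 1" .
    moreover have "\<alpha> [^]\<^bsub>\<C>\<^esub> frob \<in> ideal_power v 0" "\<alpha> \<in> ideal_power v 0"
      using pL[of frob] \<alpha> Li by blast+
    ultimately have "residue_class (\<alpha> [^]\<^bsub>\<C>\<^esub> frob) = residue_class \<alpha>"
      using residue_class_eq_iff[OF v] by blast
    then have "\<alpha> [^]\<^bsub>\<C>\<^esub> frob = \<alpha>"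
      using bij pL[of frob] \<alpha> inj_onD[of _ L "\<alpha> [^]\<^bsub>\<C>\<^esub> frob" \<alpha>] unfolding bij_betw_def by metis
    then have fx: "(\<lambda>i. s i ^ frob - s i) \<in> null_seqs v"
      using seq_class_power[OF s(1), of frob] seq_class_eq_iff[OF v seq_class_power(2)[OF s(1), of frob] s(1)]
      by (simp add: s(3))
    obtain N where N: "\<forall>i\<ge>N. \<forall>j\<ge>N. val_ge v 1 (s i - s j)" using s(1) unfolding cauchy_seqs_def by blast
    define a where "a = s N"
    have a: "integral a" by (simp add: a_def s(2))
    have "(\<lambda>i. teich_seq a i ^ frob - teich_seq a i) \<in> null_seqs v"
      unfolding null_seqs_def
    proof (intro CollectI allI exI impI)
      fix M i assume i: "nat M \<le> i"
      have "val_ge v (int i) (teich_seq a (Suc i) - teich_seq a i)" by (rule teich_seq_diff[OF a]) simp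
      then show "val_ge v M (teich_seq a i ^ frob - teich_seq a i)"
        using val_ge_mono[OF v _, of "int i" _ M] i by (simp add: mult.commute flip: power_mult)
    qed
    then have "(\<lambda>i. - (teich_seq a i ^ frob - teich_seq a i)) \<in> null_seqs v"
      unfolding null_seqs_def by (simp only: val_ge_uminus[OF v] mem_Collect_eq simp_thms)
    from null_add[OF v fx this]
    have "(\<lambda>i. (s i - teich_seq a i) ^ frob - (s i - teich_seq a i)) \<in> null_seqs v"
      by (simp add: frob(3) algebra_simps)
    then have "(\<lambda>i. s i - teich_seq a i) \<in> null_seqs v"
    proof (rule null_if_frobenius_fixed[rotated])
      fix i assume "N \<le> i"
      then show "val_ge v 1 (s i - teich_seq a i)"
        using cong_trans[of "s i" a] N cong_sym[OF cong_frob_pow[OF a]] by (auto simp: a_def)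
    qed
    then have "\<alpha> = teich a"
      unfolding s(3) teich_def using seq_class_eq_iff[OF v s(1) teich_seq_cauchy[OF a]] by simp
    then show "\<alpha> \<in> teich_field" using a by (auto simp: teich_field_def)
  qed
  moreover have "teich_field \<subseteq> L"
  proof
    fix \<beta> assume \<beta>: "\<beta> \<in> teich_field"
    have inj: "inj_on residue_class teich_field"
      and \<beta>0: "\<beta> \<in> ideal_power v 0"
      using is_coefficient_set_teich_field \<beta> by (auto simp: is_coefficient_set_def bij_betw_def)
    then have "residue_class \<beta> \<in> carrier (residue_field v)"
      by (auto simp: residue_field_carrier[OF v])
    then obtain \<alpha> where "\<alpha> \<in> L"
      "residue_class \<alpha> = residue_class \<beta>"
      using bij unfolding bij_betw_def image_iff by (metis imageE)
    then show "\<beta> \<in> L" using inj_onD[OF inj, of \<alpha> \<beta>] sub \<beta> by auto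
  qed
  ultimately show ?thesis by blast
qed

abbreviation \<kappa> where "\<kappa> \<equiv> coefficient_field v"

lemma coefficient_field_eq: "\<kappa> = \<C>\<lparr>carrier := teich_field\<rparr>"
proof -
  have "(THE L. is_coefficient_set L) = teich_field"
    using is_coefficient_set_teich_field coefficient_set_unique by (rule the_equality)
  then show ?thesis unfolding coefficient_field_def is_coefficient_set_def by simp
qed

lemma coefficient_field_simps:
  "carrier \<kappa> = teich_field"
  "\<alpha> \<otimes>\<^bsub>\<kappa>\<^esub> \<beta> = \<alpha> \<otimes>\<^bsub>\<C>\<^esub> \<beta>" "\<alpha> \<oplus>\<^bsub>\<kappa>\<^esub> \<beta> = \<alpha> \<oplus>\<^bsub>\<C>\<^esub> \<beta>"
  "\<one>\<^bsub>\<kappa>\<^esub> = \<one>\<^bsub>\<C>\<^esub>" "\<zero>\<^bsub>\<kappa>\<^esub> = \<zero>\<^bsub>\<C>\<^esub>"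
  by (simp_all add: coefficient_field_eq)

lemma coefficient_field_field: "field \<kappa>"
  unfolding coefficient_field_eq
  by (rule C.subfield_iff(2)[OF teich_field_subfield])

lemma finite_coefficient_field: "finite (carrier \<kappa>)"
proof -
  have "teich_field \<subseteq> teich ` {b\<in>T. integral b}"
  proof
    fix \<alpha> assume "\<alpha> \<in> teich_field"
    then obtain a where a: "integral a" "\<alpha> = teich a" by (auto simp: teich_field_def)
    obtain b where b: "b \<in> T" "a \<doteq> b" using T[OF a(1)] by blast
    have "integral b" using val_ge_diff[OF a(1) val_ge_mono[OF v b(2), of 0]] by simp
    then show "\<alpha> \<in> teich ` {b\<in>T. integral b}" using a b teich_eq_iff by auto
  qed
  then show ?thesis using finT finite_subset by (fastforce simp: coefficient_field_simps)
qed

text \<open>Reduction modulo the maximal ideal with values in the coefficient field instead of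
  cosets, so that a residue is again an element of the completion and can be an entry of
  \<open>\<xi>\<^sub>w\<close>.\<close>

definition residue :: "(nat \<Rightarrow> 'a) set \<Rightarrow> (nat \<Rightarrow> 'a) set" where
  "residue \<alpha> = (THE l. l \<in> carrier \<kappa> \<and> \<alpha> \<ominus>\<^bsub>\<C>\<^esub> l \<in> ideal_power v 1)"

lemma coefficient_field_cong_imp_eq:
  assumes "l \<in> carrier \<kappa>" "l' \<in> carrier \<kappa>" "l \<ominus>\<^bsub>\<C>\<^esub> l' \<in> ideal_power v 1"
  shows "l = l'"
proof -
  obtain a b where "integral a" "l = teich a" "integral b" "l' = teich b"
    using assms(1,2) by (auto simp: coefficient_field_simps teich_field_def)
  then show ?thesis using assms(3) by (simp add: teich_diff teich_ideal_power_one_iff teich_eq_iff val_ge_diff)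
qed

lemma coefficient_field_integral: "l \<in> carrier \<kappa> \<Longrightarrow> l \<in> ideal_power v 0"
  by (auto simp: coefficient_field_simps teich_field_def teich_integral)

lemma residue_unique:
  assumes "\<alpha> \<in> ideal_power v 0" "l \<in> carrier \<kappa>" "\<alpha> \<ominus>\<^bsub>\<C>\<^esub> l \<in> ideal_power v 1"
  shows "residue \<alpha> = l"
  unfolding residue_def
proof (rule the_equality)
  fix l' assume l': "l' \<in> carrier \<kappa> \<and> \<alpha> \<ominus>\<^bsub>\<C>\<^esub> l' \<in> ideal_power v 1"
  note c = ideal_power_carrier[OF v, of _ 0]
  have "(\<alpha> \<ominus>\<^bsub>\<C>\<^esub> l) \<ominus>\<^bsub>\<C>\<^esub> (\<alpha> \<ominus>\<^bsub>\<C>\<^esub> l') \<in> ideal_power v 1"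
    using assms(3) l' by (simp add: ideal_power_minus[OF v])
  also have "(\<alpha> \<ominus>\<^bsub>\<C>\<^esub> l) \<ominus>\<^bsub>\<C>\<^esub> (\<alpha> \<ominus>\<^bsub>\<C>\<^esub> l') = l' \<ominus>\<^bsub>\<C>\<^esub> l"
    using c[OF assms(1)] c[OF coefficient_field_integral[OF assms(2)]] c[OF coefficient_field_integral[of l']] l'
    by (simp add: a_minus_def C.minus_add C.a_assoc C.a_lcomm[of \<alpha> "\<ominus>\<^bsub>\<C>\<^esub> l"] C.a_comm[of l' "\<ominus>\<^bsub>\<C>\<^esub> l"] C.r_neg1 C.r_neg2)
  finally show "l' = l" using coefficient_field_cong_imp_eq assms l' by blast
qed (use assms in auto)

lemma residue:
  assumes "\<alpha> \<in> ideal_power v 0"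
  shows "residue \<alpha> \<in> carrier \<kappa>" "\<alpha> \<ominus>\<^bsub>\<C>\<^esub> residue \<alpha> \<in> ideal_power v 1"
proof -
  obtain a where a: "integral a" "\<alpha> \<ominus>\<^bsub>\<C>\<^esub> teich a \<in> ideal_power v 1" using ex_teich_cong[OF assms] by blast
  then have k: "teich a \<in> carrier \<kappa>" by (auto simp: coefficient_field_simps teich_field_def)
  have "residue \<alpha> = teich a" by (rule residue_unique[OF assms k a(2)])
  then show "residue \<alpha> \<in> carrier \<kappa>" "\<alpha> \<ominus>\<^bsub>\<C>\<^esub> residue \<alpha> \<in> ideal_power v 1" using a k by auto
qed

lemma residue_coefficient: "l \<in> carrier \<kappa> \<Longrightarrow> residue l = l"
  using ideal_power_zero[OF v, of 1] coefficient_field_integral ideal_power_carrier[OF v, of l 0]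
  by (intro residue_unique) (auto simp: a_minus_def C.r_neg)

lemma residue_add:
  assumes "\<alpha> \<in> ideal_power v 0" "\<beta> \<in> ideal_power v 0"
  shows "residue (\<alpha> \<oplus>\<^bsub>\<C>\<^esub> \<beta>) = residue \<alpha> \<oplus>\<^bsub>\<kappa>\<^esub> residue \<beta>"
proof (rule residue_unique)
  interpret K: field \<kappa> by (rule coefficient_field_field)
  note c = ideal_power_carrier[OF v, of _ 0]
  show "\<alpha> \<oplus>\<^bsub>\<C>\<^esub> \<beta> \<in> ideal_power v 0" by (intro ideal_power_add v assms)
  show "residue \<alpha> \<oplus>\<^bsub>\<kappa>\<^esub> residue \<beta> \<in> carrier \<kappa>" using assms residue(1) by simp
  have "(\<alpha> \<ominus>\<^bsub>\<C>\<^esub> residue \<alpha>) \<oplus>\<^bsub>\<C>\<^esub> (\<beta> \<ominus>\<^bsub>\<C>\<^esub> residue \<beta>) \<in> ideal_power v 1"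
    by (intro ideal_power_add v residue assms)
  also have "(\<alpha> \<ominus>\<^bsub>\<C>\<^esub> residue \<alpha>) \<oplus>\<^bsub>\<C>\<^esub> (\<beta> \<ominus>\<^bsub>\<C>\<^esub> residue \<beta>) =
      (\<alpha> \<oplus>\<^bsub>\<C>\<^esub> \<beta>) \<ominus>\<^bsub>\<C>\<^esub> (residue \<alpha> \<oplus>\<^bsub>\<C>\<^esub> residue \<beta>)"
    using assms[THEN c] c[OF coefficient_field_integral[OF residue(1)[OF assms(1)]]]
      c[OF coefficient_field_integral[OF residue(1)[OF assms(2)]]]
    by algebra
  finally show "\<alpha> \<oplus>\<^bsub>\<C>\<^esub> \<beta> \<ominus>\<^bsub>\<C>\<^esub> (residue \<alpha> \<oplus>\<^bsub>\<kappa>\<^esub> residue \<beta>) \<in> ideal_power v 1"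
    by (simp add: coefficient_field_simps)
qed

lemma residue_mult:
  assumes "\<alpha> \<in> ideal_power v 0" "\<beta> \<in> ideal_power v 0"
  shows "residue (\<alpha> \<otimes>\<^bsub>\<C>\<^esub> \<beta>) = residue \<alpha> \<otimes>\<^bsub>\<kappa>\<^esub> residue \<beta>"
proof (rule residue_unique)
  interpret K: field \<kappa> by (rule coefficient_field_field)
  note c = ideal_power_carrier[OF v, of _ 0]
  have rb: "residue \<beta> \<in> ideal_power v 0" "residue \<alpha> \<in> ideal_power v 0"
    by (intro coefficient_field_integral residue assms)+
  show "\<alpha> \<otimes>\<^bsub>\<C>\<^esub> \<beta> \<in> ideal_power v 0" using ideal_power_mult[OF v assms] by simp
  show "residue \<alpha> \<otimes>\<^bsub>\<kappa>\<^esub> residue \<beta> \<in> carrier \<kappa>" using assms residue(1) by simp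
  have "\<alpha> \<otimes>\<^bsub>\<C>\<^esub> (\<beta> \<ominus>\<^bsub>\<C>\<^esub> residue \<beta>) \<oplus>\<^bsub>\<C>\<^esub> (\<alpha> \<ominus>\<^bsub>\<C>\<^esub> residue \<alpha>) \<otimes>\<^bsub>\<C>\<^esub> residue \<beta> \<in> ideal_power v 1"
    using ideal_power_mult[OF v assms(1) residue(2)[OF assms(2)]]
      ideal_power_mult[OF v residue(2)[OF assms(1)] rb(1)]
    by (intro ideal_power_add v) auto
  also have "\<alpha> \<otimes>\<^bsub>\<C>\<^esub> (\<beta> \<ominus>\<^bsub>\<C>\<^esub> residue \<beta>) \<oplus>\<^bsub>\<C>\<^esub> (\<alpha> \<ominus>\<^bsub>\<C>\<^esub> residue \<alpha>) \<otimes>\<^bsub>\<C>\<^esub> residue \<beta> =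
      \<alpha> \<otimes>\<^bsub>\<C>\<^esub> \<beta> \<ominus>\<^bsub>\<C>\<^esub> residue \<alpha> \<otimes>\<^bsub>\<C>\<^esub> residue \<beta>"
    using assms[THEN c] rb[THEN c] by algebra
  finally show "\<alpha> \<otimes>\<^bsub>\<C>\<^esub> \<beta> \<ominus>\<^bsub>\<C>\<^esub> (residue \<alpha> \<otimes>\<^bsub>\<kappa>\<^esub> residue \<beta>) \<in> ideal_power v 1"
    by (simp add: coefficient_field_simps)
qed

lemma residue_one: "residue \<one>\<^bsub>\<C>\<^esub> = \<one>\<^bsub>\<kappa>\<^esub>"
  using residue_coefficient[of "\<one>\<^bsub>\<kappa>\<^esub>"] cring.cring_simprules(6)[OF fieldE(1)[OF coefficient_field_field]]
  by (simp add: coefficient_field_simps)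

lemma residue_eq_zero_iff:
  assumes "\<alpha> \<in> ideal_power v 0"
  shows "residue \<alpha> = \<zero>\<^bsub>\<kappa>\<^esub> \<longleftrightarrow> \<alpha> \<in> ideal_power v 1"
proof -
  have z: "\<alpha> \<ominus>\<^bsub>\<C>\<^esub> \<zero>\<^bsub>\<C>\<^esub> = \<alpha>" using ideal_power_carrier[OF v assms] by (simp add: a_minus_def)
  have "\<zero>\<^bsub>\<kappa>\<^esub> \<in> carrier \<kappa>" using cring.cring_simprules(2)[OF fieldE(1)[OF coefficient_field_field]] .
  then show ?thesis
    using residue(2)[OF assms] residue_unique[OF assms, of "\<zero>\<^bsub>\<kappa>\<^esub>"] z by (auto simp: coefficient_field_simps)
qed

end

section \<open>Reduced bases of subspaces of coordinate space\<close>

context field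
begin

abbreviation coord_space :: "nat \<Rightarrow> ('a, nat \<Rightarrow> 'a) module" where
  "coord_space n \<equiv> func_space {..<n}"

lemma coord_space_simps:
  "carrier (coord_space n) = {..<n} \<rightarrow>\<^sub>E carrier R"
  "u \<oplus>\<^bsub>coord_space n\<^esub> u' = (\<lambda>i\<in>{..<n}. u i \<oplus> u' i)"
  "c \<odot>\<^bsub>coord_space n\<^esub> u = (\<lambda>i\<in>{..<n}. c \<otimes> u i)"
  "\<zero>\<^bsub>coord_space n\<^esub> = (\<lambda>i\<in>{..<n}. \<zero>)"
  by (simp_all add: func_space_def)

lemma coord_space_vectorspace: "vectorspace R (coord_space n)"
  by (intro vectorspace.intro func_space_is_module field_axioms)

lemma subspace_iff:
  "VectorSpace.subspace R w (coord_space n) \<longleftrightarrow>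
     w \<subseteq> {..<n} \<rightarrow>\<^sub>E carrier R \<and> (\<lambda>i\<in>{..<n}. \<zero>) \<in> w \<and>
     (\<forall>u\<in>w. \<forall>u'\<in>w. (\<lambda>i\<in>{..<n}. u i \<oplus> u' i) \<in> w) \<and>
     (\<forall>c\<in>carrier R. \<forall>u\<in>w. (\<lambda>i\<in>{..<n}. c \<otimes> u i) \<in> w)"
  unfolding VectorSpace.subspace_def submodule_def coord_space_simps
  using coord_space_vectorspace func_space_is_module by blast

section \<open>Pivots of a subspace\<close>

context
  fixes n :: nat and w :: "(nat \<Rightarrow> 'a) set"
  assumes w: "VectorSpace.subspace R w (coord_space n)"
begin

abbreviation "W \<equiv> (coord_space n)\<lparr>carrier := w\<rparr>"

lemma W_vectorspace: "vectorspace R W"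
  by (rule vectorspace.subspace_is_vs[OF coord_space_vectorspace w])

lemma subspace_closed:
  "u \<in> w \<Longrightarrow> u' \<in> w \<Longrightarrow> (\<lambda>i\<in>{..<n}. u i \<oplus> u' i) \<in> w"
  "c \<in> carrier R \<Longrightarrow> u \<in> w \<Longrightarrow> (\<lambda>i\<in>{..<n}. c \<otimes> u i) \<in> w"
  "u \<in> w \<Longrightarrow> i < n \<Longrightarrow> u i \<in> carrier R" "u \<in> w \<Longrightarrow> u \<in> extensional {..<n}"
  using w unfolding subspace_iff by (auto simp: PiE_iff)

lemma subspace_add_smult:
  assumes "c \<in> carrier R" "u \<in> w" "u' \<in> w"
  shows "(\<lambda>i\<in>{..<n}. u i \<oplus> c \<otimes> u' i) \<in> w"
proof -
  have "(\<lambda>i\<in>{..<n}. u i \<oplus> (\<lambda>i\<in>{..<n}. c \<otimes> u' i) i) \<in> w"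
    by (intro subspace_closed assms)
  moreover have "(\<lambda>i\<in>{..<n}. u i \<oplus> (\<lambda>i\<in>{..<n}. c \<otimes> u' i) i) = (\<lambda>i\<in>{..<n}. u i \<oplus> c \<otimes> u' i)"
    by auto
  ultimately show ?thesis by simp
qed

lemma finsum_W:
  assumes "finite A" "f \<in> A \<rightarrow> w" "i < n"
  shows "finsum W f A i = (\<Oplus>a\<in>A. f a i)" "finsum W f A \<in> w"
proof -
  interpret W: vectorspace R W by (rule W_vectorspace)
  show "finsum W f A \<in> w" using W.finsum_closed[of f A] assms(2) by simp
  show "finsum W f A i = (\<Oplus>a\<in>A. f a i)" using assms(1,2)
  proof (induction A rule: finite_induct)
    case empty
    then show ?case using assms(3) W.finsum_empty by (simp add: coord_space_simps)
  next
    case (insert a A)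
    have "finsum W f (insert a A) = f a \<oplus>\<^bsub>W\<^esub> finsum W f A"
      using insert by (intro W.finsum_insert) auto
    moreover have "(\<Oplus>a\<in>insert a A. f a i) = f a i \<oplus> (\<Oplus>a\<in>A. f a i)"
      using insert assms(3) subspace_closed(3) by (intro finsum_insert) auto
    ultimately show ?case using insert assms(3) by (simp add: coord_space_simps)
  qed
qed

text \<open>The positions in which a nonzero vector of \<open>w\<close> can have its last nonzero
  entry. They depend on \<open>w\<close> alone, so identifying the index set of a reduced basis with
  them settles its uniqueness.\<close>

definition pivots :: "nat set" where
  "pivots = {j. j < n \<and> (\<exists>u\<in>w. u j = \<one> \<and> (\<forall>i<n. j < i \<longrightarrow> u i = \<zero>))}"

text \<open>Gaussian elimination through descending indices: subtracting a multiple of a vector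
  whose last nonzero entry is at \<open>l\<close> does not touch the positions after
  \<open>l\<close>, so entries cleared before stay cleared.\<close>

lemma ex_reduced_vector:
  assumes "j \<in> pivots"
  shows "\<exists>u\<in>w. u j = \<one> \<and> (\<forall>i<n. j < i \<or> i \<in> pivots \<and> i \<noteq> j \<longrightarrow> u i = \<zero>)"
proof -
  \<comment> \<open>After \<open>m\<close> rounds the pivot positions among the \<open>m\<close>
    places just before \<open>j\<close> are cleared; writing this as an inequality with
    \<open>i + m\<close> avoids truncated subtraction. The choice of \<open>j\<close> for
    \<open>m\<close> covers them all.\<close>
  have "\<exists>u\<in>w. u j = \<one> \<and> (\<forall>i<n. j < i \<or> i \<in> pivots \<and> i \<noteq> j \<and> j \<le> i + m \<longrightarrow> u i = \<zero>)" for m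
  proof (induction m)
    case 0
    then show ?case using assms unfolding pivots_def by fastforce
  next
    case (Suc m)
    then obtain u where u: "u \<in> w" "u j = \<one>"
      "\<And>i. i < n \<Longrightarrow> j < i \<or> i \<in> pivots \<and> i \<noteq> j \<and> j \<le> i + m \<Longrightarrow> u i = \<zero>" by blast
    have jn: "j < n" using assms by (simp add: pivots_def)
    show ?case
    proof (cases "j \<ge> Suc m \<and> j - Suc m \<in> pivots")
      case False
      have "u i = \<zero>" if "i < n" "j < i \<or> i \<in> pivots \<and> i \<noteq> j \<and> j \<le> i + Suc m" for i
      proof (cases "j = i + Suc m")
        case True then show ?thesis using False that by simp
      next
        case False then show ?thesis using u(3)[OF that(1)] that(2) by auto
      qed
      then show ?thesis using u by blast
    next
      case True
      define l where "l = j - Suc m"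
      have l: "l \<in> pivots" "l < j" "j = l + Suc m" using True by (auto simp: l_def)
      then obtain z where z: "z \<in> w" "z l = \<one>" "\<And>i. i < n \<Longrightarrow> l < i \<Longrightarrow> z i = \<zero>"
        unfolding pivots_def by blast
      have ln: "l < n" using l jn by simp
      have c: "u i \<in> carrier R" "z i \<in> carrier R" if "i < n" for i
        using subspace_closed(3) u(1) z(1) that by auto
      define u' where "u' = (\<lambda>i\<in>{..<n}. u i \<oplus> (\<ominus> u l) \<otimes> z i)"
      have "u' \<in> w" unfolding u'_def by (intro subspace_add_smult u(1) z(1)) (use c ln in auto)
      moreover have "u' j = \<one>" using l jn ln z(3)[of j] u(2) c by (simp add: u'_def)
      moreover have "u' i = \<zero>" if "i < n" "j < i \<or> i \<in> pivots \<and> i \<noteq> j \<and> j \<le> i + Suc m" for i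
      proof (cases "i = l")
        case True
        then show ?thesis using c ln z(2) by (simp add: u'_def r_neg)
      next
        case False
        then have "l < i" using that l by auto
        moreover have "u i = \<zero>" using u(3)[OF that(1)] that(2) False l(3) by auto
        ultimately show ?thesis using that(1) z(3)[of i] c ln by (simp add: u'_def)
      qed
      ultimately show ?thesis by blast
    qed
  qed
  from this[of j] show ?thesis by auto
qed

text \<open>The last nonzero position of a nonzero vector of \<open>w\<close> is a pivot, as scaling
  the vector shows.\<close>

lemma zero_if_zero_on_pivots:
  assumes "u \<in> w" "\<And>j. j \<in> pivots \<Longrightarrow> u j = \<zero>" "i < n"
  shows "u i = \<zero>"
proof (rule ccontr)
  assume ui: "u i \<noteq> \<zero>"
  define j where "j = Max {i. i < n \<and> u i \<noteq> \<zero>}"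
  have "j \<in> {i. i < n \<and> u i \<noteq> \<zero>}" unfolding j_def by (rule Max_in) (use ui assms(3) in auto)
  then have j: "j < n" "u j \<noteq> \<zero>" by auto
  have max: "u i = \<zero>" if "i < n" "j < i" for i
  proof (rule ccontr)
    assume "u i \<noteq> \<zero>"
    then have "i \<le> j" unfolding j_def by (intro Max_ge) (use that in auto)
    then show False using that by simp
  qed
  have cj: "u j \<in> carrier R" using subspace_closed(3)[OF assms(1) j(1)] .
  then have U: "u j \<in> Units R" using j(2) by (simp add: field_Units)
  define u' where "u' = (\<lambda>i\<in>{..<n}. inv u j \<otimes> u i)"
  have "u' \<in> w" unfolding u'_def by (rule subspace_closed(2)[OF _ assms(1)]) (use U in simp)
  moreover have "u' j = \<one>" using j U by (simp add: u'_def)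
  moreover have "\<forall>i<n. j < i \<longrightarrow> u' i = \<zero>" using max U by (simp add: u'_def)
  ultimately have "j \<in> pivots" using j(1) unfolding pivots_def by blast
  then show False using assms(2) j(2) by blast
qed

section \<open>Families in reduced form for a given index set\<close>

context
  fixes \<Lambda> :: "nat set" and b :: "nat \<Rightarrow> nat \<Rightarrow> 'a"
  assumes \<Lambda>: "\<Lambda> \<subseteq> {..<n}" and bw: "\<And>j. j \<in> \<Lambda> \<Longrightarrow> b j \<in> w" and b1: "\<And>j. j \<in> \<Lambda> \<Longrightarrow> b j j = \<one>"
    and b0: "\<And>j i. j \<in> \<Lambda> \<Longrightarrow> i < n \<Longrightarrow> j < i \<or> i \<in> \<Lambda> \<and> i \<noteq> j \<Longrightarrow> b j i = \<zero>"
begin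

lemma finite_\<Lambda>: "finite \<Lambda>"
  using \<Lambda> finite_subset by blast

lemma inj_on_reduced: "inj_on b \<Lambda>"
proof (rule inj_onI, rule ccontr)
  fix i j assume ij: "i \<in> \<Lambda>" "j \<in> \<Lambda>" "b i = b j" "i \<noteq> j"
  then have "b j i = \<zero>" using b0[of j i] \<Lambda> by auto
  then show False using b1[of i] ij by simp
qed

text \<open>Restricted to the positions in \<open>\<Lambda>\<close> the family is the identity
  matrix, so the entries there read off the coefficients. Independence, spanning and uniqueness all
  rest on this.\<close>

lemma lincomb_reduced:
  assumes "a \<in> b ` \<Lambda> \<rightarrow> carrier R" "i < n"
  shows "module.lincomb W a (b ` \<Lambda>) i = (\<Oplus>j\<in>\<Lambda>. a (b j) \<otimes> b j i)"
    "module.lincomb W a (b ` \<Lambda>) \<in> w" "i \<in> \<Lambda> \<Longrightarrow> module.lincomb W a (b ` \<Lambda>) i = a (b i)"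
proof -
  interpret W: vectorspace R W by (rule W_vectorspace)
  have ac: "a (b j) \<in> carrier R" if "j \<in> \<Lambda>" for j using assms(1) that by auto
  have bc: "b j i \<in> carrier R" if "j \<in> \<Lambda>" for j using subspace_closed(3)[OF bw assms(2)] that .
  have "module.lincomb W a (b ` \<Lambda>) i = (\<Oplus>u\<in>b ` \<Lambda>. (a u \<odot>\<^bsub>W\<^esub> u) i)"
    unfolding W.lincomb_def
    by (rule finsum_W(1)) (use finite_\<Lambda> bw assms(2) ac subspace_closed(2) in \<open>auto simp: coord_space_simps\<close>)
  also have "\<dots> = (\<Oplus>u\<in>b ` \<Lambda>. a u \<otimes> u i)"
    by (rule finsum_cong') (use assms(2) ac bc in \<open>auto simp: coord_space_simps\<close>)
  also have "\<dots> = (\<Oplus>j\<in>\<Lambda>. a (b j) \<otimes> b j i)"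
    by (rule finsum_reindex) (use ac bc inj_on_reduced in auto)
  finally show *: "module.lincomb W a (b ` \<Lambda>) i = (\<Oplus>j\<in>\<Lambda>. a (b j) \<otimes> b j i)" .
  show "module.lincomb W a (b ` \<Lambda>) \<in> w"
    using W.lincomb_closed[of "b ` \<Lambda>" a] bw assms(1) by auto
  assume i: "i \<in> \<Lambda>"
  have "(\<Oplus>j\<in>\<Lambda>. a (b j) \<otimes> b j i) = (\<Oplus>j\<in>\<Lambda>. if i = j then a (b j) else \<zero>)"
    by (rule finsum_cong') (use ac i b0 b1 assms(2) in auto)
  also have "\<dots> = a (b i)" by (rule finsum_singleton) (use i finite_\<Lambda> ac in auto)
  finally show "module.lincomb W a (b ` \<Lambda>) i = a (b i)" using * by simp
qed

lemma reduced_basis: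
  assumes z: "\<And>u i. u \<in> w \<Longrightarrow> (\<And>j. j \<in> \<Lambda> \<Longrightarrow> u j = \<zero>) \<Longrightarrow> i < n \<Longrightarrow> u i = \<zero>"
  shows "vectorspace.basis R W (b ` \<Lambda>)"
proof -
  interpret W: vectorspace R W by (rule W_vectorspace)
  have sub: "b ` \<Lambda> \<subseteq> carrier W" using bw by auto
  have "W.lin_indpt (b ` \<Lambda>)"
  proof (rule W.finite_lin_indpt2[OF finite_imageI[OF finite_\<Lambda>] sub], rule ballI)
    fix a u assume a: "a \<in> b ` \<Lambda> \<rightarrow> carrier R" "W.lincomb a (b ` \<Lambda>) = \<zero>\<^bsub>W\<^esub>" "u \<in> b ` \<Lambda>"
    then obtain i where i: "i \<in> \<Lambda>" "u = b i" by blast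
    then have "i < n" using \<Lambda> by auto
    then show "a u = \<zero>" using lincomb_reduced(3)[OF a(1) _ i(1)] a(2) i(2) by (simp add: coord_space_simps)
  qed
  moreover have "W.span (b ` \<Lambda>) = carrier W"
  proof
    show "W.span (b ` \<Lambda>) \<subseteq> carrier W" by (rule W.span_is_subset2[OF sub])
    show "carrier W \<subseteq> W.span (b ` \<Lambda>)"
    proof
      fix u assume "u \<in> carrier W"
      then have u: "u \<in> w" by simp
      \<comment> \<open>The only possible coefficients are the entries of \<open>u\<close> on
        \<open>\<Lambda>\<close>. A linear combination is indexed by vectors rather than positions,
        hence the inverse of \<open>b\<close>.\<close>
      define a where "a = (\<lambda>x. u (the_inv_into \<Lambda> b x))"
      have ab: "a (b j) = u j" if "j \<in> \<Lambda>" for j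
        using the_inv_into_f_f[OF inj_on_reduced that] by (simp add: a_def)
      have a: "a \<in> b ` \<Lambda> \<rightarrow> carrier R" using ab subspace_closed(3)[OF u] \<Lambda> by auto
      define y where "y = W.lincomb a (b ` \<Lambda>)"
      have yw: "y \<in> w" using W.lincomb_closed[OF sub a] by (simp add: y_def)
      have yL: "y j = u j" if "j \<in> \<Lambda>" for j
        using lincomb_reduced(3)[OF a _ that] \<Lambda> that ab by (auto simp: y_def)
      define d where "d = (\<lambda>i\<in>{..<n}. u i \<oplus> (\<ominus> \<one>) \<otimes> y i)"
      have dw: "d \<in> w" unfolding d_def by (intro subspace_add_smult u yw) auto
      have c: "u i \<in> carrier R" "y i \<in> carrier R" if "i < n" for i using subspace_closed(3) u yw that by auto
      have "d j = \<zero>" if "j \<in> \<Lambda>" for j using yL[OF that] c \<Lambda> that by (auto simp: d_def l_minus r_neg)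
      then have d0: "d i = \<zero>" if "i < n" for i using z[OF dw _ that] by blast
      have "u i = y i" if "i < n" for i
      proof -
        have "u i \<oplus> \<ominus> y i = \<zero>" using d0[OF that] c[OF that] that by (simp add: d_def l_minus)
        then show ?thesis using c[OF that] by (metis minus_equality minus_minus a_inv_closed)
      qed
      then have "u = y"
        by (intro extensionalityI[of _ "{..<n}"]) (use subspace_closed(4) u yw in auto)
      then show "u \<in> W.span (b ` \<Lambda>)" unfolding y_def W.span_def using finite_\<Lambda> a by blast
    qed
  qed
  ultimately show ?thesis using sub by (simp add: W.basis_def)
qed

lemma reduced_expansion:
  assumes B: "vectorspace.basis R W (b ` \<Lambda>)" and u: "u \<in> w" and i: "i < n"
  shows "u i = (\<Oplus>j\<in>\<Lambda>. u j \<otimes> b j i)"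
proof -
  interpret W: vectorspace R W by (rule W_vectorspace)
  have sub: "b ` \<Lambda> \<subseteq> carrier W" using bw by auto
  have "u \<in> W.span (b ` \<Lambda>)" using B u by (simp add: W.basis_def)
  then obtain a where a: "a \<in> b ` \<Lambda> \<rightarrow> carrier R" "W.lincomb a (b ` \<Lambda>) = u"
    using W.finite_in_span[OF finite_imageI[OF finite_\<Lambda>] sub] by blast
  have "u i = (\<Oplus>j\<in>\<Lambda>. a (b j) \<otimes> b j i)" using lincomb_reduced(1)[OF a(1) i] a(2) by simp
  also have "\<dots> = (\<Oplus>j\<in>\<Lambda>. u j \<otimes> b j i)"
  proof (rule finsum_cong')
    show "a (b j) \<otimes> b j i = u j \<otimes> b j i" if "j \<in> \<Lambda>" for j
      using lincomb_reduced(3)[OF a(1) _ that] a(2) \<Lambda> that by auto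
    show "(\<lambda>j. u j \<otimes> b j i) \<in> \<Lambda> \<rightarrow> carrier R"
      using subspace_closed(3)[OF u] subspace_closed(3)[OF bw] \<Lambda> i by auto
  qed simp
  finally show ?thesis .
qed

text \<open>Let \<open>u\<close> end with a 1 at a pivot \<open>j\<close> outside
  \<open>\<Lambda>\<close> and expand it in the basis. In entry \<open>j\<close> the terms with
  index l > j vanish because \<open>u l\<close> is zero, those with l < j because the basis vector
  ends at l. So \<open>u j\<close> would be 0.\<close>

lemma reduced_pivots:
  assumes B: "vectorspace.basis R W (b ` \<Lambda>)"
  shows "\<Lambda> = pivots"
proof
  show "\<Lambda> \<subseteq> pivots"
  proof
    fix j assume "j \<in> \<Lambda>"
    then show "j \<in> pivots" using \<Lambda> bw b1 b0 unfolding pivots_def by blast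
  qed
  show "pivots \<subseteq> \<Lambda>"
  proof
    fix j assume "j \<in> pivots"
    then obtain u where u: "j < n" "u \<in> w" "u j = \<one>" "\<And>i. i < n \<Longrightarrow> j < i \<Longrightarrow> u i = \<zero>"
      unfolding pivots_def by blast
    show "j \<in> \<Lambda>"
    proof (rule ccontr)
      assume nj: "j \<notin> \<Lambda>"
      have "u l \<otimes> b l j = \<zero>" if l: "l \<in> \<Lambda>" for l
      proof (cases "j < l")
        case True
        then show ?thesis using u(4)[of l] l \<Lambda> subspace_closed(3)[OF bw[OF l] u(1)] by auto
      next
        case False
        then have "l < j" using nj l by (metis linorder_neqE_nat)
        then show ?thesis using b0[OF l u(1)] subspace_closed(3)[OF u(2), of l] l \<Lambda> by auto
      qed
      then have "(\<Oplus>l\<in>\<Lambda>. u l \<otimes> b l j) = (\<Oplus>l\<in>\<Lambda>. \<zero>)" by (intro finsum_cong') auto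
      then have "u j = \<zero>" using reduced_expansion[OF B u(2,1)] by (simp add: finsum_zero)
      then show False using u(3) by simp
    qed
  qed
qed

end

text \<open>Replaces the basis condition by membership in \<open>w\<close> and fixes the index set,
  so that existence and uniqueness become questions about entries.\<close>

lemma is_reduced_basis_iff:
  "is_reduced_basis n R w \<Lambda> b \<longleftrightarrow>
     \<Lambda> = pivots \<and> b \<in> extensional \<Lambda> \<and> (\<forall>j\<in>\<Lambda>. b j \<in> w \<and> b j j = \<one> \<and>
       (\<forall>i<n. j < i \<or> i \<in> \<Lambda> \<and> i \<noteq> j \<longrightarrow> b j i = \<zero>))" (is "?l \<longleftrightarrow> ?r")
proof
  interpret W: vectorspace R W by (rule W_vectorspace)
  assume l: ?l
  then have B: "vectorspace.basis R W (b ` \<Lambda>)" by (simp add: is_reduced_basis_def)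
  then have bw: "\<forall>j\<in>\<Lambda>. b j \<in> w" by (auto simp: W.basis_def)
  have "\<Lambda> = pivots" by (rule reduced_pivots[OF _ _ _ _ B]) (use l bw in \<open>auto simp: is_reduced_basis_def\<close>)
  then show ?r using l bw by (auto simp: is_reduced_basis_def)
next
  assume r: ?r
  then have \<Lambda>: "\<Lambda> \<subseteq> {..<n}" by (auto simp: pivots_def)
  have "vectorspace.basis R W (b ` \<Lambda>)"
    by (rule reduced_basis) (use r \<Lambda> zero_if_zero_on_pivots in auto)
  then show ?l using r \<Lambda> by (auto simp: is_reduced_basis_def)
qed

lemma ex_reduced_basis: "\<exists>b. is_reduced_basis n R w pivots b"
proof -
  have "\<forall>j\<in>pivots. \<exists>u. u \<in> w \<and> u j = \<one> \<and> (\<forall>i<n. j < i \<or> i \<in> pivots \<and> i \<noteq> j \<longrightarrow> u i = \<zero>)"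
    using ex_reduced_vector by blast
  then obtain b where b: "\<And>j. j \<in> pivots \<Longrightarrow> b j \<in> w \<and> b j j = \<one> \<and>
      (\<forall>i<n. j < i \<or> i \<in> pivots \<and> i \<noteq> j \<longrightarrow> b j i = \<zero>)"
    by metis
  show ?thesis unfolding is_reduced_basis_iff
    by (rule exI[of _ "restrict b pivots"]) (use b in simp)
qed

text \<open>Corresponding vectors of two reduced bases agree on the pivots, so their difference
  vanishes.\<close>

lemma reduced_basis_unique:
  assumes "is_reduced_basis n R w \<Lambda> b" "is_reduced_basis n R w \<Lambda>' b'"
  shows "\<Lambda> = \<Lambda>'" "b = b'"
proof -
  note r = assms[unfolded is_reduced_basis_iff]
  show L: "\<Lambda> = \<Lambda>'" using r by simp
  have \<Lambda>n: "j < n" if "j \<in> \<Lambda>" for j using r that by (auto simp: pivots_def)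
  show "b = b'"
  proof (rule extensionalityI[of _ \<Lambda>])
    fix j assume j: "j \<in> \<Lambda>"
    have bw: "b j \<in> w" "b' j \<in> w" using r j L by auto
    define d where "d = (\<lambda>i\<in>{..<n}. b j i \<oplus> (\<ominus> \<one>) \<otimes> b' j i)"
    have dw: "d \<in> w" unfolding d_def by (intro subspace_add_smult bw) auto
    have c: "b j i \<in> carrier R" "b' j i \<in> carrier R" if "i < n" for i
      using subspace_closed(3) bw that by auto
    have "b j l = b' j l" if "l \<in> \<Lambda>" for l
      using r j L that \<Lambda>n[OF that] by (cases "l = j") auto
    then have "d l = \<zero>" if "l \<in> pivots" for l
      using that r \<Lambda>n c by (auto simp: d_def l_minus r_neg)
    then have d0: "d i = \<zero>" if "i < n" for i using zero_if_zero_on_pivots[OF dw _ that] by blast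
    have "b j i = b' j i" if "i < n" for i
    proof -
      have "b j i \<oplus> \<ominus> b' j i = \<zero>" using d0[OF that] c[OF that] that by (simp add: d_def l_minus)
      then show ?thesis using c[OF that] by (metis minus_equality minus_minus a_inv_closed)
    qed
    then show "b j = b' j"
      by (intro extensionalityI[of _ "{..<n}"]) (use subspace_closed(4) bw in auto)
  qed (use r L in auto)
qed

lemma the_reduced_basis:
  obtains \<Lambda> b where "(THE (\<Lambda>, b). is_reduced_basis n R w \<Lambda> b) = (\<Lambda>, b)" "is_reduced_basis n R w \<Lambda> b"
proof -
  obtain b where b: "is_reduced_basis n R w pivots b" using ex_reduced_basis by blast
  have "(THE (\<Lambda>, b). is_reduced_basis n R w \<Lambda> b) = (pivots, b)"
  proof (rule the_equality)
    fix p assume "case p of (\<Lambda>, b) \<Rightarrow> is_reduced_basis n R w \<Lambda> b"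
    then show "p = (pivots, b)" using reduced_basis_unique[OF _ b] by (cases p) blast
  qed (simp add: b)
  then show ?thesis using b that by blast
qed

lemma reduced_basisD:
  assumes "is_reduced_basis n R w \<Lambda> b"
  shows "\<Lambda> \<subseteq> {..<n}" "\<And>j. j \<in> \<Lambda> \<Longrightarrow> b j \<in> w" "\<And>j. j \<in> \<Lambda> \<Longrightarrow> b j j = \<one>"
    "\<And>j i. j \<in> \<Lambda> \<Longrightarrow> i < n \<Longrightarrow> j < i \<or> i \<in> \<Lambda> \<and> i \<noteq> j \<Longrightarrow> b j i = \<zero>"
    "\<And>u i. u \<in> w \<Longrightarrow> i < n \<Longrightarrow> u i = (\<Oplus>j\<in>\<Lambda>. u j \<otimes> b j i)"
    "vectorspace.dim R W = card \<Lambda>"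
proof -
  interpret W: vectorspace R W by (rule W_vectorspace)
  note r = assms[unfolded is_reduced_basis_iff]
  show \<Lambda>: "\<Lambda> \<subseteq> {..<n}" using assms by (simp add: is_reduced_basis_def)
  show bw: "\<And>j. j \<in> \<Lambda> \<Longrightarrow> b j \<in> w" and b1: "\<And>j. j \<in> \<Lambda> \<Longrightarrow> b j j = \<one>"
    and b0: "\<And>j i. j \<in> \<Lambda> \<Longrightarrow> i < n \<Longrightarrow> j < i \<or> i \<in> \<Lambda> \<and> i \<noteq> j \<Longrightarrow> b j i = \<zero>" using r by auto
  have B: "vectorspace.basis R W (b ` \<Lambda>)" using assms by (simp add: is_reduced_basis_def)
  show "u i = (\<Oplus>j\<in>\<Lambda>. u j \<otimes> b j i)" if "u \<in> w" "i < n" for u i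
    by (rule reduced_expansion[OF \<Lambda> bw b1 b0 B that])
  have "card (b ` \<Lambda>) = card \<Lambda>" by (rule card_image, rule inj_on_reduced[OF \<Lambda> bw b1 b0])
  then show "vectorspace.dim R W = card \<Lambda>"
    using W.dim_basis[OF _ B] \<Lambda> finite_subset by fastforce
qed

end

lemma subspace_subset_if_reduced:
  assumes w: "VectorSpace.subspace R w (coord_space n)" and w': "VectorSpace.subspace R w' (coord_space n)"
    and b: "is_reduced_basis n R w \<Lambda> b" and sub: "\<And>j. j \<in> \<Lambda> \<Longrightarrow> b j \<in> w'"
  shows "w \<subseteq> w'"
proof
  fix u assume u: "u \<in> w"
  note r = reduced_basisD[OF w b]
  have fin: "finite \<Lambda>" using r(1) finite_subset by blast
  define y where "y = finsum ((coord_space n)\<lparr>carrier := w'\<rparr>) (\<lambda>j. \<lambda>i\<in>{..<n}. u j \<otimes> b j i) \<Lambda>"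
  have t: "(\<lambda>j. \<lambda>i\<in>{..<n}. u j \<otimes> b j i) \<in> \<Lambda> \<rightarrow> w'"
    using subspace_closed(2)[OF w'] sub subspace_closed(3)[OF w u] r(1) by auto
  have "u i = y i" if "i < n" for i
  proof -
    have "y i = (\<Oplus>j\<in>\<Lambda>. (\<lambda>i\<in>{..<n}. u j \<otimes> b j i) i)" unfolding y_def by (rule finsum_W(1)[OF w' fin t that])
    then show ?thesis using r(5)[OF u that] that by simp
  qed
  moreover have yw: "y \<in> w'"
  proof -
    interpret W': vectorspace R "(coord_space n)\<lparr>carrier := w'\<rparr>" by (rule W_vectorspace[OF w'])
    show ?thesis unfolding y_def using W'.finsum_closed[of _ \<Lambda>] t by simp
  qed
  ultimately have "u = y"
    by (intro extensionalityI[of _ "{..<n}"]) (use subspace_closed(4)[OF w] subspace_closed(4)[OF w'] u in auto)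
  then show "u \<in> w'" using yw by simp
qed

lemma finite_Gr:
  assumes "finite (carrier R)" shows "finite (Gr k n R)"
proof (rule finite_subset)
  show "Gr k n R \<subseteq> Pow ({..<n} \<rightarrow>\<^sub>E carrier R)" by (auto simp: Gr_def subspace_iff)
  show "finite (Pow ({..<n} \<rightarrow>\<^sub>E carrier R))" using assms by (intro iffD2[OF finite_Pow_iff] finite_PiE) auto
qed

end

section \<open>Matrices over a ring with a residue field\<close>

lemma mat_mult_entry:
  assumes "A \<in> carrier_mat n n" "B \<in> carrier_mat n n" "i < n" "j < n"
  shows "(A * B) $$ (i, j) = (\<Sum>l<n. A $$ (i, l) * B $$ (l, j))"
  using assms by (simp add: scalar_prod_def lessThan_atLeast0)

lemmas mat_assoc = assoc_mult_mat[of _ n n _ n _ n] mult_carrier_mat[of _ n n _ n] for n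

lemma GL_iff:
  "g \<in> GL n \<longleftrightarrow> g \<in> carrier_mat n n \<and> (\<exists>h\<in>carrier_mat n n. h * g = 1\<^sub>m n \<and> g * h = 1\<^sub>m n)"
  by (auto simp: GL_def Units_def ring_mat_simps)

lemma GL_carrier: "g \<in> GL n \<Longrightarrow> g \<in> carrier_mat n n"
  by (simp add: GL_iff)

lemma ring_mat_monoid: "Group.monoid (ring_mat TYPE('r::comm_ring_1) n ())"
  using ring_mat by (rule Ring.ring.axioms(2))

lemma GL_mult: "g \<in> GL n \<Longrightarrow> h \<in> GL n \<Longrightarrow> g * h \<in> GL n"
  using monoid.Units_m_closed[OF ring_mat_monoid, of g n h] by (simp add: GL_def ring_mat_simps)

lemma GL_one: "1\<^sub>m n \<in> GL n"
  by (auto simp: GL_iff)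

lemma GL_inv:
  assumes "g \<in> GL n"
  shows "GL_inv n g \<in> GL n" "GL_inv n g * g = 1\<^sub>m n" "g * GL_inv n g = 1\<^sub>m n"
  using monoid.Units_inv_Units[OF ring_mat_monoid, of g n] monoid.Units_l_inv[OF ring_mat_monoid, of g n]
    monoid.Units_r_inv[OF ring_mat_monoid, of g n] assms
  by (simp_all add: GL_def GL_inv_def ring_mat_simps)

lemma GL_inv_unique:
  assumes "g \<in> carrier_mat n n" "h \<in> carrier_mat n n" "h * g = 1\<^sub>m n" "g * h = 1\<^sub>m n"
  shows "GL_inv n g = h"
  using monoid.inv_unique'[OF ring_mat_monoid, of g n h] assms by (simp add: GL_inv_def ring_mat_simps)

lemma GL_inv_inv: "g \<in> GL n \<Longrightarrow> GL_inv n (GL_inv n g) = g"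
  using GL_inv[of g n] GL_carrier GL_inv_unique by metis

lemma GL_inv_mult:
  assumes "g \<in> GL n" "h \<in> GL n" shows "GL_inv n (g * h) = GL_inv n h * GL_inv n g"
proof (rule GL_inv_unique)
  note c = GL_carrier[OF assms(1)] GL_carrier[OF assms(2)] GL_carrier[OF GL_inv(1)[OF assms(1)]]
    GL_carrier[OF GL_inv(1)[OF assms(2)]]
  have "GL_inv n h * GL_inv n g * (g * h) = GL_inv n h * (GL_inv n g * g) * h"
    using c by (simp add: mat_assoc[where n = n])
  then show "GL_inv n h * GL_inv n g * (g * h) = 1\<^sub>m n" using GL_inv[OF assms(1)] GL_inv[OF assms(2)] c by simp
  have "g * h * (GL_inv n h * GL_inv n g) = g * (h * GL_inv n h) * GL_inv n g"
    using c by (simp add: mat_assoc[where n = n])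
  then show "g * h * (GL_inv n h * GL_inv n g) = 1\<^sub>m n" using GL_inv[OF assms(1)] GL_inv[OF assms(2)] c by simp
qed (rule mult_carrier_mat; rule GL_carrier; intro GL_inv(1) assms)+

lemma GL_left_cancel:
  assumes "g \<in> GL n" "A \<in> carrier_mat n n" "B \<in> carrier_mat n n" "g * A = g * B"
  shows "A = B"
proof -
  note c = GL_carrier[OF assms(1)] GL_carrier[OF GL_inv(1)[OF assms(1)]]
  have "GL_inv n g * g * A = GL_inv n g * g * B"
    using c assms by (simp add: mat_assoc[where n = n])
  then show ?thesis using GL_inv[OF assms(1)] assms by simp
qed

section \<open>Permutation matrices\<close>

definition perm_mat :: "nat \<Rightarrow> (nat \<Rightarrow> nat) \<Rightarrow> 'r::comm_ring_1 mat" where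
  "perm_mat n p = mat n n (\<lambda>(i, j). if i = p j then 1 else 0)"

lemma perm_mat_mult:
  assumes p: "bij_betw p {..<n} {..<n}"
  shows "perm_mat n p * mat n n (\<lambda>(i, j). if i = j then d j else 0) * transpose_mat (perm_mat n p) =
    mat n n (\<lambda>(i, j). if i = j then d (the_inv_into {..<n} p j) else (0::'r::comm_ring_1))"
proof (rule eq_matI)
  fix i j assume "i < dim_row (mat n n (\<lambda>(i, j). if i = j then d (the_inv_into {..<n} p j) else (0::'r)))"
    "j < dim_col (mat n n (\<lambda>(i, j). if i = j then d (the_inv_into {..<n} p j) else (0::'r)))"
  then have ij: "i < n" "j < n" by auto
  let ?D = "mat n n (\<lambda>(i, j). if i = j then d j else (0::'r))"
  let ?q = "the_inv_into {..<n} p"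
  have c: "perm_mat n p \<in> carrier_mat n n" "?D \<in> carrier_mat n n" by (simp_all add: perm_mat_def)
  have q: "?q j < n" "p (?q j) = j"
    using the_inv_into_into[of p "{..<n}" j "{..<n}"] f_the_inv_into_f[of p "{..<n}" j] p ij
    by (auto simp: bij_betw_def)
  have pq: "j = p l \<longleftrightarrow> l = ?q j" if "l < n" for l
    using q p that by (metis bij_betw_def inj_onD lessThan_iff)
  have 1: "(perm_mat n p * ?D) $$ (i, l) = (if i = p l then d l else 0)" if "l < n" for l
  proof -
    have "(perm_mat n p * ?D) $$ (i, l) = (\<Sum>m<n. if m = l then (if i = p l then d l else 0) else 0)"
      unfolding mat_mult_entry[OF c ij(1) that] by (rule sum.cong) (use ij that in \<open>auto simp: perm_mat_def\<close>)
    then show ?thesis using that by simp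
  qed
  have "(perm_mat n p * ?D * transpose_mat (perm_mat n p)) $$ (i, j) =
      (\<Sum>l<n. (perm_mat n p * ?D) $$ (i, l) * transpose_mat (perm_mat n p) $$ (l, j))"
    by (rule mat_mult_entry) (use c ij mult_carrier_mat[OF c] in auto)
  also have "\<dots> = (\<Sum>l<n. if l = ?q j then (if i = j then d l else 0) else 0)"
    by (rule sum.cong) (use 1 ij pq q in \<open>auto simp: perm_mat_def simp del: index_mult_mat(1)\<close>)
  also have "\<dots> = (if i = j then d (?q j) else 0)" using q(1) by simp
  finally show "(perm_mat n p * ?D * transpose_mat (perm_mat n p)) $$ (i, j) =
      mat n n (\<lambda>(i, j). if i = j then d (?q j) else 0) $$ (i, j)" using ij by simp
qed (auto simp: perm_mat_def)

lemma perm_mat_inverse: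
  assumes p: "bij_betw p {..<n} {..<n}"
  shows "perm_mat n p * transpose_mat (perm_mat n p) = (1\<^sub>m n :: 'r::comm_ring_1 mat)"
    "transpose_mat (perm_mat n p) * perm_mat n p = (1\<^sub>m n :: 'r::comm_ring_1 mat)"
proof -
  have one: "mat n n (\<lambda>(i, j). if i = j then 1 else 0) = (1\<^sub>m n :: 'r mat)" by (rule eq_matI) auto
  show "perm_mat n p * transpose_mat (perm_mat n p) = (1\<^sub>m n :: 'r mat)"
    using perm_mat_mult[OF p, of "\<lambda>_. 1 :: 'r"] unfolding one by (simp add: perm_mat_def)
  show "transpose_mat (perm_mat n p) * perm_mat n p = (1\<^sub>m n :: 'r mat)"
  proof (rule eq_matI)
    fix i j assume "i < dim_row (1\<^sub>m n :: 'r mat)" "j < dim_col (1\<^sub>m n :: 'r mat)"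
    then have ij: "i < n" "j < n" by auto
    have "p i < n" using p ij by (auto simp: bij_betw_def)
    have pij: "p i = p j \<longleftrightarrow> i = j" using p ij by (auto simp: bij_betw_def inj_on_def)
    have "(transpose_mat (perm_mat n p) * perm_mat n p) $$ (i, j) =
        (\<Sum>l<n. transpose_mat (perm_mat n p) $$ (i, l) * (perm_mat n p $$ (l, j) :: 'r))"
      by (rule mat_mult_entry) (use ij in \<open>auto simp: perm_mat_def\<close>)
    also have "\<dots> = (\<Sum>l<n. if l = p i then (if i = j then 1 else 0) else 0)"
      by (rule sum.cong) (use ij pij in \<open>auto simp: perm_mat_def\<close>)
    also have "\<dots> = (1\<^sub>m n :: 'r mat) $$ (i, j)" using ij \<open>p i < n\<close> by simp
    finally show "(transpose_mat (perm_mat n p) * perm_mat n p) $$ (i, j) = (1\<^sub>m n :: 'r mat) $$ (i, j)" .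
  qed (auto simp: perm_mat_def)
qed

text \<open>The local situation, seen inside the ring of adeles: \<open>\<O>\<close> is the ring of integral adeles, \<open>\<rho>\<close> reduces
  the component at \<open>x\<close>, \<open>\<sigma>\<close> is a section of \<open>\<rho>\<close>, and \<open>\<pi>\<close> is the idele given by a uniformizer at \<open>x\<close>.\<close>

locale residue_data = field \<kappa> for \<kappa> :: "('k, 'm) ring_scheme" (structure) +
  fixes \<O> :: "'r::comm_ring_1 set" and \<pi> \<pi>' :: 'r and \<rho> :: "'r \<Rightarrow> 'k" and \<sigma> :: "'k \<Rightarrow> 'r"
  assumes O_one: "1 \<in> \<O>" and O_add: "a \<in> \<O> \<Longrightarrow> b \<in> \<O> \<Longrightarrow> a + b \<in> \<O>"
    and O_uminus: "a \<in> \<O> \<Longrightarrow> - a \<in> \<O>" and O_mult: "a \<in> \<O> \<Longrightarrow> b \<in> \<O> \<Longrightarrow> a * b \<in> \<O>"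
    and \<pi>_O: "\<pi> \<in> \<O>" and \<pi>_inv: "\<pi> * \<pi>' = 1"
    and \<rho>_closed: "a \<in> \<O> \<Longrightarrow> \<rho> a \<in> carrier \<kappa>"
    and \<rho>_add: "a \<in> \<O> \<Longrightarrow> b \<in> \<O> \<Longrightarrow> \<rho> (a + b) = \<rho> a \<oplus> \<rho> b"
    and \<rho>_mult: "a \<in> \<O> \<Longrightarrow> b \<in> \<O> \<Longrightarrow> \<rho> (a * b) = \<rho> a \<otimes> \<rho> b"
    and \<rho>_one: "\<rho> 1 = \<one>" and \<rho>_\<pi>: "\<rho> \<pi> = \<zero>"
    and \<rho>_kernel: "a \<in> \<O> \<Longrightarrow> \<rho> a = \<zero> \<Longrightarrow> a * \<pi>' \<in> \<O>"
    and \<sigma>_O: "l \<in> carrier \<kappa> \<Longrightarrow> \<sigma> l \<in> \<O>" and \<rho>_\<sigma>: "l \<in> carrier \<kappa> \<Longrightarrow> \<rho> (\<sigma> l) = l"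
    and \<sigma>_zero: "\<sigma> \<zero> = 0"
begin

lemma O_zero: "0 \<in> \<O>" using O_add[OF O_one O_uminus[OF O_one]] by simp
lemma O_diff: "a \<in> \<O> \<Longrightarrow> b \<in> \<O> \<Longrightarrow> a - b \<in> \<O>" using O_add[of a "- b"] O_uminus[of b] by simp
lemma O_sum: "(\<And>i. i \<in> I \<Longrightarrow> f i \<in> \<O>) \<Longrightarrow> sum f I \<in> \<O>"
  by (induction I rule: infinite_finite_induct) (auto simp: O_zero O_add)
lemma O_prod: "(\<And>i. i \<in> I \<Longrightarrow> f i \<in> \<O>) \<Longrightarrow> prod f I \<in> \<O>"
  by (induction I rule: infinite_finite_induct) (auto simp: O_one O_mult)
lemma \<rho>_zero: "\<rho> 0 = \<zero>" using \<rho>_\<sigma>[of \<zero>] \<sigma>_zero by simp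
lemma \<rho>_diff: "a \<in> \<O> \<Longrightarrow> b \<in> \<O> \<Longrightarrow> \<rho> (a - b) = \<rho> a \<ominus> \<rho> b"
proof -
  assume ab: "a \<in> \<O>" "b \<in> \<O>"
  have "\<rho> (a - b) \<oplus> \<rho> b = \<rho> a" using \<rho>_add[of "a - b" b] ab O_diff by simp
  then show ?thesis using ab \<rho>_closed[of a] \<rho>_closed[of b] \<rho>_closed[OF O_diff[OF ab]]
    by (metis a_minus_def add.inv_solve_right)
qed
lemma \<rho>_sum:
  assumes "finite I" "\<And>i. i \<in> I \<Longrightarrow> f i \<in> \<O>"
  shows "\<rho> (sum f I) = (\<Oplus>i\<in>I. \<rho> (f i))"
  using assms
proof (induction I rule: finite_induct)
  case (insert x F)
  then have "\<rho> (sum f (insert x F)) = \<rho> (f x) \<oplus> \<rho> (sum f F)" by (simp add: \<rho>_add O_sum)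
  also have "\<dots> = (\<Oplus>i\<in>insert x F. \<rho> (f i))" using insert \<rho>_closed by (subst finsum_insert) auto
  finally show ?case .
qed (simp add: \<rho>_zero)

section \<open>Integral matrices and integral units\<close>

definition int_mat :: "nat \<Rightarrow> 'r mat set" where
  "int_mat n = {A \<in> carrier_mat n n. \<forall>i<n. \<forall>j<n. A $$ (i, j) \<in> \<O>}"

lemma int_mat_mult: "A \<in> int_mat n \<Longrightarrow> B \<in> int_mat n \<Longrightarrow> A * B \<in> int_mat n"
  unfolding int_mat_def by (auto simp: mat_mult_entry[of _ n] intro!: O_sum O_mult simp del: index_mult_mat(1))

lemma det_int_mat: assumes "A \<in> int_mat n" shows "det A \<in> \<O>"
proof -
  have s: "signof p \<in> \<O>" for p :: "nat \<Rightarrow> nat" by (auto simp: sign_def O_one O_uminus)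
  have "A $$ (i, p i) \<in> \<O>" if "p permutes {0..<n}" "i < n" for p i
    using assms permutes_in_image[OF that(1), of i] that(2) by (auto simp: int_mat_def)
  then show ?thesis
    using assms by (subst det_def'[of A n]) (auto simp: int_mat_def intro!: O_sum O_mult O_prod s)
qed

definition K :: "nat \<Rightarrow> 'r mat set" where
  "K n = {g \<in> GL n. g \<in> int_mat n \<and> GL_inv n g \<in> int_mat n}"

lemma K_I: "A \<in> int_mat n \<Longrightarrow> B \<in> int_mat n \<Longrightarrow> A * B = 1\<^sub>m n \<Longrightarrow> B * A = 1\<^sub>m n \<Longrightarrow> A \<in> K n"
  using GL_inv_unique[of A n B] by (auto simp: K_def GL_iff int_mat_def)

lemma K_mult: "g \<in> K n \<Longrightarrow> h \<in> K n \<Longrightarrow> g * h \<in> K n"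
  by (simp add: K_def GL_mult int_mat_mult GL_inv_mult)

lemma K_inv: "g \<in> K n \<Longrightarrow> GL_inv n g \<in> K n"
  by (simp add: K_def GL_inv GL_inv_inv)

lemma K_one: "1\<^sub>m n \<in> K n"
  by (rule K_I[of _ _ "1\<^sub>m n"]) (auto simp: int_mat_def O_one O_zero)

lemma perm_mat_K: assumes "bij_betw p {..<n} {..<n}" shows "perm_mat n p \<in> K n" "transpose_mat (perm_mat n p) \<in> K n"
proof -
  have "perm_mat n p \<in> int_mat n" "transpose_mat (perm_mat n p) \<in> int_mat n"
    by (auto simp: int_mat_def perm_mat_def O_one O_zero)
  then show "perm_mat n p \<in> K n" "transpose_mat (perm_mat n p) \<in> K n"
    using K_I perm_mat_inverse[OF assms] by blast+
qed

lemma det_K: assumes "A \<in> K n" shows "det A \<in> \<O>" "\<exists>b\<in>\<O>. det A * b = 1"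
proof -
  have A: "A \<in> int_mat n" "GL_inv n A \<in> int_mat n" "A \<in> GL n" using assms by (auto simp: K_def)
  show "det A \<in> \<O>" by (rule det_int_mat[OF A(1)])
  have "det A * det (GL_inv n A) = 1"
    using det_mult[of A n "GL_inv n A"] GL_inv[OF A(3)] GL_carrier A(3) by (metis det_one)
  then show "\<exists>b\<in>\<O>. det A * b = 1" using det_int_mat[OF A(2)] by blast
qed

definition diag :: "nat \<Rightarrow> (nat \<Rightarrow> 'r) \<Rightarrow> 'r mat" where
  "diag n d = mat n n (\<lambda>(i, j). if i = j then d j else 0)"

lemma diag_carrier: "diag n d \<in> carrier_mat n n"
  by (simp add: diag_def)

lemma mult_diag_entry:
  assumes "A \<in> carrier_mat n n" "i < n" "j < n"
  shows "(A * diag n d) $$ (i, j) = A $$ (i, j) * d j"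
proof -
  have "(A * diag n d) $$ (i, j) = (\<Sum>l<n. if l = j then A $$ (i, j) * d j else 0)"
    unfolding mat_mult_entry[OF assms(1) diag_carrier assms(2,3)]
    by (rule sum.cong) (use assms in \<open>auto simp: diag_def\<close>)
  then show ?thesis using assms by simp
qed

lemma diag_mult: "diag n d * diag n d' = diag n (\<lambda>i. d i * d' i)"
proof (rule eq_matI)
  fix i j assume "i < dim_row (diag n (\<lambda>i. d i * d' i))" "j < dim_col (diag n (\<lambda>i. d i * d' i))"
  then have "i < n" "j < n" by (auto simp: diag_def)
  then show "(diag n d * diag n d') $$ (i, j) = diag n (\<lambda>i. d i * d' i) $$ (i, j)"
    by (subst mult_diag_entry[OF diag_carrier]) (auto simp: diag_def)
qed (auto simp: diag_def)

lemma diag_one: "(\<And>i. i < n \<Longrightarrow> d i = 1) \<Longrightarrow> diag n d = 1\<^sub>m n"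
  by (rule eq_matI) (auto simp: diag_def)

lemma det_diag: "det (diag n d) = (\<Prod>i<n. d i)"
proof -
  have "det (diag n d) = prod_list (diag_mat (diag n d))"
    by (rule det_upper_triangular) (auto simp: diag_def)
  then show ?thesis by (simp add: prod_list_diag_prod diag_def lessThan_atLeast0)
qed

definition uniformizer_at :: "nat set \<Rightarrow> nat \<Rightarrow> 'r" where
  "uniformizer_at J i = (if i \<in> J then \<pi> else 1)"

lemma uniformizer_at_O: "uniformizer_at J i \<in> \<O>"
  by (simp add: uniformizer_at_def \<pi>_O O_one)

lemma diag_uniformizer_GL: "diag n (uniformizer_at J) \<in> GL n"
proof -
  define d' where "d' i = (if i \<in> J then \<pi>' else 1)" for i
  have "diag n d' * diag n (uniformizer_at J) = 1\<^sub>m n" "diag n (uniformizer_at J) * diag n d' = 1\<^sub>m n"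
    unfolding diag_mult using \<pi>_inv by (auto intro!: diag_one simp: d'_def uniformizer_at_def mult.commute)
  then show ?thesis unfolding GL_iff using diag_carrier by blast
qed

text \<open>Replaces a comparison of valuations. If the exponents differed, cancelling the smaller
  power of \<open>\<pi>\<close> would exhibit a unit as an integral multiple of
  \<open>\<pi>\<close>, and applying \<open>\<rho>\<close> would give 1 = 0 in the residue
  field.\<close>

lemma uniformizer_power_unit_eq:
  assumes "u \<in> \<O>" "u' \<in> \<O>" "\<exists>b\<in>\<O>. u * b = 1" "\<exists>b\<in>\<O>. u' * b = 1" "\<pi> ^ k * u = \<pi> ^ l * u'"
  shows "k = l"
proof -
  have main: "\<not> k < l" if "u \<in> \<O>" "u' \<in> \<O>" "\<exists>b\<in>\<O>. u * b = 1" "\<pi> ^ k * u = \<pi> ^ l * u'" for k l u u'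
  proof
    assume "k < l"
    have canc: "\<pi>' ^ k * (\<pi> ^ k * a) = a" for a
      using \<pi>_inv by (simp add: mult.commute[of \<pi> \<pi>'] flip: mult.assoc power_mult_distrib)
    have pO: "\<pi> ^ m \<in> \<O>" for m by (induction m) (auto simp: O_one O_mult \<pi>_O)
    have "\<pi> ^ l = \<pi> ^ k * (\<pi> * \<pi> ^ (l - k - 1))"
      using \<open>k < l\<close> by (simp flip: power_add power_Suc add: Suc_diff_Suc)
    then have "\<pi> ^ k * u = \<pi> ^ k * (\<pi> * (\<pi> ^ (l - k - 1) * u'))" using that(4) by (simp add: mult.assoc)
    then have u: "u = \<pi> * (\<pi> ^ (l - k - 1) * u')" using canc by metis
    from that(3) obtain b where b: "b \<in> \<O>" "u * b = 1" by blast
    have "1 = \<pi> * (\<pi> ^ (l - k - 1) * u' * b)" using b(2) unfolding u by (simp add: mult.assoc)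
    then have "\<rho> 1 = \<rho> \<pi> \<otimes> \<rho> (\<pi> ^ (l - k - 1) * u' * b)"
      using \<rho>_mult[OF \<pi>_O, of "\<pi> ^ (l - k - 1) * u' * b"] O_mult pO that(2) b(1) by metis
    then have "\<one> = \<zero>" unfolding \<rho>_\<pi> \<rho>_one using \<rho>_closed O_mult pO that(2) b(1) by simp
    then show False by simp
  qed
  show ?thesis using main[of u u' k l] main[of u' u l k] assms by fastforce
qed

end

section \<open>Decomposition of the Hecke coset\<close>

context residue_data
begin

definition reduced_mat :: "nat \<Rightarrow> nat set \<Rightarrow> (nat \<Rightarrow> nat \<Rightarrow> 'k) \<Rightarrow> 'r mat" where
  "reduced_mat n \<Lambda> b = mat n n (\<lambda>(i, j).
     if i = j then (if j \<in> \<Lambda> then 1 else \<pi>) else if i < j \<and> j \<in> \<Lambda> then \<sigma> (b j i) else 0)"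

text \<open>Off-diagonal entries sit in rows outside \<open>\<Lambda>\<close> and columns inside it.
  The nilpotent part therefore squares to zero, products add the entries, and negation
  inverts.\<close>

definition unipotent_mat :: "nat \<Rightarrow> nat set \<Rightarrow> (nat \<Rightarrow> nat \<Rightarrow> 'r) \<Rightarrow> 'r mat" where
  "unipotent_mat n \<Lambda> c = mat n n (\<lambda>(i, j). if i = j then 1 else if i \<notin> \<Lambda> \<and> j \<in> \<Lambda> then c i j else 0)"

lemma unipotent_mat_mult:
  "unipotent_mat n \<Lambda> c * unipotent_mat n \<Lambda> c' = unipotent_mat n \<Lambda> (\<lambda>i j. c i j + c' i j)"
proof (rule eq_matI)
  fix i j assume "i < dim_row (unipotent_mat n \<Lambda> (\<lambda>i j. c i j + c' i j))"
    "j < dim_col (unipotent_mat n \<Lambda> (\<lambda>i j. c i j + c' i j))"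
  then have ij: "i < n" "j < n" by (auto simp: unipotent_mat_def)
  have C: "unipotent_mat n \<Lambda> c \<in> carrier_mat n n" for c by (simp add: unipotent_mat_def)
  have "(unipotent_mat n \<Lambda> c * unipotent_mat n \<Lambda> c') $$ (i, j) =
      (\<Sum>l<n. (if l = i then unipotent_mat n \<Lambda> c' $$ (i, j) else 0) +
        (if l = j then (if i \<noteq> j \<and> i \<notin> \<Lambda> \<and> j \<in> \<Lambda> then c i j else 0) else 0))"
    unfolding mat_mult_entry[OF C C ij] by (rule sum.cong) (use ij in \<open>auto simp: unipotent_mat_def\<close>)
  also have "\<dots> = unipotent_mat n \<Lambda> (\<lambda>i j. c i j + c' i j) $$ (i, j)"
    unfolding sum.distrib using ij by (simp add: unipotent_mat_def add.commute)
  finally show "(unipotent_mat n \<Lambda> c * unipotent_mat n \<Lambda> c') $$ (i, j) =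
      unipotent_mat n \<Lambda> (\<lambda>i j. c i j + c' i j) $$ (i, j)" .
qed (auto simp: unipotent_mat_def)

lemma unipotent_mat_K:
  assumes "\<And>i j. c i j \<in> \<O>" shows "unipotent_mat n \<Lambda> c \<in> K n"
proof (rule K_I)
  have one: "unipotent_mat n \<Lambda> (\<lambda>i j. 0) = 1\<^sub>m n" by (rule eq_matI) (auto simp: unipotent_mat_def)
  show "unipotent_mat n \<Lambda> c \<in> int_mat n" "unipotent_mat n \<Lambda> (\<lambda>i j. - c i j) \<in> int_mat n"
    using assms by (auto simp: int_mat_def unipotent_mat_def O_one O_zero O_uminus)
  show "unipotent_mat n \<Lambda> c * unipotent_mat n \<Lambda> (\<lambda>i j. - c i j) = 1\<^sub>m n"
    "unipotent_mat n \<Lambda> (\<lambda>i j. - c i j) * unipotent_mat n \<Lambda> c = 1\<^sub>m n"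
    unfolding unipotent_mat_mult by (simp_all add: one)
qed

text \<open>A reduced basis vanishes at the other pivots, so the off-diagonal entries sit where
  \<open>unipotent_mat\<close> allows them. The diagonal factor on the right leaves the columns in
  \<open>\<Lambda>\<close> alone and multiplies the others, which are unit vectors, by
  \<open>\<pi>\<close>.\<close>

lemma reduced_mat_decomposition:
  assumes b: "\<And>j i. j \<in> \<Lambda> \<Longrightarrow> i < n \<Longrightarrow> b j i \<in> carrier \<kappa>"
    and b0: "\<And>j i. j \<in> \<Lambda> \<Longrightarrow> i < n \<Longrightarrow> i \<in> \<Lambda> \<Longrightarrow> i \<noteq> j \<Longrightarrow> b j i = \<zero>"
  shows "\<exists>u\<in>K n. reduced_mat n \<Lambda> b = u * diag n (uniformizer_at (- \<Lambda>))"
proof -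
  define c where "c i j = (if i < j \<and> i < n \<and> j \<in> \<Lambda> then \<sigma> (b j i) else 0)" for i j
  have "c i j \<in> \<O>" for i j using b \<sigma>_O by (auto simp: c_def O_zero)
  then have u: "unipotent_mat n \<Lambda> c \<in> K n" by (rule unipotent_mat_K)
  have C: "unipotent_mat n \<Lambda> c \<in> carrier_mat n n" by (simp add: unipotent_mat_def)
  have "reduced_mat n \<Lambda> b = unipotent_mat n \<Lambda> c * diag n (uniformizer_at (- \<Lambda>))"
  proof (rule eq_matI)
    fix i j assume "i < dim_row (unipotent_mat n \<Lambda> c * diag n (uniformizer_at (- \<Lambda>)))"
      "j < dim_col (unipotent_mat n \<Lambda> c * diag n (uniformizer_at (- \<Lambda>)))"
    then have ij: "i < n" "j < n" by (auto simp: unipotent_mat_def diag_def)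
    show "reduced_mat n \<Lambda> b $$ (i, j) = (unipotent_mat n \<Lambda> c * diag n (uniformizer_at (- \<Lambda>))) $$ (i, j)"
      unfolding mult_diag_entry[OF C ij]
      using ij b0[of j i] by (auto simp: reduced_mat_def unipotent_mat_def uniformizer_at_def c_def \<sigma>_zero)
  qed (auto simp: reduced_mat_def unipotent_mat_def diag_def)
  then show ?thesis using u by blast
qed

definition Hecke_coset :: "nat \<Rightarrow> nat \<Rightarrow> 'r mat set" where
  "Hecke_coset n r = {k1 * diag n (uniformizer_at {..<r}) * k2 | k1 k2. k1 \<in> K n \<and> k2 \<in> K n}"

lemma K_carrier: "g \<in> K n \<Longrightarrow> g \<in> carrier_mat n n"
  by (simp add: K_def int_mat_def)

text \<open>A permutation carrying the first \<open>r\<close> indices to the complement of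
  \<open>\<Lambda>\<close> conjugates one diagonal matrix into the other, and permutation matrices
  are integral units.\<close>

lemma diag_uniformizer_Hecke_coset:
  assumes \<Lambda>: "\<Lambda> \<subseteq> {..<n}" "card \<Lambda> = n - r" and r: "r \<le> n"
  shows "\<exists>k1\<in>K n. \<exists>k2\<in>K n. diag n (uniformizer_at (- \<Lambda>)) = k1 * diag n (uniformizer_at {..<r}) * k2"
proof -
  have fin: "finite \<Lambda>" using \<Lambda>(1) finite_subset by blast
  have "card ({..<n} - \<Lambda>) = r" using card_Diff_subset[OF fin \<Lambda>(1)] \<Lambda>(2) r by simp
  then obtain p1 where p1: "bij_betw p1 {..<r} ({..<n} - \<Lambda>)"
    using finite_same_card_bij[of "{..<r}" "{..<n} - \<Lambda>"] by auto
  obtain p2 where p2: "bij_betw p2 {r..<n} \<Lambda>"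
    using finite_same_card_bij[of "{r..<n}" \<Lambda>] \<Lambda>(2) fin by auto
  define p where "p i = (if i < r then p1 i else p2 i)" for i
  have 1: "bij_betw p {..<r} ({..<n} - \<Lambda>)" using p1 by (rule bij_betw_cong[THEN iffD1, rotated]) (simp add: p_def)
  have 2: "bij_betw p {r..<n} \<Lambda>" using p2 by (rule bij_betw_cong[THEN iffD1, rotated]) (simp add: p_def)
  have "bij_betw p ({..<r} \<union> {r..<n}) (({..<n} - \<Lambda>) \<union> \<Lambda>)" by (rule bij_betw_combine[OF 1 2]) auto
  moreover have "{..<r} \<union> {r..<n} = {..<n}" "({..<n} - \<Lambda>) \<union> \<Lambda> = {..<n}" using r \<Lambda>(1) by auto
  ultimately have p: "bij_betw p {..<n} {..<n}" by simp
  have "uniformizer_at (- \<Lambda>) j = uniformizer_at {..<r} (the_inv_into {..<n} p j)" if "j < n" for j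
  proof -
    define i where "i = the_inv_into {..<n} p j"
    have i: "i < n" "p i = j"
      using the_inv_into_into[of p "{..<n}" j "{..<n}"] f_the_inv_into_f[of p "{..<n}" j] p that
      by (auto simp: bij_betw_def i_def)
    have "j \<in> {..<n} - \<Lambda>" if "i < r" using bij_betwE[OF 1] that i(2) by auto
    moreover have "j \<in> \<Lambda>" if "\<not> i < r" using bij_betwE[OF 2] that i by auto
    ultimately have "j \<in> \<Lambda> \<longleftrightarrow> \<not> i < r" by blast
    then show ?thesis by (simp add: uniformizer_at_def i_def)
  qed
  then have "diag n (uniformizer_at (- \<Lambda>)) =
      perm_mat n p * diag n (uniformizer_at {..<r}) * transpose_mat (perm_mat n p)"
    unfolding diag_def perm_mat_mult[OF p] by (intro cong_mat) auto
  then show ?thesis using perm_mat_K[OF p] by blast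
qed

lemma reduced_mat_Hecke_coset:
  assumes "\<And>j i. j \<in> \<Lambda> \<Longrightarrow> i < n \<Longrightarrow> b j i \<in> carrier \<kappa>"
    and "\<And>j i. j \<in> \<Lambda> \<Longrightarrow> i < n \<Longrightarrow> i \<in> \<Lambda> \<Longrightarrow> i \<noteq> j \<Longrightarrow> b j i = \<zero>"
    and "\<Lambda> \<subseteq> {..<n}" "card \<Lambda> = n - r" "r \<le> n"
  shows "reduced_mat n \<Lambda> b \<in> Hecke_coset n r"
proof -
  obtain u where u: "u \<in> K n" "reduced_mat n \<Lambda> b = u * diag n (uniformizer_at (- \<Lambda>))"
    using reduced_mat_decomposition[of \<Lambda> n b] assms(1,2) by blast
  obtain k1 k2 where k: "k1 \<in> K n" "k2 \<in> K n"
    "diag n (uniformizer_at (- \<Lambda>)) = k1 * diag n (uniformizer_at {..<r}) * k2"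
    using diag_uniformizer_Hecke_coset[OF assms(3-5)] by blast
  have "reduced_mat n \<Lambda> b = (u * k1) * diag n (uniformizer_at {..<r}) * k2"
    unfolding u(2) k(3) using K_carrier[OF u(1)] K_carrier[OF k(1)] K_carrier[OF k(2)] diag_carrier
    by (simp add: mat_assoc[where n = n])
  then show ?thesis unfolding Hecke_coset_def using K_mult[OF u(1) k(1)] k(2) by blast
qed

lemma K_GL: "g \<in> K n \<Longrightarrow> g \<in> GL n"
  by (simp add: K_def)

lemma Hecke_coset_GL: assumes "h \<in> Hecke_coset n r" shows "h \<in> GL n"
proof -
  obtain k1 k2 where k: "k1 \<in> K n" "k2 \<in> K n" "h = k1 * diag n (uniformizer_at {..<r}) * k2"
    using assms unfolding Hecke_coset_def by blast
  show ?thesis unfolding k(3) by (intro GL_mult diag_uniformizer_GL K_GL k(1,2))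
qed

lemma reduced_mat_GL:
  assumes "\<And>j i. j \<in> \<Lambda> \<Longrightarrow> i < n \<Longrightarrow> b j i \<in> carrier \<kappa>"
    and "\<And>j i. j \<in> \<Lambda> \<Longrightarrow> i < n \<Longrightarrow> i \<in> \<Lambda> \<Longrightarrow> i \<noteq> j \<Longrightarrow> b j i = \<zero>"
  shows "reduced_mat n \<Lambda> b \<in> GL n"
proof -
  obtain u where "u \<in> K n" "reduced_mat n \<Lambda> b = u * diag n (uniformizer_at (- \<Lambda>))"
    using reduced_mat_decomposition[of \<Lambda> n b] assms by blast
  then show ?thesis using GL_mult[OF K_GL diag_uniformizer_GL] by simp
qed

text \<open>The second claim says that the lattice of \<open>h\<close> contains \<open>\<pi>\<close>
  times the standard lattice. The witness comes from the complementary diagonal matrix, whose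
  product with the original one is the scalar \<open>\<pi>\<close>.\<close>

lemma Hecke_coset_integral:
  assumes "h \<in> Hecke_coset n r"
  shows "h \<in> int_mat n" "\<exists>E\<in>int_mat n. h * E = diag n (\<lambda>_. \<pi>)"
proof -
  obtain k1 k2 where k: "k1 \<in> K n" "k2 \<in> K n" and h: "h = k1 * diag n (uniformizer_at {..<r}) * k2"
    using assms unfolding Hecke_coset_def by blast
  have di: "diag n (uniformizer_at J) \<in> int_mat n" for J
    by (auto simp: int_mat_def diag_def uniformizer_at_O O_zero)
  show "h \<in> int_mat n" unfolding h using k di by (intro int_mat_mult) (auto simp: K_def)
  define E where "E = GL_inv n k2 * diag n (uniformizer_at (- {..<r})) * GL_inv n k1"
  have E: "E \<in> int_mat n" unfolding E_def using k di by (intro int_mat_mult) (auto simp: K_def)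
  note c = K_carrier[OF k(1)] K_carrier[OF k(2)] K_carrier[OF K_inv[OF k(1)]] K_carrier[OF K_inv[OF k(2)]]
  let ?D = "diag n (uniformizer_at {..<r})" and ?D' = "diag n (uniformizer_at (- {..<r}))"
  have dd: "?D * ?D' = \<pi> \<cdot>\<^sub>m 1\<^sub>m n"
    unfolding diag_mult by (rule eq_matI) (auto simp: diag_def uniformizer_at_def)
  have "h * E = k1 * ?D * (k2 * GL_inv n k2) * ?D' * GL_inv n k1"
    unfolding h E_def using c diag_carrier by (simp add: mat_assoc[where n = n])
  also have "\<dots> = k1 * (?D * ?D') * GL_inv n k1"
    using GL_inv[OF K_GL[OF k(2)]] c diag_carrier by (simp add: left_mult_one_mat[of _ n n] mat_assoc[where n = n])
  also have "\<dots> = \<pi> \<cdot>\<^sub>m (k1 * GL_inv n k1)"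
    unfolding dd using c by (simp add: mult_smult_distrib[of _ n n _ n] mult_smult_assoc_mat[of _ n n _ n])
  also have "\<dots> = diag n (\<lambda>_. \<pi>)"
    unfolding GL_inv(3)[OF K_GL[OF k(1)]] by (rule eq_matI) (auto simp: diag_def)
  finally show "\<exists>E\<in>int_mat n. h * E = diag n (\<lambda>_. \<pi>)" using E by blast
qed

text \<open>The reduction at x of the lattice generated by the columns of \<open>h\<close>.\<close>

definition reduction_space :: "nat \<Rightarrow> 'r mat \<Rightarrow> (nat \<Rightarrow> 'k) set" where
  "reduction_space n h = {\<lambda>i\<in>{..<n}. \<rho> (\<Sum>l<n. h $$ (i, l) * z l) | z. \<forall>l. z l \<in> \<O>}"

lemma reduction_space_subspace:
  assumes h: "h \<in> int_mat n"
  shows "VectorSpace.subspace \<kappa> (reduction_space n h) (coord_space n)"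
  unfolding subspace_iff
proof (intro conjI ballI subsetI)
  have hO: "h $$ (i, l) \<in> \<O>" if "i < n" "l < n" for i l using h that by (simp add: int_mat_def)
  have sO: "(\<Sum>l<n. h $$ (i, l) * z l) \<in> \<O>" if "\<forall>l. z l \<in> \<O>" "i < n" for z i
    using that hO by (intro O_sum O_mult) auto
  fix u assume u: "u \<in> reduction_space n h"
  then obtain z where z: "\<forall>l. z l \<in> \<O>" "u = (\<lambda>i\<in>{..<n}. \<rho> (\<Sum>l<n. h $$ (i, l) * z l))"
    unfolding reduction_space_def by blast
  show "u \<in> {..<n} \<rightarrow>\<^sub>E carrier \<kappa>" using z sO \<rho>_closed by auto
  {
    fix u' assume "u' \<in> reduction_space n h"
    then obtain z' where z': "\<forall>l. z' l \<in> \<O>" "u' = (\<lambda>i\<in>{..<n}. \<rho> (\<Sum>l<n. h $$ (i, l) * z' l))"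
      unfolding reduction_space_def by blast
    have "(\<lambda>i\<in>{..<n}. u i \<oplus> u' i) = (\<lambda>i\<in>{..<n}. \<rho> (\<Sum>l<n. h $$ (i, l) * (z l + z' l)))"
      using sO[OF z(1)] sO[OF z'(1)]
      by (intro restrict_ext) (simp add: z(2) z'(2) distrib_left sum.distrib \<rho>_add)
    then show "(\<lambda>i\<in>{..<n}. u i \<oplus> u' i) \<in> reduction_space n h"
      unfolding reduction_space_def using z(1) z'(1) O_add by (intro CollectI exI[of _ "\<lambda>l. z l + z' l"]) auto
  }
  fix c assume c: "c \<in> carrier \<kappa>"
  have "(\<lambda>i\<in>{..<n}. c \<otimes> u i) = (\<lambda>i\<in>{..<n}. \<rho> (\<Sum>l<n. h $$ (i, l) * (\<sigma> c * z l)))"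
  proof (intro restrict_ext)
    fix i assume "i \<in> {..<n}"
    then have i: "i < n" by simp
    have "(\<Sum>l<n. h $$ (i, l) * (\<sigma> c * z l)) = \<sigma> c * (\<Sum>l<n. h $$ (i, l) * z l)"
      unfolding sum_distrib_left by (rule sum.cong) (auto simp: mult.left_commute)
    then show "c \<otimes> u i = \<rho> (\<Sum>l<n. h $$ (i, l) * (\<sigma> c * z l))"
      using sO[OF z(1) i] i c by (simp add: z(2) \<rho>_mult \<sigma>_O \<rho>_\<sigma>)
  qed
  then show "(\<lambda>i\<in>{..<n}. c \<otimes> u i) \<in> reduction_space n h"
    unfolding reduction_space_def using z(1) O_mult \<sigma>_O[OF c] by (intro CollectI exI[of _ "\<lambda>l. \<sigma> c * z l"]) auto
next
  show "(\<lambda>i\<in>{..<n}. \<zero>) \<in> reduction_space n h"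
    unfolding reduction_space_def by (intro CollectI exI[of _ "\<lambda>_. 0"]) (auto simp: \<rho>_zero O_zero)
qed

section \<open>The lattice of a reduced matrix\<close>

context
  fixes n :: nat and w :: "(nat \<Rightarrow> 'k) set" and \<Lambda> :: "nat set" and b :: "nat \<Rightarrow> nat \<Rightarrow> 'k"
  assumes w: "VectorSpace.subspace \<kappa> w (coord_space n)" and rb: "is_reduced_basis n \<kappa> w \<Lambda> b"
begin

lemmas rbD = reduced_basisD[OF w rb]

lemma fin_\<Lambda>: "finite \<Lambda>" using rbD(1) finite_subset by blast

lemma b_closed: "j \<in> \<Lambda> \<Longrightarrow> i < n \<Longrightarrow> b j i \<in> carrier \<kappa>"
  using subspace_closed(3)[OF w rbD(2)] .

lemma reduced_mat_basis_GL: "reduced_mat n \<Lambda> b \<in> GL n"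
  by (rule reduced_mat_GL) (use b_closed rbD(4) in auto)

lemma reduced_mat_entry_O: "i < n \<Longrightarrow> j < n \<Longrightarrow> reduced_mat n \<Lambda> b $$ (i, j) \<in> \<O>"
  using b_closed \<sigma>_O by (auto simp: reduced_mat_def O_one O_zero \<pi>_O)

lemma \<rho>_reduced_mat:
  assumes "i < n" "j < n"
  shows "\<rho> (reduced_mat n \<Lambda> b $$ (i, j)) = (if j \<in> \<Lambda> then b j i else \<zero>)"
  using assms rbD(3,4)[of j] b_closed[of j i] \<rho>_\<sigma>
  by (auto simp: reduced_mat_def \<rho>_one \<rho>_zero \<rho>_\<pi>)

lemma reduction_space_reduced_mat:
  assumes z: "\<And>l. l < n \<Longrightarrow> z l \<in> \<O>"
  shows "(\<lambda>i\<in>{..<n}. \<rho> (\<Sum>l<n. reduced_mat n \<Lambda> b $$ (i, l) * z l)) \<in> w"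
proof -
  let ?f = "\<lambda>l. \<lambda>i\<in>{..<n}. \<rho> (z l) \<otimes> b l i"
  have zL: "\<rho> (z l) \<in> carrier \<kappa>" if "l < n" for l using z[OF that] \<rho>_closed by blast
  have f: "?f \<in> \<Lambda> \<rightarrow> w"
    using subspace_closed(2)[OF w zL rbD(2)] rbD(1) by auto
  define y where "y = finsum ((coord_space n)\<lparr>carrier := w\<rparr>) ?f \<Lambda>"
  have yw: "y \<in> w"
    using vectorspace.axioms(1)[OF W_vectorspace[OF w]] f
    unfolding y_def by (intro abelian_monoid.finsum_closed[where G = "(coord_space n)\<lparr>carrier := w\<rparr>", simplified])
      (auto simp: module_def abelian_group_def)
  have "\<rho> (\<Sum>l<n. reduced_mat n \<Lambda> b $$ (i, l) * z l) = y i" if i: "i < n" for i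
  proof -
    have "\<rho> (\<Sum>l<n. reduced_mat n \<Lambda> b $$ (i, l) * z l) =
        (\<Oplus>l\<in>{..<n}. \<rho> (reduced_mat n \<Lambda> b $$ (i, l) * z l))"
      by (rule \<rho>_sum) (use i z reduced_mat_entry_O in \<open>auto intro: O_mult\<close>)
    also have "\<dots> = (\<Oplus>l\<in>{..<n}. if l \<in> \<Lambda> then \<rho> (z l) \<otimes> b l i else \<zero>)"
      by (rule finsum_cong')
        (use i z zL b_closed reduced_mat_entry_O in \<open>auto simp: \<rho>_mult \<rho>_reduced_mat m_comm\<close>)
    also have "\<dots> = (\<Oplus>l\<in>\<Lambda>. if l \<in> \<Lambda> then \<rho> (z l) \<otimes> b l i else \<zero>)"
      by (rule add.finprod_mono_neutral_cong_left[symmetric]) (use rbD(1) i zL b_closed in auto)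
    also have "\<dots> = (\<Oplus>l\<in>\<Lambda>. ?f l i)"
      by (rule finsum_cong') (use rbD(1) i zL b_closed in auto)
    also have "\<dots> = y i" unfolding y_def by (rule finsum_W(1)[OF w fin_\<Lambda> f i, symmetric])
    finally show ?thesis .
  qed
  then have "(\<lambda>i\<in>{..<n}. \<rho> (\<Sum>l<n. reduced_mat n \<Lambda> b $$ (i, l) * z l)) = y"
    by (intro extensionalityI[of _ "{..<n}"]) (use subspace_closed(4)[OF w yw] in auto)
  then show ?thesis using yw by simp
qed

text \<open>Every integral vector reducing into \<open>w\<close> lies in the lattice of the reduced
  matrix. The rows in \<open>\<Lambda>\<close> force \<open>m i\<close> to be \<open>c i\<close>. In
  any other row \<open>\<pi> * m i\<close> must be \<open>c i\<close> minus the contribution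
  \<open>S i\<close> of the columns in \<open>\<Lambda>\<close>; this difference is divisible by
  \<open>\<pi>\<close> because the reduction of \<open>c\<close> satisfies the expansion in the
  reduced basis.\<close>

lemma reduced_mat_solve:
  assumes c: "\<And>i. i < n \<Longrightarrow> c i \<in> \<O>" and cw: "(\<lambda>i\<in>{..<n}. \<rho> (c i)) \<in> w"
  shows "\<exists>m. (\<forall>i. m i \<in> \<O>) \<and> (\<forall>i<n. (\<Sum>l<n. reduced_mat n \<Lambda> b $$ (i, l) * m l) = c i)"
proof -
  define S where "S i = (\<Sum>l\<in>\<Lambda>. if i < l then \<sigma> (b l i) * c l else 0)" for i
  have SO: "S i \<in> \<O>" if "i < n" for i
    unfolding S_def using that c b_closed rbD(1) \<sigma>_O by (intro O_sum) (auto intro!: O_mult simp: O_zero)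
  have \<rho>S: "\<rho> (S i) = \<rho> (c i)" if i: "i < n" "i \<notin> \<Lambda>" for i
  proof -
    have "\<rho> (S i) = (\<Oplus>l\<in>\<Lambda>. \<rho> (if i < l then \<sigma> (b l i) * c l else 0))"
      unfolding S_def using fin_\<Lambda> i c b_closed rbD(1) \<sigma>_O by (intro \<rho>_sum) (auto intro!: O_mult simp: O_zero)
    also have "\<dots> = (\<Oplus>l\<in>\<Lambda>. \<rho> (c l) \<otimes> b l i)"
    proof (rule finsum_cong')
      fix l assume l: "l \<in> \<Lambda>"
      then have ln: "l < n" using rbD(1) by auto
      show "\<rho> (if i < l then \<sigma> (b l i) * c l else 0) = \<rho> (c l) \<otimes> b l i"
      proof (cases "i < l")
        case True
        then show ?thesis
          using l ln i c[OF ln] b_closed[OF l i(1)] \<rho>_closed[OF c[OF ln]] by (simp add: \<rho>_mult \<sigma>_O \<rho>_\<sigma> m_comm)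
      next
        case False
        then have "b l i = \<zero>" using rbD(4)[OF l i(1)] i l by (metis linorder_neqE_nat)
        then show ?thesis using False \<rho>_closed[OF c[OF ln]] by (simp add: \<rho>_zero)
      qed
    qed (use c \<rho>_closed b_closed i rbD(1) in auto)
    also have "\<dots> = (\<Oplus>l\<in>\<Lambda>. (\<lambda>i\<in>{..<n}. \<rho> (c i)) l \<otimes> b l i)"
      by (rule finsum_cong') (use c \<rho>_closed b_closed i rbD(1) in auto)
    also have "\<dots> = \<rho> (c i)" using rbD(5)[OF cw i(1)] i(1) by simp
    finally show ?thesis .
  qed
  define m where "m i = (if i < n then if i \<in> \<Lambda> then c i else (c i - S i) * \<pi>' else 0)" for i
  have "m i \<in> \<O>" for i
  proof (cases "i < n \<and> i \<notin> \<Lambda>")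
    case True
    then have "\<rho> (c i - S i) = \<zero>"
      using \<rho>S[of i] c[of i] SO[of i] \<rho>_closed[of "c i"] by (simp add: \<rho>_diff a_minus_def r_neg)
    then show ?thesis using True c SO by (auto simp: m_def intro!: \<rho>_kernel O_diff)
  qed (auto simp: m_def c O_zero)
  moreover have "(\<Sum>l<n. reduced_mat n \<Lambda> b $$ (i, l) * m l) = c i" if i: "i < n" for i
  proof -
    have "(\<Sum>l<n. reduced_mat n \<Lambda> b $$ (i, l) * m l) =
        (\<Sum>l<n. (if l = i then (if i \<in> \<Lambda> then m i else \<pi> * m i) else 0) +
          (if l \<in> \<Lambda> then (if i < l then \<sigma> (b l i) * c l else 0) else 0))"
      by (rule sum.cong) (use i in \<open>auto simp: reduced_mat_def m_def\<close>)
    also have "\<dots> = (if i \<in> \<Lambda> then m i else \<pi> * m i) + S i"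
    proof -
      have "(\<Sum>l<n. if l \<in> \<Lambda> then (if i < l then \<sigma> (b l i) * c l else 0) else 0) = S i"
        unfolding S_def using rbD(1) by (intro sum.mono_neutral_cong_right) auto
      then show ?thesis using i by (simp add: sum.distrib)
    qed
    also have "\<dots> = c i"
    proof (cases "i \<in> \<Lambda>")
      case True
      have "S i = 0" unfolding S_def
      proof (rule sum.neutral, intro ballI)
        fix l assume "l \<in> \<Lambda>"
        then show "(if i < l then \<sigma> (b l i) * c l else 0) = 0" using rbD(4)[of l i] True i by (auto simp: \<sigma>_zero)
      qed
      then show ?thesis using True i by (simp add: m_def)
    next
      case False
      then have "\<pi> * m i = (\<pi> * \<pi>') * (c i - S i)" using i by (simp add: m_def mult.commute mult.left_commute)
      then show ?thesis using False by (simp add: \<pi>_inv)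
    qed
    finally show ?thesis .
  qed
  ultimately show ?thesis by blast
qed

end

text \<open>The counterpart for \<open>h\<close>: the vector \<open>c\<close> differs from a lattice
  vector \<open>h z\<close> by \<open>\<pi>\<close> times an integral vector \<open>y\<close>, and
  \<open>\<pi> y\<close> is \<open>h E y\<close>, again in the lattice. So \<open>z + E y\<close>
  solves the system.\<close>

lemma reduction_space_solve:
  assumes h: "h \<in> Hecke_coset n r" and c: "\<And>i. i < n \<Longrightarrow> c i \<in> \<O>"
    and cw: "(\<lambda>i\<in>{..<n}. \<rho> (c i)) \<in> reduction_space n h"
  shows "\<exists>m. (\<forall>i. m i \<in> \<O>) \<and> (\<forall>i<n. (\<Sum>l<n. h $$ (i, l) * m l) = c i)"
proof -
  have hi: "h \<in> int_mat n" by (rule Hecke_coset_integral(1)[OF h])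
  obtain E where E: "E \<in> int_mat n" "h * E = diag n (\<lambda>_. \<pi>)" using Hecke_coset_integral(2)[OF h] by blast
  obtain z where z: "\<forall>l. z l \<in> \<O>" "(\<lambda>i\<in>{..<n}. \<rho> (c i)) = (\<lambda>i\<in>{..<n}. \<rho> (\<Sum>l<n. h $$ (i, l) * z l))"
    using cw unfolding reduction_space_def by blast
  define y where "y i = (c i - (\<Sum>l<n. h $$ (i, l) * z l)) * \<pi>'" for i
  have yO: "y i \<in> \<O>" if i: "i < n" for i
  proof -
    have s: "(\<Sum>l<n. h $$ (i, l) * z l) \<in> \<O>" using z(1) hi i by (intro O_sum O_mult) (auto simp: int_mat_def)
    have "\<rho> (c i) = \<rho> (\<Sum>l<n. h $$ (i, l) * z l)" using fun_cong[OF z(2), of i] i by simp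
    then have "\<rho> (c i - (\<Sum>l<n. h $$ (i, l) * z l)) = \<zero>"
      using s c[OF i] \<rho>_closed[OF s] by (simp add: \<rho>_diff a_minus_def r_neg)
    then show ?thesis unfolding y_def by (rule \<rho>_kernel[rotated]) (intro O_diff s c i)
  qed
  define m where "m l = (if l < n then z l + (\<Sum>j<n. E $$ (l, j) * y j) else 0)" for l
  have "m l \<in> \<O>" for l
    using z(1) E(1) yO by (auto simp: m_def int_mat_def O_zero intro!: O_add O_sum O_mult)
  moreover have "(\<Sum>l<n. h $$ (i, l) * m l) = c i" if i: "i < n" for i
  proof -
    have "(\<Sum>l<n. h $$ (i, l) * m l) =
        (\<Sum>l<n. h $$ (i, l) * z l) + (\<Sum>l<n. \<Sum>j<n. h $$ (i, l) * E $$ (l, j) * y j)"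
      by (simp add: m_def distrib_left sum.distrib sum_distrib_left mult.assoc)
    also have "(\<Sum>l<n. \<Sum>j<n. h $$ (i, l) * E $$ (l, j) * y j) = (\<Sum>j<n. (h * E) $$ (i, j) * y j)"
      using hi E(1) i by (subst sum.swap) (auto simp: int_mat_def mat_mult_entry[of _ n] sum_distrib_right
          simp del: index_mult_mat(1) intro!: sum.cong)
    also have "\<dots> = (\<Sum>j<n. if j = i then \<pi> * y i else 0)"
      unfolding E(2) by (rule sum.cong) (use i in \<open>auto simp: diag_def\<close>)
    also have "\<dots> = (\<pi> * \<pi>') * (c i - (\<Sum>l<n. h $$ (i, l) * z l))"
      using i by (simp add: y_def mult.commute mult.left_commute)
    finally show ?thesis by (simp add: \<pi>_inv)
  qed
  ultimately show ?thesis by blast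
qed

section \<open>Comparison of lattices\<close>

lemma mat_of_columns:
  assumes A: "A \<in> carrier_mat n n" and B: "B \<in> carrier_mat n n"
    and m: "\<And>j. j < n \<Longrightarrow> \<exists>m. (\<forall>i. m i \<in> \<O>) \<and> (\<forall>i<n. (\<Sum>l<n. A $$ (i, l) * m l) = B $$ (i, j))"
  shows "\<exists>M\<in>int_mat n. A * M = B"
proof -
  have "\<forall>j. \<exists>m. j < n \<longrightarrow> (\<forall>i. m i \<in> \<O>) \<and> (\<forall>i<n. (\<Sum>l<n. A $$ (i, l) * m l) = B $$ (i, j))"
    using m by blast
  then obtain m where m: "\<And>j i. j < n \<Longrightarrow> m j i \<in> \<O>"
    "\<And>j i. j < n \<Longrightarrow> i < n \<Longrightarrow> (\<Sum>l<n. A $$ (i, l) * m j l) = B $$ (i, j)" by metis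
  define M where "M = mat n n (\<lambda>(i, j). m j i)"
  have M: "M \<in> int_mat n" using m(1) by (auto simp: int_mat_def M_def)
  then have "A * M = B"
    using A B m(2) by (intro eq_matI) (auto simp: int_mat_def mat_mult_entry[of _ n] M_def simp del: index_mult_mat(1))
  then show ?thesis using M by blast
qed

text \<open>With \<open>w\<close> the reduction of the lattice of \<open>h\<close>, each of
  \<open>h\<close> and the reduced matrix of \<open>w\<close> is the other one times an integral
  matrix, by solving for one column at a time. Cancellation shows that the two integral factors are
  mutually inverse, so the quotient is an integral unit.\<close>

theorem Hecke_coset_cover:
  assumes h: "h \<in> Hecke_coset n r" and r: "r \<le> n"
  obtains w \<Lambda> b k where "w \<in> Gr (n - r) n \<kappa>" "is_reduced_basis n \<kappa> w \<Lambda> b" "k \<in> K n"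
    "h = reduced_mat n \<Lambda> b * k"
proof -
  have hi: "h \<in> int_mat n" by (rule Hecke_coset_integral(1)[OF h])
  have hc: "h \<in> carrier_mat n n" using hi by (simp add: int_mat_def)
  define w where "w = reduction_space n h"
  have w: "VectorSpace.subspace \<kappa> w (coord_space n)" unfolding w_def by (rule reduction_space_subspace[OF hi])
  obtain \<Lambda> b where rb: "is_reduced_basis n \<kappa> w \<Lambda> b" by (rule the_reduced_basis[OF w])
  let ?\<xi> = "reduced_mat n \<Lambda> b"
  have \<xi>GL: "?\<xi> \<in> GL n" by (rule reduced_mat_basis_GL[OF w rb])
  note \<xi>c = GL_carrier[OF \<xi>GL]
  have "\<exists>M\<in>int_mat n. ?\<xi> * M = h"
  proof (rule mat_of_columns[OF \<xi>c hc], rule reduced_mat_solve[OF w rb])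
    fix j assume j: "j < n"
    show "h $$ (i, j) \<in> \<O>" if "i < n" for i using hi j that by (simp add: int_mat_def)
    \<comment> \<open>Column \<open>j\<close> is the image of the \<open>j\<close>-th unit vector,
      hence a lattice vector.\<close>
    have "(\<lambda>i\<in>{..<n}. \<rho> (h $$ (i, j))) = (\<lambda>i\<in>{..<n}. \<rho> (\<Sum>l<n. h $$ (i, l) * (if l = j then 1 else 0)))"
      using j by (intro restrict_ext) (simp add: if_distrib cong: if_cong)
    then show "(\<lambda>i\<in>{..<n}. \<rho> (h $$ (i, j))) \<in> w"
      unfolding w_def reduction_space_def
      by (intro CollectI exI[of _ "\<lambda>l. if l = j then 1 else 0"]) (auto simp: O_one O_zero)
  qed
  then obtain M where M: "M \<in> int_mat n" "?\<xi> * M = h" by blast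
  have "\<exists>M\<in>int_mat n. h * M = ?\<xi>"
  proof (rule mat_of_columns[OF hc \<xi>c], rule reduction_space_solve[OF h])
    fix j assume j: "j < n"
    show "?\<xi> $$ (i, j) \<in> \<O>" if "i < n" for i by (rule reduced_mat_entry_O[OF w rb that j])
    have "(\<lambda>i\<in>{..<n}. \<rho> (?\<xi> $$ (i, j))) = (\<lambda>i\<in>{..<n}. \<rho> (\<Sum>l<n. ?\<xi> $$ (i, l) * (if l = j then 1 else 0)))"
      using j by (intro restrict_ext) (simp add: if_distrib cong: if_cong)
    also have "\<dots> \<in> w" by (rule reduction_space_reduced_mat[OF w rb]) (auto simp: O_one O_zero)
    finally show "(\<lambda>i\<in>{..<n}. \<rho> (?\<xi> $$ (i, j))) \<in> reduction_space n h" by (simp add: w_def)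
  qed
  then obtain M' where M': "M' \<in> int_mat n" "h * M' = ?\<xi>" by blast
  note c = M(1)[unfolded int_mat_def] M'(1)[unfolded int_mat_def]
  have "h * (M' * M) = h * 1\<^sub>m n"
    using c hc M(2) M'(2) by (simp flip: assoc_mult_mat[of _ n n _ n _ n])
  then have 1: "M' * M = 1\<^sub>m n" using GL_left_cancel[OF Hecke_coset_GL[OF h]] c by auto
  have "?\<xi> * (M * M') = ?\<xi> * 1\<^sub>m n"
    using c \<xi>c M(2) M'(2) by (simp flip: assoc_mult_mat[of _ n n _ n _ n])
  then have 2: "M * M' = 1\<^sub>m n" using GL_left_cancel[OF \<xi>GL] c by auto
  have MK: "M \<in> K n" by (rule K_I[OF M(1) M'(1) 2 1])
  have \<Lambda>n: "\<Lambda> \<subseteq> {..<n}" by (rule reduced_basisD(1)[OF w rb])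
  \<comment> \<open>Up to integral units, \<open>det h\<close> is \<open>\<pi> ^ r\<close> by the
    double coset and \<open>\<pi> ^ (n - card \<Lambda>)\<close> by the reduced matrix.\<close>
  have "card \<Lambda> = n - r"
  proof -
    have du: "det (diag n (uniformizer_at J)) = \<pi> ^ card (J \<inter> {..<n})" for J
      unfolding det_diag uniformizer_at_def by (simp add: prod.If_cases Int_commute)
    obtain k1 k2 where k: "k1 \<in> K n" "k2 \<in> K n" and hk: "h = k1 * diag n (uniformizer_at {..<r}) * k2"
      using h unfolding Hecke_coset_def by blast
    obtain u where u: "u \<in> K n" "?\<xi> = u * diag n (uniformizer_at (- \<Lambda>))"
      using reduced_mat_decomposition[of \<Lambda> n b] b_closed[OF w rb] reduced_basisD(4)[OF w rb] by metis
    have unit: "det A * det B \<in> \<O> \<and> (\<exists>b\<in>\<O>. det A * det B * b = 1)" if "A \<in> K n" "B \<in> K n" for A B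
    proof -
      from that obtain a b where "a \<in> \<O>" "det A * a = 1" "b \<in> \<O>" "det B * b = 1" using det_K by meson
      then show ?thesis using det_K(1)[OF that(1)] det_K(1)[OF that(2)]
        by (intro conjI O_mult bexI[of _ "a * b"]) (auto simp: mult.assoc mult.left_commute[of "det B"])
    qed
    have "det h = \<pi> ^ card ({..<r} \<inter> {..<n}) * (det k1 * det k2)"
      unfolding hk using K_carrier[OF k(1)] K_carrier[OF k(2)] diag_carrier[of n]
      by (simp add: det_mult[of _ n] du mult.commute mult.left_commute)
    moreover have "det h = \<pi> ^ card (- \<Lambda> \<inter> {..<n}) * (det u * det M)"
      unfolding M(2)[symmetric] u(2) using K_carrier[OF u(1)] K_carrier[OF MK] diag_carrier[of n]
      by (simp add: det_mult[of _ n] du mult.commute mult.left_commute)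
    ultimately have "card ({..<r} \<inter> {..<n}) = card (- \<Lambda> \<inter> {..<n})"
      using uniformizer_power_unit_eq unit[OF k] unit[OF u(1) MK] by metis
    moreover have "{..<r} \<inter> {..<n} = {..<r}" using r by auto
    moreover have "- \<Lambda> \<inter> {..<n} = {..<n} - \<Lambda>" by auto
    moreover have "card ({..<n} - \<Lambda>) = n - card \<Lambda>"
      using card_Diff_subset[OF finite_subset[OF \<Lambda>n] \<Lambda>n] by simp
    moreover have "card \<Lambda> \<le> n" using card_mono[OF _ \<Lambda>n] by simp
    ultimately show ?thesis by simp
  qed
  then have "w \<in> Gr (n - r) n \<kappa>" using w reduced_basisD(6)[OF w rb] by (simp add: Gr_def)
  then show ?thesis using that rb MK M(2) by blast
qed

text \<open>The vector \<open>b' j\<close> is the reduction of column \<open>j\<close> of the second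
  matrix, which is an integral combination of columns of the first and so reduces into
  \<open>w\<close>. The inverse of \<open>k\<close> gives the other inclusion.\<close>

theorem reduced_mat_inj:
  assumes w: "VectorSpace.subspace \<kappa> w (coord_space n)" "is_reduced_basis n \<kappa> w \<Lambda> b"
    and w': "VectorSpace.subspace \<kappa> w' (coord_space n)" "is_reduced_basis n \<kappa> w' \<Lambda>' b'"
    and k: "k \<in> K n" and eq: "reduced_mat n \<Lambda>' b' = reduced_mat n \<Lambda> b * k"
  shows "w' = w"
proof -
  have main: "w' \<subseteq> w"
    if w: "VectorSpace.subspace \<kappa> w (coord_space n)" "is_reduced_basis n \<kappa> w \<Lambda> b"
      and w': "VectorSpace.subspace \<kappa> w' (coord_space n)" "is_reduced_basis n \<kappa> w' \<Lambda>' b'"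
      and k: "k \<in> K n" and eq: "reduced_mat n \<Lambda>' b' = reduced_mat n \<Lambda> b * k" for w \<Lambda> b w' \<Lambda>' b' k
  proof (rule subspace_subset_if_reduced[OF w'(1) w(1) w'(2)])
    fix j assume j: "j \<in> \<Lambda>'"
    then have jn: "j < n" using reduced_basisD(1)[OF w'] by auto
    have bc: "b' j \<in> extensional {..<n}" using subspace_closed(4)[OF w'(1)] reduced_basisD(2)[OF w'] j by blast
    have "b' j = (\<lambda>i\<in>{..<n}. \<rho> (reduced_mat n \<Lambda>' b' $$ (i, j)))"
      by (intro extensionalityI[OF bc]) (use \<rho>_reduced_mat[OF w' _ jn] j in auto)
    also have "\<dots> = (\<lambda>i\<in>{..<n}. \<rho> (\<Sum>l<n. reduced_mat n \<Lambda> b $$ (i, l) * k $$ (l, j)))"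
      unfolding eq using GL_carrier[OF reduced_mat_basis_GL[OF w]] K_carrier[OF k] jn
      by (intro restrict_ext) (simp add: mat_mult_entry[of _ n] del: index_mult_mat(1))
    also have "\<dots> \<in> w"
      by (rule reduction_space_reduced_mat[OF w]) (use k jn in \<open>auto simp: K_def int_mat_def\<close>)
    finally show "b' j \<in> w" .
  qed
  have "reduced_mat n \<Lambda>' b' * GL_inv n k = reduced_mat n \<Lambda> b * (k * GL_inv n k)"
    unfolding eq using GL_carrier[OF reduced_mat_basis_GL[OF w]] K_carrier[OF k] K_carrier[OF K_inv[OF k]]
    by (simp add: mat_assoc[where n = n])
  also have "\<dots> = reduced_mat n \<Lambda> b"
    using GL_inv(3)[OF K_GL[OF k]] GL_carrier[OF reduced_mat_basis_GL[OF w]] by simp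
  finally show ?thesis using main[OF w w' k eq] main[OF w' w K_inv[OF k]] by auto
qed

end

section \<open>Adeles\<close>

lemma adele_eqI: "(\<And>x. local_component a x = local_component b x) \<Longrightarrow> a = b"
  by (simp add: local_component_inject[symmetric] ext)

lemma local_component_carrier: "local_component a x \<in> carrier (completion_ring (val x))"
  using local_component[of a] by blast

lemma local_component_simps:
  "local_component (a + b) x = local_component a x \<oplus>\<^bsub>completion_ring (val x)\<^esub> local_component b x"
  "local_component (a * b) x = local_component a x \<otimes>\<^bsub>completion_ring (val x)\<^esub> local_component b x"
  "local_component (- a) x = \<ominus>\<^bsub>completion_ring (val x)\<^esub> local_component a x"
  "local_component 1 x = \<one>\<^bsub>completion_ring (val x)\<^esub>" "local_component 0 x = \<zero>\<^bsub>completion_ring (val x)\<^esub>"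
  by (simp_all add: plus_adele.rep_eq times_adele.rep_eq uminus_adele.rep_eq one_adele.rep_eq zero_adele.rep_eq)

lemma local_component_adele_at:
  assumes "\<alpha> \<in> carrier (completion_ring (val x))"
  shows "local_component (adele_at x \<alpha>) y = (if y = x then \<alpha> else \<zero>\<^bsub>completion_ring (val y)\<^esub>)"
proof -
  have "finite {y. (if y = x then \<alpha> else \<zero>\<^bsub>completion_ring (val y)\<^esub>) \<notin> ideal_power (val y) 0}"
    by (rule finite_subset[of _ "{x}"]) (auto simp: ideal_power_zero[OF is_valuation_val])
  then show ?thesis unfolding adele_at_def
    by (subst Abs_adele_inverse) (auto simp: assms cring.cring_simprules(2)[OF completion_val_cring])
qed

lemma local_component_idele_at:
  assumes "\<alpha> \<in> carrier (completion_ring (val x))"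
  shows "local_component (idele_at x \<alpha>) y = (if y = x then \<alpha> else \<one>\<^bsub>completion_ring (val y)\<^esub>)"
proof -
  have "finite {y. (if y = x then \<alpha> else \<one>\<^bsub>completion_ring (val y)\<^esub>) \<notin> ideal_power (val y) 0}"
    by (rule finite_subset[of _ "{x}"]) (auto simp: ideal_power_one[OF is_valuation_val])
  then show ?thesis unfolding idele_at_def
    by (subst Abs_adele_inverse) (auto simp: assms cring.cring_simprules(6)[OF completion_val_cring])
qed

lemma to_completion_ops:
  assumes v: "is_valuation v"
  shows "to_completion v a \<in> carrier (completion_ring v)"
    "to_completion v a \<oplus>\<^bsub>completion_ring v\<^esub> to_completion v b = to_completion v (a + b)"
    "to_completion v a \<otimes>\<^bsub>completion_ring v\<^esub> to_completion v b = to_completion v (a * b)"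
    "\<one>\<^bsub>completion_ring v\<^esub> = to_completion v 1" "\<zero>\<^bsub>completion_ring v\<^esub> = to_completion v 0"
  by (simp_all add: to_completion_seq_class[OF v] seq_class_closed[OF v] seq_class_ops[OF v] cauchy_const[OF v]
      seq_class_one[OF v] seq_class_zero[OF v])

lemma place_residue_valuation: "\<exists>T. residue_valuation (val x) T"
proof -
  obtain T where "finite T" "\<forall>a. val_ge (val x) 0 a \<longrightarrow> (\<exists>b\<in>T. val_ge (val x) 1 (a - b))"
    using function_field_finite_residues[OF function_field is_valuation_val, of x] by blast
  then have "residue_valuation (val x) T"
    using is_valuation_val function_field_prime_CHAR[OF function_field] by unfold_locales auto
  then show ?thesis by blast
qed

definition reduction_at :: "'a::function_field place \<Rightarrow> 'a adele \<Rightarrow> (nat \<Rightarrow> 'a) set" where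
  "reduction_at x a = residue_valuation.residue (val x) (local_component a x)"

text \<open>The uniformizer idele is 1 away from x, so dividing by it preserves integrality there,
  and at x the vanishing residue supplies the missing factor.\<close>

lemma residue_data_place:
  fixes x :: "'a::function_field place"
  assumes \<pi>: "val x \<pi> = 1"
  shows "residue_data (coefficient_field (val x)) integral_adeles (idele_at x (to_completion (val x) \<pi>))
    (idele_at x (to_completion (val x) (inverse \<pi>))) (reduction_at x) (adele_at x)"
proof -
  obtain T where "residue_valuation (val x) T" using place_residue_valuation by blast
  then interpret R: residue_valuation "val x" T .
  note v = is_valuation_val[of x]
  note iv = is_valuation_val
  note tc = to_completion_ops[OF v]
  have nz: "\<pi> \<noteq> 0" using \<pi> v by (auto simp: is_valuation_def)
  have kc: "l \<in> carrier (completion_ring (val x))" if "l \<in> carrier R.\<kappa>" for l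
    using ideal_power_carrier[OF v R.coefficient_field_integral[OF that]] .
  have ic: "local_component a x \<in> ideal_power (val x) 0" if "a \<in> integral_adeles" for a
    using that by (simp add: integral_adeles_def)
  have \<pi>1: "to_completion (val x) \<pi> \<in> ideal_power (val x) 1"
    unfolding to_completion_seq_class[OF v]
    by (subst seq_class_ideal_power_iff[OF v cauchy_const[OF v]]) (simp add: val_ge_def \<pi>)
  show ?thesis
  proof (intro residue_data.intro residue_data_axioms.intro R.coefficient_field_field)
    show "(1::'a adele) \<in> integral_adeles"
      by (simp add: integral_adeles_def local_component_simps ideal_power_one[OF iv])
    fix a b :: "'a adele" assume a: "a \<in> integral_adeles"
    show "- a \<in> integral_adeles"
      using a by (simp add: integral_adeles_def local_component_simps ideal_power_a_inv[OF iv])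
    show "reduction_at x a \<in> carrier R.\<kappa>" unfolding reduction_at_def by (rule R.residue(1)[OF ic[OF a]])
    show "a * idele_at x (to_completion (val x) (inverse \<pi>)) \<in> integral_adeles" if "reduction_at x a = \<zero>\<^bsub>R.\<kappa>\<^esub>"
    proof -
      have 1: "local_component a x \<in> ideal_power (val x) 1"
        using that R.residue_eq_zero_iff[OF ic[OF a]] by (simp add: reduction_at_def)
      have "local_component (a * idele_at x (to_completion (val x) (inverse \<pi>))) y \<in> ideal_power (val y) 0" for y
      proof (cases "y = x")
        case True
        then show ?thesis using ideal_power_uniformizer[OF v \<pi> 1]
          by (simp add: local_component_simps local_component_idele_at tc(1))
      next
        case False
        have "local_component a y \<otimes>\<^bsub>completion_ring (val y)\<^esub> \<one>\<^bsub>completion_ring (val y)\<^esub> = local_component a y"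
          by (rule Group.monoid.r_one[OF ring.is_monoid[OF cring.axioms(1)[OF completion_val_cring]] local_component_carrier])
        then show ?thesis using False a
          by (simp add: local_component_simps local_component_idele_at tc(1) integral_adeles_def)
      qed
      then show ?thesis by (simp add: integral_adeles_def)
    qed
    assume b: "b \<in> integral_adeles"
    show "a + b \<in> integral_adeles"
      using a b by (simp add: integral_adeles_def local_component_simps ideal_power_add[OF iv])
    show "a * b \<in> integral_adeles"
      using a b by (simp add: integral_adeles_def local_component_simps ideal_power_mult[OF iv, of _ _ 0 _ 0, simplified])
    show "reduction_at x (a + b) = reduction_at x a \<oplus>\<^bsub>R.\<kappa>\<^esub> reduction_at x b"
      unfolding reduction_at_def local_component_simps by (rule R.residue_add[OF ic[OF a] ic[OF b]])
    show "reduction_at x (a * b) = reduction_at x a \<otimes>\<^bsub>R.\<kappa>\<^esub> reduction_at x b"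
      unfolding reduction_at_def local_component_simps by (rule R.residue_mult[OF ic[OF a] ic[OF b]])
  next
    show *: "idele_at x (to_completion (val x) \<pi>) \<in> integral_adeles"
      using \<pi>1 ideal_power_antimono[OF v, of 0 1] ideal_power_one[OF iv]
      by (auto simp: integral_adeles_def local_component_idele_at tc(1))
    show "idele_at x (to_completion (val x) \<pi>) * idele_at x (to_completion (val x) (inverse \<pi>)) = 1"
    proof (rule adele_eqI)
      fix y :: "'a place"
      have "\<one>\<^bsub>completion_ring (val y)\<^esub> \<otimes>\<^bsub>completion_ring (val y)\<^esub> \<one>\<^bsub>completion_ring (val y)\<^esub> = \<one>\<^bsub>completion_ring (val y)\<^esub>"
        by (intro cring.cring_simprules(12) cring.cring_simprules(6) completion_val_cring)
      then show "local_component (idele_at x (to_completion (val x) \<pi>) * idele_at x (to_completion (val x) (inverse \<pi>))) y =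
          local_component 1 y"
        using nz by (simp add: local_component_simps local_component_idele_at tc)
    qed
    show "reduction_at x 1 = \<one>\<^bsub>R.\<kappa>\<^esub>" by (simp add: reduction_at_def local_component_simps R.residue_one)
    show "reduction_at x (idele_at x (to_completion (val x) \<pi>)) = \<zero>\<^bsub>R.\<kappa>\<^esub>"
      using R.residue_eq_zero_iff[OF ic[OF *]] \<pi>1 by (simp add: reduction_at_def local_component_idele_at tc(1))
    show "adele_at x \<zero>\<^bsub>R.\<kappa>\<^esub> = 0"
      by (rule adele_eqI) (simp add: R.coefficient_field_simps local_component_adele_at local_component_simps)
    fix l assume l: "l \<in> carrier R.\<kappa>"
    show "adele_at x l \<in> integral_adeles"
      using R.coefficient_field_integral[OF l] ideal_power_zero[OF iv]
      by (auto simp: integral_adeles_def local_component_adele_at kc[OF l])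
    show "reduction_at x (adele_at x l) = l"
      by (simp add: reduction_at_def local_component_adele_at kc[OF l] R.residue_coefficient[OF l])
  qed
qed

lemma finite_coefficient_field_place: "finite (carrier (coefficient_field (val x)))"
  using place_residue_valuation residue_valuation.finite_coefficient_field by blast

section \<open>Matrices with entries in the function field\<close>

lemma local_component_sum:
  assumes "\<And>l. l \<in> I \<Longrightarrow> local_component (a l) x = to_completion (val x) (b l)"
  shows "local_component (\<Sum>l\<in>I. a l) x = to_completion (val x) (\<Sum>l\<in>I. b l)"
  using assms
  by (induction I rule: infinite_finite_induct)
    (simp_all add: local_component_simps to_completion_ops[OF is_valuation_val])

text \<open>The condition of \<open>GL_F\<close> at a single place. Stated place by place it also
  applies to adelic matrices that carry rational data at x only.\<close>

definition represents_at :: "nat \<Rightarrow> 'a::function_field place \<Rightarrow> 'a adele mat \<Rightarrow> 'a mat \<Rightarrow> bool" where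
  "represents_at n x g \<gamma> \<longleftrightarrow> (\<forall>i<n. \<forall>j<n. local_component (g $$ (i, j)) x = to_completion (val x) (\<gamma> $$ (i, j)))"

lemma GL_F_iff: "g \<in> GL_F n \<longleftrightarrow> g \<in> GL n \<and> (\<exists>\<gamma>\<in>GL n. \<forall>x. represents_at n x g \<gamma>)"
  unfolding GL_F_def represents_at_def by blast

lemma represents_at_mult:
  assumes "g \<in> carrier_mat n n" "h \<in> carrier_mat n n" "\<gamma> \<in> carrier_mat n n" "\<delta> \<in> carrier_mat n n"
    and "represents_at n x g \<gamma>" "represents_at n x h \<delta>"
  shows "represents_at n x (g * h) (\<gamma> * \<delta>)"
  unfolding represents_at_def
proof (intro allI impI)
  fix i j assume ij: "i < n" "j < n"
  show "local_component ((g * h) $$ (i, j)) x = to_completion (val x) ((\<gamma> * \<delta>) $$ (i, j))"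
    unfolding mat_mult_entry[OF assms(1,2) ij] mat_mult_entry[OF assms(3,4) ij]
    by (rule local_component_sum)
      (use assms(5,6) ij in \<open>simp add: represents_at_def local_component_simps to_completion_ops[OF is_valuation_val]\<close>)
qed

lemma GL_F_one: "1\<^sub>m n \<in> GL_F n"
  unfolding GL_F_iff represents_at_def
  by (intro conjI GL_one bexI[of _ "1\<^sub>m n"])
    (simp_all add: local_component_simps to_completion_ops[OF is_valuation_val])

lemma GL_F_mult: assumes "g \<in> GL_F n" "h \<in> GL_F n" shows "g * h \<in> GL_F n"
proof -
  obtain \<gamma> \<delta> where r: "\<gamma> \<in> GL n" "\<And>x. represents_at n x g \<gamma>" "\<delta> \<in> GL n" "\<And>x. represents_at n x h \<delta>"
    using assms unfolding GL_F_iff by blast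
  have gh: "g \<in> GL n" "h \<in> GL n" using assms by (simp_all add: GL_F_iff)
  have "represents_at n x (g * h) (\<gamma> * \<delta>)" for x
    by (intro represents_at_mult GL_carrier gh r)
  then show ?thesis unfolding GL_F_iff using GL_mult[OF gh] GL_mult[OF r(1,3)] by blast
qed

text \<open>Putting the inverse over \<open>F\<close> at the single place \<open>x\<close> gives an adelic matrix, which reduces the claim
  about components at \<open>x\<close> to an identity of adelic matrices.\<close>

lemma GL_F_inv: assumes "g \<in> GL_F n" shows "GL_inv n g \<in> GL_F n"
proof -
  obtain \<gamma> where g: "g \<in> GL n" and \<gamma>: "\<gamma> \<in> GL n" "\<And>x. represents_at n x g \<gamma>"
    using assms unfolding GL_F_iff by blast
  have "represents_at n x (GL_inv n g) (GL_inv n \<gamma>)" for x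
  proof -
    note v = is_valuation_val[of x]
    interpret C: cring "completion_ring (val x)" by (rule completion_val_cring)
    define A where "A = mat n n (\<lambda>(i, j). adele_at x (to_completion (val x) (GL_inv n \<gamma> $$ (i, j))))"
    have A: "A \<in> carrier_mat n n" by (simp add: A_def)
    note gc = GL_carrier[OF g] GL_carrier[OF GL_inv(1)[OF g]] GL_carrier[OF \<gamma>(1)] GL_carrier[OF GL_inv(1)[OF \<gamma>(1)]]
    have Ax: "represents_at n x A (GL_inv n \<gamma>)"
      by (simp add: represents_at_def A_def local_component_adele_at to_completion_ops[OF v])
    have "represents_at n x (A * g) (GL_inv n \<gamma> * \<gamma>)" by (rule represents_at_mult[OF A gc(1,4,3) Ax \<gamma>(2)])
    then have "represents_at n x (A * g) (1\<^sub>m n)" by (simp add: GL_inv[OF \<gamma>(1)])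
    moreover have "represents_at n x (1\<^sub>m n) (1\<^sub>m n)"
      by (simp add: represents_at_def local_component_simps to_completion_ops[OF v])
    ultimately have Agx: "local_component ((A * g) $$ (i, l)) x = local_component ((1\<^sub>m n) $$ (i, l)) x"
      if "i < n" "l < n" for i l using that by (simp add: represents_at_def del: index_mult_mat(1))
    have "A = A * g * GL_inv n g"
      using GL_inv[OF g] A gc by (simp add: mat_assoc[where n = n])
    then have "local_component (A $$ (i, j)) x = local_component (GL_inv n g $$ (i, j)) x" if ij: "i < n" "j < n" for i j
    proof -
      have sum_cong: "local_component (\<Sum>l\<in>I. a l) x = local_component (\<Sum>l\<in>I. b l) x"
        if "\<And>l. l \<in> I \<Longrightarrow> local_component (a l) x = local_component (b l) x" for I and a b :: "nat \<Rightarrow> 'a adele"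
        using that by (induction I rule: infinite_finite_induct) (simp_all add: local_component_simps)
      have "local_component ((A * g * GL_inv n g) $$ (i, j)) x =
          local_component (\<Sum>l<n. (A * g) $$ (i, l) * GL_inv n g $$ (l, j)) x"
        by (subst mat_mult_entry[OF mult_carrier_mat[OF A gc(1)] gc(2) ij]) simp
      also have "\<dots> = local_component (\<Sum>l<n. (1\<^sub>m n) $$ (i, l) * GL_inv n g $$ (l, j)) x"
        by (rule sum_cong) (use Agx ij in \<open>simp add: local_component_simps del: index_mult_mat(1) index_one_mat(1)\<close>)
      also have "\<dots> = local_component ((1\<^sub>m n * GL_inv n g) $$ (i, j)) x"
        using gc ij by (subst mat_mult_entry[of _ n]) auto
      finally show ?thesis using \<open>A = A * g * GL_inv n g\<close> gc by simp
    qed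
    then show ?thesis using Ax by (simp add: represents_at_def)
  qed
  then show ?thesis using GL_inv(1)[OF g] GL_inv(1)[OF \<gamma>(1)] unfolding GL_F_iff by blast
qed

section \<open>The action of the Hecke operator\<close>

lemma GL_O_eq_K:
  assumes "residue_data \<kappa> (integral_adeles :: 'a::function_field adele set) \<pi> \<pi>' \<rho> \<sigma>"
  shows "GL_O n = residue_data.K (integral_adeles :: 'a adele set) n"
  unfolding GL_O_def residue_data.K_def[OF assms] residue_data.int_mat_def[OF assms]
  by (auto simp: GL_carrier GL_carrier[OF GL_inv(1)])

lemma GL_assoc:
  assumes "a \<in> GL n" "b \<in> GL n" "c \<in> GL n" shows "a * b * c = a * (b * c)"
  using assms[THEN GL_carrier] by (rule assoc_mult_mat)

section \<open>Integration over cosets\<close>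

locale haar =
  fixes n :: nat and \<mu> :: "'a::function_field adele mat measure"
  assumes haar: "is_haar_measure n \<mu>"
begin

lemma space: "space \<mu> = GL n"
  using haar by (simp add: is_haar_measure_def)

text \<open>Sets outside the sigma-algebra have measure \<open>0\<close>, so invariance shows that cosets are measurable.\<close>

lemma left_coset:
  assumes "h \<in> GL n"
  shows "(*) h ` GL_O n \<in> sets \<mu>" "emeasure \<mu> ((*) h ` GL_O n) = 1"
proof -
  have 1: "emeasure \<mu> (GL_O n) = 1" using haar by (simp add: is_haar_measure_def)
  then have "GL_O n \<in> sets \<mu>" using emeasure_notin_sets by force
  then show *: "emeasure \<mu> ((*) h ` GL_O n) = 1" using haar assms 1 by (simp add: is_haar_measure_def)
  then show "(*) h ` GL_O n \<in> sets \<mu>" using emeasure_notin_sets by force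
qed

text \<open>Every coset has volume 1 and the translate of \<open>f\<close> is constant on it, so
  each coset contributes one value. A sum of indicators as hypothesis covers both exhaustion and
  disjointness when \<open>\<Phi>\<close> is itself an indicator.\<close>

lemma hecke_act_cosets:
  assumes fin: "finite I" and s: "\<And>i. i \<in> I \<Longrightarrow> s i \<in> GL n"
    and part: "\<And>h. h \<in> GL n \<Longrightarrow> \<Phi> h = (\<Sum>i\<in>I. indicator ((*) (s i) ` GL_O n) h)"
    and f: "\<And>i k. i \<in> I \<Longrightarrow> k \<in> GL_O n \<Longrightarrow> f (g * (s i * k)) = f (g * s i)"
  shows "hecke_act \<mu> \<Phi> f g = (\<Sum>i\<in>I. f (g * s i))"
proof -
  let ?C = "\<lambda>i. (*) (s i) ` GL_O n"
  have "has_bochner_integral \<mu> (\<lambda>h. indicator (?C i) h *\<^sub>R f (g * s i)) (measure \<mu> (?C i) *\<^sub>R f (g * s i))"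
    if "i \<in> I" for i
    using left_coset[OF s[OF that]] by (intro has_bochner_integral_indicator) auto
  moreover have "measure \<mu> (?C i) = 1" if "i \<in> I" for i
    using left_coset(2)[OF s[OF that]] by (simp add: measure_def)
  ultimately have "has_bochner_integral \<mu> (\<lambda>h. \<Sum>i\<in>I. indicator (?C i) h *\<^sub>R f (g * s i)) (\<Sum>i\<in>I. f (g * s i))"
    by (intro has_bochner_integral_sum) fastforce
  moreover have "\<Phi> h * f (g * h) = (\<Sum>i\<in>I. indicator (?C i) h *\<^sub>R f (g * s i))" if "h \<in> space \<mu>" for h
    unfolding part[OF that[unfolded space]] sum_distrib_right
    by (rule sum.cong) (auto simp: f indicator_def)
  ultimately have "has_bochner_integral \<mu> (\<lambda>h. \<Phi> h * f (g * h)) (\<Sum>i\<in>I. f (g * s i))"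
    by (subst has_bochner_integral_cong[OF refl _ refl]) auto
  then show ?thesis unfolding hecke_act_def by (rule has_bochner_integral_integral_eq)
qed

end

locale hecke_setting =
  residue_data "coefficient_field (val x)" "integral_adeles :: 'a::function_field adele set"
    "idele_at x (to_completion (val x) \<pi>)" "idele_at x (to_completion (val x) (inverse \<pi>))"
    "reduction_at x" "adele_at x" + haar n \<mu>
  for x :: "'a::function_field place" and \<pi> :: "'a::function_field" and n :: nat
    and \<mu> :: "'a::function_field adele mat measure" +
  fixes r :: nat
  assumes r: "r \<le> n"
begin

abbreviation "\<kappa>\<^sub>x \<equiv> coefficient_field (val x)"
abbreviation "\<xi> \<equiv> xi n x \<pi>"
abbreviation "subspaces \<equiv> Gr (n - r) n \<kappa>\<^sub>x"

lemmas GL_O_K = GL_O_eq_K[OF residue_data_axioms]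

lemma finite_subspaces: "finite subspaces"
  by (rule finite_Gr[OF finite_coefficient_field_place])

lemma GL_O:
  fixes k l :: "'a adele mat"
  shows "k \<in> GL_O n \<Longrightarrow> k \<in> GL n" "k \<in> GL_O n \<Longrightarrow> l \<in> GL_O n \<Longrightarrow> k * l \<in> GL_O n"
    "k \<in> GL_O n \<Longrightarrow> GL_inv n k \<in> GL_O n" "(1\<^sub>m n :: 'a adele mat) \<in> GL_O n"
  by (simp_all add: GL_O_K K_GL K_mult K_inv K_one)

lemma GL_F_GL: "\<gamma> \<in> GL_F n \<Longrightarrow> \<gamma> \<in> GL n"
  by (simp add: GL_F_iff)

lemma xi_reduced_mat:
  assumes w: "VectorSpace.subspace \<kappa>\<^sub>x w (coord_space n)" and b: "is_reduced_basis n \<kappa>\<^sub>x w \<Lambda> b"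
  shows "\<xi> w = reduced_mat n \<Lambda> b"
proof -
  obtain \<Lambda>' b' where "(THE (\<Lambda>, b). is_reduced_basis n \<kappa>\<^sub>x w \<Lambda> b) = (\<Lambda>', b')" "is_reduced_basis n \<kappa>\<^sub>x w \<Lambda>' b'"
    by (rule the_reduced_basis[OF w])
  then show ?thesis using reduced_basis_unique[OF w b] unfolding xi_def reduced_mat_def by auto
qed

lemma Gr_reduced_basis:
  assumes "w \<in> subspaces"
  obtains \<Lambda> b where "VectorSpace.subspace \<kappa>\<^sub>x w (coord_space n)" "is_reduced_basis n \<kappa>\<^sub>x w \<Lambda> b"
    "\<xi> w = reduced_mat n \<Lambda> b" "card \<Lambda> = n - r"
proof -
  have w: "VectorSpace.subspace \<kappa>\<^sub>x w (coord_space n)" using assms by (simp add: Gr_def)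
  obtain \<Lambda> b where b: "is_reduced_basis n \<kappa>\<^sub>x w \<Lambda> b" by (rule the_reduced_basis[OF w])
  then show ?thesis
    using that w xi_reduced_mat[OF w b] reduced_basisD(6)[OF w b] assms by (simp add: Gr_def)
qed

lemma xi_Hecke_coset: assumes "w \<in> subspaces" shows "\<xi> w \<in> Hecke_coset n r"
proof -
  obtain \<Lambda> b where b: "VectorSpace.subspace \<kappa>\<^sub>x w (coord_space n)" "is_reduced_basis n \<kappa>\<^sub>x w \<Lambda> b"
    "\<xi> w = reduced_mat n \<Lambda> b" "card \<Lambda> = n - r" by (rule Gr_reduced_basis[OF assms])
  show ?thesis unfolding b(3)
    by (rule reduced_mat_Hecke_coset)
      (use b_closed[OF b(1,2)] reduced_basisD(1,4)[OF b(1,2)] b(4) r in auto)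
qed

lemma xi_GL: "w \<in> subspaces \<Longrightarrow> \<xi> w \<in> GL n"
  using xi_Hecke_coset Hecke_coset_GL by blast

lemma Phi_eq: "Phi n x \<pi> r = indicator (Hecke_coset n r)"
proof -
  have "mat n n (\<lambda>(i, j). if i \<noteq> j then 0 else if i < r then idele_at x (to_completion (val x) \<pi>) else 1) =
      diag n (uniformizer_at {..<r})"
    by (rule eq_matI) (auto simp: diag_def uniformizer_at_def)
  then show ?thesis unfolding Phi_def Hecke_coset_def GL_O_K by (simp add: Let_def)
qed

lemma Hecke_coset_bi_invariant:
  assumes "k \<in> GL_O n" "h \<in> Hecke_coset n r" "l \<in> GL_O n" shows "k * h * l \<in> Hecke_coset n r"
proof -
  obtain k1 k2 where k: "k1 \<in> K n" "k2 \<in> K n" "h = k1 * diag n (uniformizer_at {..<r}) * k2"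
    using assms(2) unfolding Hecke_coset_def by blast
  have "k * h * l = (k * k1) * diag n (uniformizer_at {..<r}) * (k2 * l)"
    unfolding k(3) using GL_carrier[OF GL_O(1)[OF assms(1)]] K_carrier[OF k(1)] K_carrier[OF k(2)]
      GL_carrier[OF GL_O(1)[OF assms(3)]] diag_carrier
    by (simp add: mat_assoc[where n = n])
  moreover have "k * k1 \<in> K n" "k2 * l \<in> K n" using K_mult assms(1,3) k(1,2) by (simp_all add: GL_O_K)
  ultimately show ?thesis unfolding Hecke_coset_def by blast
qed

text \<open>The left factor \<open>k\<close> prepares the evaluation at another representative of a
  class: the Hecke coset is stable under it, so the translated matrices represent the same set of
  cosets.\<close>

lemma Phi_partition:
  assumes k: "k \<in> GL_O n" and h: "h \<in> GL n"
  shows "Phi n x \<pi> r h = (\<Sum>w\<in>subspaces. indicator ((*) (k * \<xi> w) ` GL_O n) h)"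
proof (cases "h \<in> Hecke_coset n r")
  case True
  have "GL_inv n k * h \<in> Hecke_coset n r"
    using Hecke_coset_bi_invariant[OF GL_O(3)[OF k] True GL_O(4)]
      right_mult_one_mat[OF GL_carrier[OF GL_mult[OF GL_inv(1)[OF GL_O(1)[OF k]] h]]] by metis
  then obtain w \<Lambda> b k' where w: "w \<in> subspaces" and b: "is_reduced_basis n \<kappa>\<^sub>x w \<Lambda> b" and k': "k' \<in> K n"
    and eq: "GL_inv n k * h = reduced_mat n \<Lambda> b * k'"
    using Hecke_coset_cover[OF _ r] by metis
  have ws: "VectorSpace.subspace \<kappa>\<^sub>x w (coord_space n)" using w by (simp add: Gr_def)
  have gl: "k \<in> GL n" "k' \<in> GL n" using GL_O(1) k k' by (auto simp: GL_O_K)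
  have kx: "k * \<xi> w' * l = k * (\<xi> w' * l)" if "w' \<in> subspaces" "l \<in> GL_O n" for w' l
    by (rule GL_assoc[OF gl(1) xi_GL[OF that(1)] GL_O(1)[OF that(2)]])
  have "k * \<xi> w * k' = k * (GL_inv n k * h)"
    unfolding eq using kx[OF w, of k'] k' xi_reduced_mat[OF ws b] by (simp add: GL_O_K)
  also have "\<dots> = h"
    using GL_assoc[OF gl(1) GL_inv(1)[OF gl(1)] h] GL_inv(3)[OF gl(1)] GL_carrier[OF h] by simp
  finally have hw: "h = k * \<xi> w * k'" by simp
  \<comment> \<open>Cancelling \<open>k\<close> leaves two reduced matrices that differ by an
    integral unit on the right, so \<open>reduced_mat_inj\<close> applies.\<close>
  have uniq: "w' = w" if w': "w' \<in> subspaces" "h \<in> (*) (k * \<xi> w') ` GL_O n" for w'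
  proof -
    obtain l where l: "l \<in> GL_O n" "h = k * \<xi> w' * l" using w'(2) by blast
    obtain \<Lambda>' b' where b': "VectorSpace.subspace \<kappa>\<^sub>x w' (coord_space n)" "is_reduced_basis n \<kappa>\<^sub>x w' \<Lambda>' b'"
      "\<xi> w' = reduced_mat n \<Lambda>' b'" by (rule Gr_reduced_basis[OF w'(1)])
    have "k * (\<xi> w * k') = k * (\<xi> w' * l)"
      using hw l(2) kx[OF w, of k'] kx[OF w'(1) l(1)] k' by (simp add: GL_O_K)
    then have "\<xi> w * k' = \<xi> w' * l"
      using GL_left_cancel[OF gl(1)] GL_mult[OF xi_GL[OF w] gl(2)] GL_mult[OF xi_GL[OF w'(1)] GL_O(1)[OF l(1)]] GL_carrier
      by blast
    then have "\<xi> w * k' * GL_inv n k' = \<xi> w' * (l * GL_inv n k')"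
      using GL_assoc[OF xi_GL[OF w'(1)] GL_O(1)[OF l(1)] GL_inv(1)[OF gl(2)]] by simp
    moreover have "\<xi> w * k' * GL_inv n k' = \<xi> w"
      using GL_assoc[OF xi_GL[OF w] gl(2) GL_inv(1)[OF gl(2)]] GL_inv(3)[OF gl(2)] GL_carrier[OF xi_GL[OF w]] by simp
    ultimately have "reduced_mat n \<Lambda> b = reduced_mat n \<Lambda>' b' * (l * GL_inv n k')"
      using b'(3) xi_reduced_mat[OF ws b] by simp
    moreover have "l * GL_inv n k' \<in> K n" using l(1) k' by (simp add: GL_O_K K_mult K_inv)
    ultimately show ?thesis using reduced_mat_inj[OF b'(1,2) ws b] by simp
  qed
  have "(\<Sum>w'\<in>subspaces. indicator ((*) (k * \<xi> w') ` GL_O n) h) =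
      (\<Sum>w'\<in>subspaces. if w' = w then 1 else (0::complex))"
  proof (rule sum.cong)
    fix w' assume w': "w' \<in> subspaces"
    have "h \<in> (*) (k * \<xi> w) ` GL_O n" using hw k' by (simp add: GL_O_K)
    then have "h \<in> (*) (k * \<xi> w') ` GL_O n \<longleftrightarrow> w' = w" using uniq[OF w'] by blast
    then show "indicator ((*) (k * \<xi> w') ` GL_O n) h = (if w' = w then 1 else (0::complex))"
      by (simp add: indicator_def)
  qed simp
  then show ?thesis using True w finite_subspaces by (simp add: Phi_eq)
next
  case False
  have "h \<notin> (*) (k * \<xi> w) ` GL_O n" if "w \<in> subspaces" for w
  proof
    assume "h \<in> (*) (k * \<xi> w) ` GL_O n"
    then obtain l where "l \<in> GL_O n" "h = k * \<xi> w * l" by blast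
    then show False using False Hecke_coset_bi_invariant[OF k xi_Hecke_coset[OF that]] by blast
  qed
  then show ?thesis using False by (simp add: Phi_eq)
qed

text \<open>For \<open>g' = \<gamma> g k\<close> the cosets are represented by
  \<open>\<xi> w\<close> multiplied on the left by the inverse of \<open>k\<close>. Then
  \<open>k\<close> cancels exactly, \<open>\<gamma>\<close> is absorbed by left invariance, and no
  permutation of the subspaces has to be followed.\<close>

lemma hecke_act_Phi:
  assumes f: "f \<in> double_coset_functions n" and g: "g \<in> GL n" and g': "g' \<in> double_coset n g"
  shows "hecke_act \<mu> (Phi n x \<pi> r) f g' = (\<Sum>w\<in>subspaces. f (g * \<xi> w))"
proof -
  obtain \<gamma> k where \<gamma>: "\<gamma> \<in> GL_F n" and k: "k \<in> GL_O n" and eq: "g' = \<gamma> * g * k"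
    using g' unfolding double_coset_def by blast
  let ?k = "GL_inv n k"
  have gl: "\<gamma> \<in> GL n" "k \<in> GL n" "?k \<in> GL n" using \<gamma> k GL_F_GL GL_O by auto
  have g'GL: "g' \<in> GL n" unfolding eq by (intro GL_mult gl g)
  have inv: "f (a * l) = f a" if "a \<in> GL n" "l \<in> GL_O n" for a l
    using f that GL_F_one[of n] GL_carrier[OF that(1)] unfolding double_coset_functions_def
    by (metis (mono_tags, lifting) left_mult_one_mat mem_Collect_eq)
  have "hecke_act \<mu> (Phi n x \<pi> r) f g' = (\<Sum>w\<in>subspaces. f (g' * (?k * \<xi> w)))"
  proof (rule hecke_act_cosets[OF finite_subspaces])
    show "Phi n x \<pi> r h = (\<Sum>w\<in>subspaces. indicator ((*) (?k * \<xi> w) ` GL_O n) h)" if "h \<in> GL n" for h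
      by (rule Phi_partition[OF GL_O(3)[OF k] that])
    fix w assume w: "w \<in> subspaces"
    show kx: "?k * \<xi> w \<in> GL n" by (intro GL_mult gl xi_GL w)
    fix l :: "'a adele mat" assume l: "l \<in> GL_O n"
    show "f (g' * (?k * \<xi> w * l)) = f (g' * (?k * \<xi> w))"
      using inv[OF GL_mult[OF g'GL kx] l] GL_assoc[OF g'GL kx GL_O(1)[OF l]] by simp
  qed
  also have "\<dots> = (\<Sum>w\<in>subspaces. f (g * \<xi> w))"
  proof (rule sum.cong)
    fix w assume w: "w \<in> subspaces"
    note c = GL_carrier[OF gl(1)] GL_carrier[OF gl(2)] GL_carrier[OF gl(3)] GL_carrier[OF g] GL_carrier[OF xi_GL[OF w]]
    have "g' * (?k * \<xi> w) = \<gamma> * g * ((k * ?k) * \<xi> w)"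
      unfolding eq using c by (simp add: mat_assoc[where n = n])
    also have "\<dots> = \<gamma> * (g * \<xi> w) * 1\<^sub>m n"
      unfolding GL_inv(3)[OF gl(2)] using c
      by (simp add: mat_assoc[where n = n] right_mult_one_mat[of _ n n])
    finally show "f (g' * (?k * \<xi> w)) = f (g * \<xi> w)"
      using f \<gamma> GL_O(4) GL_mult[OF g xi_GL[OF w]] by (simp add: double_coset_functions_def)
  qed simp
  finally show ?thesis .
qed

section \<open>Double cosets as vertices\<close>

lemma mem_double_coset:
  fixes g :: "'a adele mat"
  assumes "g \<in> GL n" shows "g \<in> double_coset n g"
proof -
  have "g = 1\<^sub>m n * g * 1\<^sub>m n" using GL_carrier[OF assms] by simp
  then show ?thesis unfolding double_coset_def using GL_F_one GL_O(4) by blast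
qed

lemma double_coset_GL:
  fixes g :: "'a adele mat"
  assumes "g \<in> GL n" "h \<in> double_coset n g" shows "h \<in> GL n"
proof -
  obtain \<gamma> k where "\<gamma> \<in> GL_F n" "k \<in> GL_O n" "h = \<gamma> * g * k" using assms(2) unfolding double_coset_def by blast
  then show ?thesis using GL_mult[OF GL_mult[OF GL_F_GL assms(1)] GL_O(1)] by simp
qed

lemma double_coset_mono:
  fixes g :: "'a adele mat"
  assumes g: "g \<in> GL n" and h: "h \<in> double_coset n g" shows "double_coset n h \<subseteq> double_coset n g"
proof
  fix a assume "a \<in> double_coset n h"
  then obtain \<gamma> k where a: "\<gamma> \<in> GL_F n" "k \<in> GL_O n" "a = \<gamma> * h * k" unfolding double_coset_def by blast
  obtain \<delta> l where hh: "\<delta> \<in> GL_F n" "l \<in> GL_O n" "h = \<delta> * g * l" using h unfolding double_coset_def by blast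
  have "a = (\<gamma> * \<delta>) * g * (l * k)"
    unfolding a(3) hh(3) using GL_carrier[OF g] GL_carrier[OF GL_F_GL[OF a(1)]] GL_carrier[OF GL_F_GL[OF hh(1)]]
      GL_carrier[OF GL_O(1)[OF a(2)]] GL_carrier[OF GL_O(1)[OF hh(2)]]
    by (simp add: mat_assoc[where n = n])
  then show "a \<in> double_coset n g" unfolding double_coset_def using GL_F_mult[OF a(1) hh(1)] GL_O(2)[OF hh(2) a(2)] by blast
qed

lemma double_coset_eq:
  fixes g :: "'a adele mat"
  assumes g: "g \<in> GL n" and h: "h \<in> double_coset n g" shows "double_coset n h = double_coset n g"
proof
  obtain \<gamma> k where hh: "\<gamma> \<in> GL_F n" "k \<in> GL_O n" "h = \<gamma> * g * k" using h unfolding double_coset_def by blast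
  have gl: "\<gamma> \<in> GL n" "k \<in> GL n" using hh GL_F_GL GL_O by auto
  note c = GL_carrier[OF g] GL_carrier[OF gl(1)] GL_carrier[OF gl(2)] GL_carrier[OF GL_inv(1)[OF gl(1)]]
    GL_carrier[OF GL_inv(1)[OF gl(2)]]
  have "GL_inv n \<gamma> * h * GL_inv n k = (GL_inv n \<gamma> * \<gamma>) * g * (k * GL_inv n k)"
    unfolding hh(3) using c by (simp add: mat_assoc[where n = n])
  also have "\<dots> = g" unfolding GL_inv(2)[OF gl(1)] GL_inv(3)[OF gl(2)] using c by simp
  finally have "g \<in> double_coset n h"
    unfolding double_coset_def using GL_F_inv[OF hh(1)] GL_O(3)[OF hh(2)] by (intro CollectI) metis
  then show "double_coset n g \<subseteq> double_coset n h" by (rule double_coset_mono[OF double_coset_GL[OF g h]])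
  show "double_coset n h \<subseteq> double_coset n g" by (rule double_coset_mono[OF g h])
qed

lemma vertex_indicator:
  fixes c :: "'a adele mat set"
  assumes "c \<in> vertices n" shows "indicator c \<in> double_coset_functions n"
proof -
  obtain g0 where g0: "g0 \<in> GL n" "c = double_coset n g0" using assms unfolding vertices_def by blast
  have "\<gamma> * g * k \<in> c \<longleftrightarrow> g \<in> c" if "\<gamma> \<in> GL_F n" "g \<in> GL n" "k \<in> GL_O n" for \<gamma> g k
  proof -
    have "\<gamma> * g * k \<in> double_coset n g" using that unfolding double_coset_def by blast
    then have e: "double_coset n (\<gamma> * g * k) = double_coset n g" by (rule double_coset_eq[OF that(2)])
    have GL: "\<gamma> * g * k \<in> GL n" using that GL_mult GL_F_GL GL_O(1) by blast
    show ?thesis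
      using double_coset_eq[OF g0(1)] mem_double_coset[OF GL] mem_double_coset[OF that(2)] e unfolding g0(2) by blast
  qed
  then show ?thesis by (simp add: double_coset_functions_def indicator_def)
qed

lemma double_coset_function_some:
  fixes g :: "'a adele mat"
  assumes f: "f \<in> double_coset_functions n" and g: "g \<in> GL n"
  shows "f (SOME h. h \<in> double_coset n g) = f g"
proof -
  have "(SOME h. h \<in> double_coset n g) \<in> double_coset n g" by (rule someI[of _ g]) (rule mem_double_coset[OF g])
  then obtain \<gamma> k where "\<gamma> \<in> GL_F n" "k \<in> GL_O n" "(SOME h. h \<in> double_coset n g) = \<gamma> * g * k"
    unfolding double_coset_def by blast
  then show ?thesis using f g by (simp add: double_coset_functions_def)
qed

lemma vertex_some:
  fixes c :: "'a adele mat set"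
  assumes "c \<in> vertices n" "c' \<in> vertices n" shows "(SOME h. h \<in> c) \<in> c' \<longleftrightarrow> c = c'"
proof -
  obtain g where g: "g \<in> GL n" "c = double_coset n g" using assms(1) unfolding vertices_def by blast
  obtain g' where g': "g' \<in> GL n" "c' = double_coset n g'" using assms(2) unfolding vertices_def by blast
  have s: "(SOME h. h \<in> c) \<in> c" unfolding g(2) by (rule someI[of _ g]) (rule mem_double_coset[OF g(1)])
  then show ?thesis using double_coset_eq[OF g(1)] double_coset_eq[OF g'(1)] unfolding g(2) g'(2) by blast
qed

section \<open>Multiplicities\<close>

definition neighbor_count :: "'a adele mat \<Rightarrow> 'a adele mat set \<Rightarrow> complex" where
  "neighbor_count g c = of_nat (card {w \<in> subspaces. double_coset n (g * \<xi> w) = c})"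

lemma neighbor_count_support:
  "{c. neighbor_count g c \<noteq> 0} = (\<lambda>w. double_coset n (g * \<xi> w)) ` subspaces"
  using finite_subspaces by (auto simp: neighbor_count_def card_eq_0_iff)

text \<open>Groups the subspaces by the class they lead to. Used with the value of a test function
  at a chosen representative, and with the constant 1 for the total multiplicity.\<close>

lemma sum_neighbor_count:
  "(\<Sum>c | neighbor_count g c \<noteq> 0. neighbor_count g c * F c) = (\<Sum>w\<in>subspaces. F (double_coset n (g * \<xi> w)))"
proof -
  have "(\<Sum>w\<in>subspaces. F (double_coset n (g * \<xi> w))) =
      (\<Sum>c\<in>(\<lambda>w. double_coset n (g * \<xi> w)) ` subspaces.
         \<Sum>w | w \<in> subspaces \<and> double_coset n (g * \<xi> w) = c. F (double_coset n (g * \<xi> w)))"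
    by (rule sum.image_gen[OF finite_subspaces])
  also have "\<dots> = (\<Sum>c | neighbor_count g c \<noteq> 0. neighbor_count g c * F c)"
    unfolding neighbor_count_support by (rule sum.cong) (auto simp: neighbor_count_def)
  finally show ?thesis by simp
qed

lemma represents_neighbor_count:
  assumes g: "g \<in> GL n"
  shows "represents_hecke \<mu> n (double_coset_functions n) (Phi n x \<pi> r) (double_coset n g) (neighbor_count g)"
  unfolding represents_hecke_def
proof (intro conjI ballI)
  show "finite {c. neighbor_count g c \<noteq> 0}" unfolding neighbor_count_support using finite_subspaces by simp
  show "{c. neighbor_count g c \<noteq> 0} \<subseteq> vertices n"
    unfolding neighbor_count_support vertices_def using GL_mult[OF g xi_GL] by blast
  fix f :: "'a adele mat \<Rightarrow> complex" and g' assume f: "f \<in> double_coset_functions n" and g': "g' \<in> double_coset n g"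
  have "(\<Sum>c | neighbor_count g c \<noteq> 0. neighbor_count g c * f (SOME h. h \<in> c)) =
      (\<Sum>w\<in>subspaces. f (SOME h. h \<in> double_coset n (g * \<xi> w)))"
    by (rule sum_neighbor_count)
  also have "\<dots> = (\<Sum>w\<in>subspaces. f (g * \<xi> w))"
    by (rule sum.cong) (simp_all add: double_coset_function_some[OF f GL_mult[OF g xi_GL]])
  finally show "hecke_act \<mu> (Phi n x \<pi> r) f g' =
      (\<Sum>c | neighbor_count g c \<noteq> 0. neighbor_count g c * f (SOME h. h \<in> c))"
    using hecke_act_Phi[OF f g g'] by simp
qed

text \<open>The indicator of a vertex is itself a test function, and evaluating on it isolates a
  single coefficient.\<close>

lemma represents_hecke_eval:
  assumes m: "represents_hecke \<mu> n (double_coset_functions n) \<Phi> (double_coset n g) m"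
    and g: "g \<in> GL n" and c: "c \<in> vertices n"
  shows "m c = hecke_act \<mu> \<Phi> (indicator c) g"
proof -
  have fin: "finite {c. m c \<noteq> 0}" and sub: "{c. m c \<noteq> 0} \<subseteq> vertices n"
    using m by (auto simp: represents_hecke_def)
  have "hecke_act \<mu> \<Phi> (indicator c) g = (\<Sum>c' | m c' \<noteq> 0. m c' * indicator c (SOME h. h \<in> c'))"
    using m vertex_indicator[OF c] mem_double_coset[OF g] unfolding represents_hecke_def by blast
  also have "\<dots> = (\<Sum>c' | m c' \<noteq> 0. if c' = c then m c else 0)"
    by (rule sum.cong) (use sub vertex_some[OF _ c] in \<open>auto simp: indicator_def\<close>)
  also have "\<dots> = m c" using fin by simp
  finally show ?thesis by simp
qed

lemma hecke_multiplicity_Phi: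
  assumes g: "g \<in> GL n"
  shows "hecke_multiplicity \<mu> n (Phi n x \<pi> r) (double_coset n g) = neighbor_count g"
  unfolding hecke_multiplicity_def
proof (rule the_equality)
  show 1: "represents_hecke \<mu> n (double_coset_functions n) (Phi n x \<pi> r) (double_coset n g) (neighbor_count g)"
    by (rule represents_neighbor_count[OF g])
  fix m assume m: "represents_hecke \<mu> n (double_coset_functions n) (Phi n x \<pi> r) (double_coset n g) m"
  show "m = neighbor_count g"
  proof
    fix c
    show "m c = neighbor_count g c"
    proof (cases "c \<in> vertices n")
      case True
      then show ?thesis using represents_hecke_eval[OF m g] represents_hecke_eval[OF 1 g] by simp
    next
      \<comment> \<open>Sets that are not vertices cannot be tested; there both functions vanish by
        the support condition in \<open>represents_hecke\<close>.\<close>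
      case False
      then have "m c = 0" "neighbor_count g c = 0" using m 1 unfolding represents_hecke_def by blast+
      then show ?thesis by simp
    qed
  qed
qed

lemma hecke_edges_Phi:
  assumes g: "g \<in> GL n"
  shows "(double_coset n g, c, m) \<in> hecke_edges \<mu> n (Phi n x \<pi> r) \<longleftrightarrow> m = neighbor_count g c \<and> m \<noteq> 0"
  using g by (auto simp: hecke_edges_def hecke_multiplicity_Phi[OF g] vertices_def)

text \<open>Specializing the central factor to 1 leaves exactly the invariance under
  \<open>GL_F\<close> and \<open>GL_O\<close>, so a formula valid for all test functions holds for
  these forms.\<close>

lemma unramified_subset: "unramified_automorphic_forms \<mu> n \<subseteq> double_coset_functions n"
proof
  fix f assume "f \<in> unramified_automorphic_forms \<mu> n"
  then have a: "\<forall>\<gamma>\<in>GL_F n. \<forall>z\<in>center_A n. \<forall>g\<in>GL n. f (\<gamma> * z * g) = f g"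
    and k: "\<forall>g\<in>GL n. \<forall>k\<in>GL_O n. f (g * k) = f g"
    by (auto simp: unramified_automorphic_forms_def automorphic_forms_def)
  have "(1 :: 'a adele) \<cdot>\<^sub>m 1\<^sub>m n \<in> center_A n"
    unfolding center_A_def by (intro CollectI exI[of _ "1 :: 'a adele"]) simp
  moreover have "(1 :: 'a adele) \<cdot>\<^sub>m 1\<^sub>m n = 1\<^sub>m n" by (rule eq_matI) auto
  ultimately have z: "1\<^sub>m n \<in> (center_A n :: 'a adele mat set)" by simp
  have "f (\<gamma> * g * l) = f g" if "\<gamma> \<in> GL_F n" "g \<in> GL n" "l \<in> GL_O n" for \<gamma> g l
  proof -
    have "f (\<gamma> * g * l) = f (\<gamma> * g)" using k that(3) GL_mult[OF GL_F_GL[OF that(1)] that(2)] by simp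
    also have "\<dots> = f (\<gamma> * 1\<^sub>m n * g)" using GL_carrier[OF GL_F_GL[OF that(1)]] by simp
    also have "\<dots> = f g" using a that z by blast
    finally show ?thesis .
  qed
  then show "f \<in> double_coset_functions n" by (simp add: double_coset_functions_def)
qed

end

theorem theorem2p6:
  fixes x :: "'a::function_field place" and \<pi> :: 'a and n r :: nat
    and \<mu> :: "'a adele mat measure" and g :: "'a adele mat"
  assumes "n \<ge> 1" and "r \<in> {1..n}" and "val x \<pi> = 1"
    and "is_haar_measure n \<mu>" and "g \<in> GL n"
  shows
    "hecke_neighbors \<mu> n (Phi n x \<pi> r) (double_coset n g) =
       {double_coset n (g * xi n x \<pi> w) | w. w \<in> Gr (n - r) n (coefficient_field (val x))} \<and>
     (\<forall>c m. (double_coset n g, c, m) \<in> hecke_edges \<mu> n (Phi n x \<pi> r) \<longrightarrow>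
       m = of_nat (card {w \<in> Gr (n - r) n (coefficient_field (val x)).
                         double_coset n (g * xi n x \<pi> w) = c})) \<and>
     (\<Sum>(c, c', m)\<in>{e \<in> hecke_edges \<mu> n (Phi n x \<pi> r). fst e = double_coset n g}. m) =
       of_nat (card (Gr (n - r) n (coefficient_field (val x)))) \<and>
     represents_hecke \<mu> n (unramified_automorphic_forms \<mu> n) (Phi n x \<pi> r) (double_coset n g)
       (hecke_multiplicity \<mu> n (Phi n x \<pi> r) (double_coset n g))"
proof -
  interpret residue_data "coefficient_field (val x)" integral_adeles
    "idele_at x (to_completion (val x) \<pi>)" "idele_at x (to_completion (val x) (inverse \<pi>))"
    "reduction_at x" "adele_at x"
    by (rule residue_data_place) fact
  interpret haar n \<mu> by unfold_locales fact
  interpret hecke_setting x \<pi> n \<mu> r using assms(2) by unfold_locales simp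
  note g = \<open>g \<in> GL n\<close>
  note edges = hecke_edges_Phi[OF g]
  show ?thesis
  proof (intro conjI allI impI)
    have "hecke_neighbors \<mu> n (Phi n x \<pi> r) (double_coset n g) = {c. neighbor_count g c \<noteq> 0}"
      unfolding hecke_neighbors_def edges by simp
    then show "hecke_neighbors \<mu> n (Phi n x \<pi> r) (double_coset n g) =
        {double_coset n (g * xi n x \<pi> w) | w. w \<in> subspaces}"
      unfolding neighbor_count_support by blast
    show "m = of_nat (card {w \<in> subspaces. double_coset n (g * xi n x \<pi> w) = c})"
      if "(double_coset n g, c, m) \<in> hecke_edges \<mu> n (Phi n x \<pi> r)" for c m
      using that unfolding edges by (simp add: neighbor_count_def)
    \<comment> \<open>An edge leaving the class of \<open>g\<close> is determined by its target, so
      summing over edges is summing over the support of \<open>neighbor_count g\<close>.\<close>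
    have E: "{e \<in> hecke_edges \<mu> n (Phi n x \<pi> r). fst e = double_coset n g} =
        (\<lambda>c. (double_coset n g, c, neighbor_count g c)) ` {c. neighbor_count g c \<noteq> 0}"
      using edges by (auto simp: image_iff)
    have "(\<Sum>(c, c', m)\<in>{e \<in> hecke_edges \<mu> n (Phi n x \<pi> r). fst e = double_coset n g}. m) =
        (\<Sum>c | neighbor_count g c \<noteq> 0. neighbor_count g c * 1)"
      unfolding E by (subst sum.reindex) (auto simp: inj_on_def)
    also have "\<dots> = of_nat (card subspaces)"
      by (subst sum_neighbor_count) simp
    finally show "(\<Sum>(c, c', m)\<in>{e \<in> hecke_edges \<mu> n (Phi n x \<pi> r). fst e = double_coset n g}. m) =
        of_nat (card subspaces)" .
    show "represents_hecke \<mu> n (unramified_automorphic_forms \<mu> n) (Phi n x \<pi> r) (double_coset n g)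
        (hecke_multiplicity \<mu> n (Phi n x \<pi> r) (double_coset n g))"
      using represents_neighbor_count[OF g] unramified_subset
      unfolding hecke_multiplicity_Phi[OF g] represents_hecke_def by blast
  qed
qed

end
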